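(* Let $\alpha$ be an endomorphism of a unital commutative $C^*$-algebra $A$, and let $L$ be a transfer operator for $(A,\alpha)$. Let $K_\alpha:=\overline{A\alpha(A)A}\cap J(M_L)$. Then the canonical map $j_A:A\to A\rtimes_{\alpha,L}\mathbb{N}$ is injective if and only if $L$ is faithful on $K_\alpha$.
   Context: Endomorphisms are $*$-homomorphisms $\alpha:A\to A$, not assumed unital or injective. A transfer operator for $(A,\alpha)$ is a continuous linear map $L:A\to A$ that is positive ($a\ge 0\Rightarrow L(a)\ge 0$) and satisfies $L(\alpha(a)b)=aL(b)$ for all $a,b\in A$. $L$ is faithful on an ideal $I$ of $A$ if: whenever $a\in I$ and $L(a^*a)=0$, then $a=0$. Toeplitz algebra: $\mathcal{T}(A,\alpha,L)$ is the universal unital $C^*$-algebra generated by a copy of $A$ (via a unital homomorphism $i_A:A\to\mathcal{T}(A,\alpha,L)$, which is injective) and an element $S$ with $S\,i_A(a)=i_A(\alpha(a))S$ and $S^*i_A(a)S=i_A(L(a))$ for all $a\in A$. The bimodule $M_L$: let $A_L$ be a copy of the vector space $A$ with right action $m\cdot a=m\alpha(a)$ and $A$-valued form $\langle m,n\rangle_L=L(m^*n)$; let $N=\{a\in A_L:\langle a,a\rangle_L=0\}$, let $q:A_L\to A_L/N$ be the quotient map, and let $M_L$ be the right Hilbert $A$-module obtained by completing $A_L/N$. Left multiplication induces a homomorphism $\phi:A\to\mathcal{L}(M_L)$ (adjointable operators), $\phi(a)q(b)=q(ab)$. $\mathcal{K}(M_L)$ denotes the compact operators (closed span of $\Theta_{x,y}:z\mapsto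 x\cdot\langle y,z\rangle$), and $J(M_L):=\phi^{-1}(\mathcal{K}(M_L))$. $\overline{A\alpha(A)A}$ denotes the closed linear span of the products $a\alpha(b)c$, $a,b,c\in A$. Crossed product: a redundancy is a pair $(i_A(a),k)$ with $a\in A$, $k\in\overline{i_A(A)SS^*i_A(A)}$ (closed linear span) and $i_A(a)i_A(b)S=k\,i_A(b)S$ for all $b\in A$. Exel's crossed product $A\rtimes_{\alpha,L}\mathbb{N}$ is the quotient of $\mathcal{T}(A,\alpha,L)$ by the closed two-sided ideal generated by $\{i_A(a)-k: (i_A(a),k)\text{ is a redundancy with } a\in\overline{A\alpha(A)A}\}$; $Q$ denotes the quotient map, and $j_A:=Q\circ i_A$. *)

theory Defs
  imports
    "HOL-Analysis.Analysis"
    "HOL-Algebra.QuotRing"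
    "HOL-Library.Poly_Mapping"
begin

section \<open>Unital $C^*$-algebras as a type class\<close>

class scaleC =
  fixes scaleC :: "complex \<Rightarrow> 'a \<Rightarrow> 'a"  (infixr \<open>*\<^sub>C\<close> 75)

class star =
  fixes star :: "'a \<Rightarrow> 'a"

text \<open>The class \<open>monoid_mult\<close> rather than \<open>ring_1\<close> supplies the unit, so that the zero
  algebra is not excluded.\<close>

class unital_cstar_algebra = banach + real_normed_algebra + monoid_mult + scaleC + star +
  assumes scaleC_add_right: "c *\<^sub>C (x + y) = c *\<^sub>C x + c *\<^sub>C y"
    and scaleC_add_left: "(c + d) *\<^sub>C x = c *\<^sub>C x + d *\<^sub>C x"
    and scaleC_scaleC: "c *\<^sub>C d *\<^sub>C x = (c * d) *\<^sub>C x"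
    and scaleC_of_real: "complex_of_real r *\<^sub>C x = r *\<^sub>R x"
    and norm_scaleC: "norm (c *\<^sub>C x) = cmod c * norm x"
    and mult_scaleC_left: "c *\<^sub>C x * y = c *\<^sub>C (x * y)"
    and mult_scaleC_right: "x * c *\<^sub>C y = c *\<^sub>C (x * y)"
    and star_star: "star (star x) = x"
    and star_add: "star (x + y) = star x + star y"
    and star_scaleC: "star (c *\<^sub>C x) = cnj c *\<^sub>C star x"
    and star_mult: "star (x * y) = star y * star x"
    and cstar_identity: "norm (star x * x) = (norm x)\<^sup>2"

class comm_unital_cstar_algebra = unital_cstar_algebra + comm_monoid_mult

definition cpositive :: "'a::unital_cstar_algebra \<Rightarrow> bool" where
  "cpositive a \<longleftrightarrow> (\<exists>b. a = star b * b)"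

definition clinear_map ::
  "('a::unital_cstar_algebra \<Rightarrow> 'b::unital_cstar_algebra) \<Rightarrow> bool" where
  "clinear_map f \<longleftrightarrow> (\<forall>x y. f (x + y) = f x + f y) \<and> (\<forall>c x. f (c *\<^sub>C x) = c *\<^sub>C f x)"

definition star_hom ::
  "('a::unital_cstar_algebra \<Rightarrow> 'b::unital_cstar_algebra) \<Rightarrow> bool" where
  "star_hom f \<longleftrightarrow> clinear_map f \<and> (\<forall>x y. f (x * y) = f x * f y) \<and> (\<forall>x. f (star x) = star (f x))"

definition transfer_operator ::
  "('a::unital_cstar_algebra \<Rightarrow> 'a) \<Rightarrow> ('a \<Rightarrow> 'a) \<Rightarrow> bool" where
  "transfer_operator \<alpha> L \<longleftrightarrow>
     clinear_map L \<and> continuous_on UNIV L \<and> (\<forall>a. cpositive a \<longrightarrow> cpositive (L a)) \<and>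
     (\<forall>a b. L (\<alpha> a * b) = a * L b)"

definition faithful_on :: "('a::unital_cstar_algebra \<Rightarrow> 'a) \<Rightarrow> 'a set \<Rightarrow> bool" where
  "faithful_on L I \<longleftrightarrow> (\<forall>a\<in>I. L (star a * a) = 0 \<longrightarrow> a = 0)"


section \<open>Hausdorff completion with respect to a seminorm\<close>

text \<open>For a seminorm \<open>p\<close> on \<open>'v\<close>, the completion of the normed space obtained from
  \<open>'v\<close> by dividing out the null space of \<open>p\<close>. Its elements are the equivalence classes of
  \<open>p\<close>-Cauchy sequences in \<open>'v\<close>, and maps on \<open>'v\<close> are extended to it termwise.\<close>

definition pcauchy :: "('v::ab_group_add \<Rightarrow> real) \<Rightarrow> (nat \<Rightarrow> 'v) \<Rightarrow> bool" where
  "pcauchy p X \<longleftrightarrow> (\<forall>e>0. \<exists>M. \<forall>m\<ge>M. \<forall>n\<ge>M. p (X m - X n) < e)"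

definition pclass :: "('v::ab_group_add \<Rightarrow> real) \<Rightarrow> (nat \<Rightarrow> 'v) \<Rightarrow> (nat \<Rightarrow> 'v) set" where
  "pclass p X = {Y. pcauchy p Y \<and> (\<lambda>n. p (X n - Y n)) \<longlonglongrightarrow> 0}"

definition completion :: "('v::ab_group_add \<Rightarrow> real) \<Rightarrow> (nat \<Rightarrow> 'v) set set" where
  "completion p = {pclass p X |X. pcauchy p X}"

definition cpl_embed :: "('v::ab_group_add \<Rightarrow> real) \<Rightarrow> 'v \<Rightarrow> (nat \<Rightarrow> 'v) set" where
  "cpl_embed p v = pclass p (\<lambda>n. v)"

definition cpl_lift ::
  "('v::ab_group_add \<Rightarrow> real) \<Rightarrow> ('v \<Rightarrow> 'v) \<Rightarrow> (nat \<Rightarrow> 'v) set \<Rightarrow> (nat \<Rightarrow> 'v) set" where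
  "cpl_lift p f x = (\<Union>X\<in>x. pclass p (\<lambda>n. f (X n)))"

definition cpl_lift2 ::
  "('v::ab_group_add \<Rightarrow> real) \<Rightarrow> ('v \<Rightarrow> 'v \<Rightarrow> 'v)
    \<Rightarrow> (nat \<Rightarrow> 'v) set \<Rightarrow> (nat \<Rightarrow> 'v) set \<Rightarrow> (nat \<Rightarrow> 'v) set" where
  "cpl_lift2 p f x y = (\<Union>X\<in>x. \<Union>Y\<in>y. pclass p (\<lambda>n. f (X n) (Y n)))"

definition cpl_norm :: "('v::ab_group_add \<Rightarrow> real) \<Rightarrow> (nat \<Rightarrow> 'v) set \<Rightarrow> real" where
  "cpl_norm p x = (THE r. \<forall>X\<in>x. (\<lambda>n. p (X n)) \<longlonglongrightarrow> r)"


section \<open>$C^*$-algebras with explicit carrier\<close>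

text \<open>The algebras built below depend on \<open>\<alpha>\<close> and \<open>L\<close>, hence cannot be types; they are
  records extending the \<open>ring\<close> record.\<close>

record 'x cstar_alg = "'x ring" +
  scal :: "complex \<Rightarrow> 'x \<Rightarrow> 'x"
  adj :: "'x \<Rightarrow> 'x"
  nrm :: "'x \<Rightarrow> real"

inductive_set cspan :: "('x, 'm) cstar_alg_scheme \<Rightarrow> 'x set \<Rightarrow> 'x set"
  for V :: "('x, 'm) cstar_alg_scheme" and B :: "'x set" where
  zero: "\<zero>\<^bsub>V\<^esub> \<in> cspan V B"
| add: "b \<in> B \<Longrightarrow> x \<in> cspan V B \<Longrightarrow> scal V c b \<oplus>\<^bsub>V\<^esub> x \<in> cspan V B"

definition norm_closure :: "('x, 'm) cstar_alg_scheme \<Rightarrow> 'x set \<Rightarrow> 'x set" where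
  "norm_closure V X = {x \<in> carrier V. \<forall>e>0. \<exists>y\<in>X. nrm V (x \<ominus>\<^bsub>V\<^esub> y) < e}"

abbreviation closed_cspan :: "('x, 'm) cstar_alg_scheme \<Rightarrow> 'x set \<Rightarrow> 'x set" where
  "closed_cspan V B \<equiv> norm_closure V (cspan V B)"

definition closed_ideal_gen :: "('x, 'm) cstar_alg_scheme \<Rightarrow> 'x set \<Rightarrow> 'x set" where
  "closed_ideal_gen V B = \<Inter> {I. ideal I V \<and> norm_closure V I \<subseteq> I \<and> B \<subseteq> I}"

definition quotient_alg :: "('x, 'm) cstar_alg_scheme \<Rightarrow> 'x set \<Rightarrow> 'x set cstar_alg" where
  "quotient_alg V I =
     \<lparr>carrier = carrier (V Quot I), mult = mult (V Quot I), one = one (V Quot I),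
      zero = zero (V Quot I), add = add (V Quot I),
      scal = (\<lambda>c X. \<Union>x\<in>X. I +>\<^bsub>V\<^esub> scal V c x),
      adj = (\<lambda>X. \<Union>x\<in>X. I +>\<^bsub>V\<^esub> adj V x),
      nrm = (\<lambda>X. Inf (nrm V ` X))\<rparr>"


section \<open>The Toeplitz algebra\<close>

text \<open>The free unital complex $*$-algebra on a copy of \<open>A\<close> and an element \<open>S\<close>, the
  involution on the copy of \<open>A\<close> being that of \<open>A\<close>: finitely supported complex functions on
  words, with convolution product.\<close>

datatype 'a letter = Elem 'a | Gen | Gen_adj

instantiation list :: (type) monoid_add
begin
definition zero_list :: "'a list" where "zero_list = []"
definition plus_list :: "'a list \<Rightarrow> 'a list \<Rightarrow> 'a list" where "plus_list = append"
instance by standard (simp_all add: zero_list_def plus_list_def)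
end

type_synonym 'a free_alg = "'a letter list \<Rightarrow>\<^sub>0 complex"

definition letter :: "'a letter \<Rightarrow> 'a free_alg" where
  "letter l = Poly_Mapping.single [l] 1"

definition free_scale :: "complex \<Rightarrow> 'a free_alg \<Rightarrow> 'a free_alg" where
  "free_scale c x = Poly_Mapping.single [] c * x"

fun letter_adj :: "'a::star letter \<Rightarrow> 'a letter" where
  "letter_adj (Elem a) = Elem (star a)"
| "letter_adj Gen = Gen_adj"
| "letter_adj Gen_adj = Gen"

definition free_star :: "'a::star free_alg \<Rightarrow> 'a free_alg" where
  "free_star x =
     (\<Sum>w\<in>Poly_Mapping.keys x.
        Poly_Mapping.single (rev (map letter_adj w)) (cnj (Poly_Mapping.lookup x w)))"

definition cstar_seminorm :: "('a::star free_alg \<Rightarrow> real) \<Rightarrow> bool" where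
  "cstar_seminorm p \<longleftrightarrow>
     (\<forall>x y. p (x + y) \<le> p x + p y) \<and> (\<forall>c x. p (free_scale c x) = cmod c * p x) \<and>
     (\<forall>x y. p (x * y) \<le> p x * p y) \<and> (\<forall>x. p (free_star x * x) = (p x)\<^sup>2)"

text \<open>The relations say that \<open>A\<close> is mapped by a unital homomorphism (compatibility with
  the involution is built into the free algebra), $S a = \alpha(a) S$ and $S^* a S = L(a)$.\<close>

definition toeplitz_relations ::
  "('a::unital_cstar_algebra \<Rightarrow> 'a) \<Rightarrow> ('a \<Rightarrow> 'a) \<Rightarrow> 'a free_alg set" where
  "toeplitz_relations \<alpha> L =
     {letter (Elem (a + b)) - (letter (Elem a) + letter (Elem b)) |a b. True} \<union>
     {letter (Elem (c *\<^sub>C a)) - free_scale c (letter (Elem a)) |c a. True} \<union>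
     {letter (Elem (a * b)) - letter (Elem a) * letter (Elem b) |a b. True} \<union>
     {letter (Elem 1) - 1} \<union>
     {letter Gen * letter (Elem a) - letter (Elem (\<alpha> a)) * letter Gen |a. True} \<union>
     {letter Gen_adj * letter (Elem a) * letter Gen - letter (Elem (L a)) |a. True}"

text \<open>Every representation of the relations in a $C^*$-algebra induces a $C^*$-seminorm
  on the free algebra vanishing on the relations, and each such seminorm arises this way by
  completing. The universal $C^*$-algebra is therefore the Hausdorff completion with
  respect to the largest of them. (The supremum is finite because $*$-homomorphisms between
  $C^*$-algebras are contractive and $S^*S = L(1)$.)\<close>

definition toeplitz_seminorm ::
  "('a::unital_cstar_algebra \<Rightarrow> 'a) \<Rightarrow> ('a \<Rightarrow> 'a) \<Rightarrow> 'a free_alg \<Rightarrow> real" where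
  "toeplitz_seminorm \<alpha> L x =
     Sup {p x |p. cstar_seminorm p \<and> (\<forall>r\<in>toeplitz_relations \<alpha> L. p r = 0)}"

definition toeplitz ::
  "('a::unital_cstar_algebra \<Rightarrow> 'a) \<Rightarrow> ('a \<Rightarrow> 'a) \<Rightarrow> (nat \<Rightarrow> 'a free_alg) set cstar_alg" where
  "toeplitz \<alpha> L =
     (let p = toeplitz_seminorm \<alpha> L in
      \<lparr>carrier = completion p,
       mult = cpl_lift2 p (*),
       one = cpl_embed p 1,
       zero = cpl_embed p 0,
       add = cpl_lift2 p (+),
       scal = (\<lambda>c. cpl_lift p (free_scale c)),
       adj = cpl_lift p free_star,
       nrm = cpl_norm p\<rparr>)"

definition i_A ::
  "('a::unital_cstar_algebra \<Rightarrow> 'a) \<Rightarrow> ('a \<Rightarrow> 'a) \<Rightarrow> 'a \<Rightarrow> (nat \<Rightarrow> 'a free_alg) set" where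
  "i_A \<alpha> L a = cpl_embed (toeplitz_seminorm \<alpha> L) (letter (Elem a))"

definition toeplitz_S ::
  "('a::unital_cstar_algebra \<Rightarrow> 'a) \<Rightarrow> ('a \<Rightarrow> 'a) \<Rightarrow> (nat \<Rightarrow> 'a free_alg) set" where
  "toeplitz_S \<alpha> L = cpl_embed (toeplitz_seminorm \<alpha> L) (letter Gen)"


section \<open>The Hilbert module and its operators\<close>

type_synonym 'a hmod = "(nat \<Rightarrow> 'a) set"

definition module_seminorm :: "('a::unital_cstar_algebra \<Rightarrow> 'a) \<Rightarrow> 'a \<Rightarrow> real" where
  "module_seminorm L m = sqrt (norm (L (star m * m)))"

definition M_L :: "('a::unital_cstar_algebra \<Rightarrow> 'a) \<Rightarrow> 'a hmod set" where
  "M_L L = completion (module_seminorm L)"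

definition mod_zero :: "('a::unital_cstar_algebra \<Rightarrow> 'a) \<Rightarrow> 'a hmod" where
  "mod_zero L = cpl_embed (module_seminorm L) 0"

definition mod_add :: "('a::unital_cstar_algebra \<Rightarrow> 'a) \<Rightarrow> 'a hmod \<Rightarrow> 'a hmod \<Rightarrow> 'a hmod" where
  "mod_add L = cpl_lift2 (module_seminorm L) (+)"

definition mod_scale ::
  "('a::unital_cstar_algebra \<Rightarrow> 'a) \<Rightarrow> complex \<Rightarrow> 'a hmod \<Rightarrow> 'a hmod" where
  "mod_scale L c = cpl_lift (module_seminorm L) ((*\<^sub>C) c)"

definition mod_act ::
  "('a::unital_cstar_algebra \<Rightarrow> 'a) \<Rightarrow> ('a \<Rightarrow> 'a) \<Rightarrow> 'a hmod \<Rightarrow> 'a \<Rightarrow> 'a hmod" where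
  "mod_act \<alpha> L x a = cpl_lift (module_seminorm L) (\<lambda>m. m * \<alpha> a) x"

definition mod_inner ::
  "('a::unital_cstar_algebra \<Rightarrow> 'a) \<Rightarrow> 'a hmod \<Rightarrow> 'a hmod \<Rightarrow> 'a" where
  "mod_inner L x y = (THE v. \<forall>X\<in>x. \<forall>Y\<in>y. (\<lambda>n. L (star (X n) * Y n)) \<longlonglongrightarrow> v)"

definition mod_norm :: "('a::unital_cstar_algebra \<Rightarrow> 'a) \<Rightarrow> 'a hmod \<Rightarrow> real" where
  "mod_norm L x = sqrt (norm (mod_inner L x x))"

definition is_adjoint ::
  "('a::unital_cstar_algebra \<Rightarrow> 'a) \<Rightarrow> ('a hmod \<Rightarrow> 'a hmod) \<Rightarrow> ('a hmod \<Rightarrow> 'a hmod) \<Rightarrow> bool" where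
  "is_adjoint L T U \<longleftrightarrow>
     U \<in> M_L L \<rightarrow>\<^sub>E M_L L \<and> (\<forall>x\<in>M_L L. \<forall>y\<in>M_L L. mod_inner L (T x) y = mod_inner L x (U y))"

definition adjointable_ops ::
  "('a::unital_cstar_algebra \<Rightarrow> 'a) \<Rightarrow> ('a hmod \<Rightarrow> 'a hmod) cstar_alg" where
  "adjointable_ops L =
     \<lparr>carrier = {T \<in> M_L L \<rightarrow>\<^sub>E M_L L. \<exists>U. is_adjoint L T U},
      mult = (\<lambda>T U. compose (M_L L) T U),
      one = (\<lambda>x\<in>M_L L. x),
      zero = (\<lambda>x\<in>M_L L. mod_zero L),
      add = (\<lambda>T U. \<lambda>x\<in>M_L L. mod_add L (T x) (U x)),
      scal = (\<lambda>c T. \<lambda>x\<in>M_L L. mod_scale L c (T x)),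
      adj = (\<lambda>T. THE U. is_adjoint L T U),
      nrm = (\<lambda>T. Sup {mod_norm L (T x) |x. x \<in> M_L L \<and> mod_norm L x \<le> 1})\<rparr>"

definition Theta ::
  "('a::unital_cstar_algebra \<Rightarrow> 'a) \<Rightarrow> ('a \<Rightarrow> 'a) \<Rightarrow> 'a hmod \<Rightarrow> 'a hmod \<Rightarrow> 'a hmod \<Rightarrow> 'a hmod" where
  "Theta \<alpha> L x y = (\<lambda>z\<in>M_L L. mod_act \<alpha> L x (mod_inner L y z))"

definition compact_ops ::
  "('a::unital_cstar_algebra \<Rightarrow> 'a) \<Rightarrow> ('a \<Rightarrow> 'a) \<Rightarrow> ('a hmod \<Rightarrow> 'a hmod) set" where
  "compact_ops \<alpha> L =
     closed_cspan (adjointable_ops L) {Theta \<alpha> L x y |x y. x \<in> M_L L \<and> y \<in> M_L L}"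

definition left_act ::
  "('a::unital_cstar_algebra \<Rightarrow> 'a) \<Rightarrow> 'a \<Rightarrow> 'a hmod \<Rightarrow> 'a hmod" where
  "left_act L a = (\<lambda>x\<in>M_L L. cpl_lift (module_seminorm L) (\<lambda>m. a * m) x)"

definition J_M ::
  "('a::unital_cstar_algebra \<Rightarrow> 'a) \<Rightarrow> ('a \<Rightarrow> 'a) \<Rightarrow> 'a set" where
  "J_M \<alpha> L = {a. left_act L a \<in> compact_ops \<alpha> L}"

text \<open>The real span used here is a complex subspace, because scalars can be absorbed
  into \<open>a\<close>.\<close>

definition range_ideal :: "('a::unital_cstar_algebra \<Rightarrow> 'a) \<Rightarrow> 'a set" where
  "range_ideal \<alpha> = closure (span {a * \<alpha> b * c |a b c. True})"

definition K_ideal ::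
  "('a::unital_cstar_algebra \<Rightarrow> 'a) \<Rightarrow> ('a \<Rightarrow> 'a) \<Rightarrow> 'a set" where
  "K_ideal \<alpha> L = range_ideal \<alpha> \<inter> J_M \<alpha> L"


section \<open>Exel's crossed product\<close>

definition redundancy ::
  "('a::unital_cstar_algebra \<Rightarrow> 'a) \<Rightarrow> ('a \<Rightarrow> 'a) \<Rightarrow> 'a \<Rightarrow> (nat \<Rightarrow> 'a free_alg) set \<Rightarrow> bool" where
  "redundancy \<alpha> L a k \<longleftrightarrow>
     (let T = toeplitz \<alpha> L; i = i_A \<alpha> L; S = toeplitz_S \<alpha> L in
        k \<in> closed_cspan T {i b \<otimes>\<^bsub>T\<^esub> S \<otimes>\<^bsub>T\<^esub> adj T S \<otimes>\<^bsub>T\<^esub> i c |b c. True} \<and>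
        (\<forall>b. i a \<otimes>\<^bsub>T\<^esub> i b \<otimes>\<^bsub>T\<^esub> S = k \<otimes>\<^bsub>T\<^esub> i b \<otimes>\<^bsub>T\<^esub> S))"

definition redundancy_ideal ::
  "('a::unital_cstar_algebra \<Rightarrow> 'a) \<Rightarrow> ('a \<Rightarrow> 'a) \<Rightarrow> (nat \<Rightarrow> 'a free_alg) set set" where
  "redundancy_ideal \<alpha> L =
     closed_ideal_gen (toeplitz \<alpha> L)
       {i_A \<alpha> L a \<ominus>\<^bsub>toeplitz \<alpha> L\<^esub> k |a k. a \<in> range_ideal \<alpha> \<and> redundancy \<alpha> L a k}"

definition crossed_product ::
  "('a::unital_cstar_algebra \<Rightarrow> 'a) \<Rightarrow> ('a \<Rightarrow> 'a) \<Rightarrow> (nat \<Rightarrow> 'a free_alg) set set cstar_alg" where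
  "crossed_product \<alpha> L = quotient_alg (toeplitz \<alpha> L) (redundancy_ideal \<alpha> L)"

definition Q_map ::
  "('a::unital_cstar_algebra \<Rightarrow> 'a) \<Rightarrow> ('a \<Rightarrow> 'a)
    \<Rightarrow> (nat \<Rightarrow> 'a free_alg) set \<Rightarrow> (nat \<Rightarrow> 'a free_alg) set set" where
  "Q_map \<alpha> L x = redundancy_ideal \<alpha> L +>\<^bsub>toeplitz \<alpha> L\<^esub> x"

definition j_A ::
  "('a::unital_cstar_algebra \<Rightarrow> 'a) \<Rightarrow> ('a \<Rightarrow> 'a) \<Rightarrow> 'a \<Rightarrow> (nat \<Rightarrow> 'a free_alg) set set" where
  "j_A \<alpha> L = Q_map \<alpha> L \<circ> i_A \<alpha> L"

end

theory Submission
  imports Defs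
begin

text \<open>If \<open>a\<close> lies in \<open>K_\<alpha>\<close> and \<open>L (a\<^sup>* a) = 0\<close>, then \<open>a\<close> acts as zero on \<open>M_L\<close>, so \<open>(i_A a, 0)\<close> is a
  redundancy and \<open>j_A a = 0\<close>.

  Conversely, a redundancy \<open>(i_A b, k)\<close> has \<open>b \<in> K_\<alpha>\<close>, and in the Fock representation \<open>i_A b - k\<close>
  lives on the vacuum level, where it acts as \<open>b\<close>. It is therefore killed by two $C^*$-seminorms on
  the Toeplitz algebra: the norm of the Fock representation modulo \<open>K_\<alpha>\<close>, and the limit of the
  norms of the restrictions to the levels \<open>\<ge> n\<close>. If the first one vanishes on \<open>a\<close>, then \<open>a\<close> and all
  \<open>L\<^sup>n (g\<^sup>* a\<^sup>* a g)\<close> lie in \<open>K_\<alpha>\<close>. Choosing \<open>g\<close> to cut off the small spectral values of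
  \<open>a\<^sup>* a\<close>, faithfulness of \<open>L\<close> on \<open>K_\<alpha>\<close> shows inductively that these elements are nonzero, so \<open>a\<close> acts on
  every level with norm bounded below, and the second seminorm does not vanish on \<open>a\<close>.\<close>

text \<open>To see that an element avoids the redundancy ideal, it suffices to find a closed ideal
  that contains every i_A b - k but not the element. Each C*-seminorm on the free algebra that
  vanishes on the relations provides one, its null space, so everything reduces to the choice of
  seminorms. Two are combined because neither detects enough alone: the one modulo K_\<alpha> is
  identically zero when K_\<alpha> is all of A, the one at high levels is identically zero when L =
  0. The first brings the elements on all levels into K_\<alpha>, the only place where faithfulness
  can be applied; the second then cannot vanish unless a = 0.

  The analysis uses no spectra or characters. Positive means of the form b^* b, nonnegative spectrum
  is replaced by the condition that the norm of t - h is at most t for some t \<ge> 0, and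
  continuous functions of a are replaced by square roots. A recurring device is an element u = c + i
  b with c, b self-adjoint and u^* u a scalar, which bounds the norm of its real part c.\<close>

instance comm_unital_cstar_algebra \<subseteq> comm_ring
  by standard (rule distrib_right)

section \<open>Positivity in commutative $C^*$-algebras\<close>

lemma scaleC_zero_left [simp]: "0 *\<^sub>C (x::'a::unital_cstar_algebra) = 0"
  using scaleC_of_real[of 0 x] by simp

lemma scaleC_zero_right [simp]: "c *\<^sub>C (0::'a::unital_cstar_algebra) = 0"
  using scaleC_add_right[of c 0 "0::'a"] by simp

lemma scaleC_one [simp]: "1 *\<^sub>C (x::'a::unital_cstar_algebra) = x"
  using scaleC_of_real[of 1 x] by simp

lemma scaleC_minus_one: "(-1) *\<^sub>C (x::'a::unital_cstar_algebra) = - x"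
  using scaleC_of_real[of "-1" x] by simp

lemma scaleC_minus_right: "c *\<^sub>C (- x) = - (c *\<^sub>C (x::'a::unital_cstar_algebra))"
  using scaleC_add_right[of c x "-x"] by (simp add: eq_neg_iff_add_eq_0 add.commute)

lemma star_zero [simp]: "star (0::'a::unital_cstar_algebra) = 0"
  using star_scaleC[of 0 "0::'a"] by simp

lemma star_minus: "star (- x) = - star (x::'a::unital_cstar_algebra)"
  using star_scaleC[of "-1" x] by (simp add: scaleC_minus_one)

lemma star_diff: "star (x - y) = star x - star (y::'a::unital_cstar_algebra)"
  using star_add[of x "-y"] by (simp add: star_minus)

lemma star_scaleR: "star (r *\<^sub>R x) = r *\<^sub>R star (x::'a::unital_cstar_algebra)"
  using star_scaleC[of "complex_of_real r" x] by (simp add: scaleC_of_real)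

lemma star_one [simp]: "star (1::'a::unital_cstar_algebra) = 1"
  by (metis mult.left_neutral mult.right_neutral star_mult star_star)

lemma star_sum: "star (sum f I) = (\<Sum>i\<in>I. star (f i :: 'a::unital_cstar_algebra))"
  by (induction I rule: infinite_finite_induct) (auto simp: star_add)

lemma norm_star [simp]: "norm (star x) = norm (x::'a::unital_cstar_algebra)"
proof -
  have le: "norm x \<le> norm (star x)" for x :: 'a
  proof -
    have "norm x * norm x \<le> norm (star x) * norm x"
      using cstar_identity[of x] norm_mult_ineq[of "star x" x] by (simp add: power2_eq_square)
    then show ?thesis by (cases "x = 0") auto
  qed
  show ?thesis using le[of x] le[of "star x"] by (simp add: star_star)
qed

lemma star_mult_self_eq_0_iff [simp]: "star x * x = 0 \<longleftrightarrow> x = (0::'a::unital_cstar_algebra)"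
  using cstar_identity[of x] by auto

lemma norm_one_le: "norm (1::'a::unital_cstar_algebra) \<le> 1"
  using cstar_identity[of "1::'a"]
  by (metis mult.left_neutral norm_ge_zero order.order_iff_strict power2_eq_square
      mult_cancel_right2 star_one zero_le_one)

lemma selfadjoint_decomposition:
  fixes a :: "'a::unital_cstar_algebra"
  obtains x y where "star x = x" "star y = y" "a = x + \<i> *\<^sub>C y"
proof
  let ?x = "(1/2) *\<^sub>R (a + star a)" and ?y = "(- \<i> / 2) *\<^sub>C (a - star a)"
  show "star ?x = ?x" by (simp add: star_scaleR star_add star_star add.commute)
  show "star ?y = ?y"
    using scaleC_minus_right[of "\<i>/2" "a - star a"]
    by (simp add: star_scaleC star_diff star_star)
       (metis add.inverse_inverse minus_diff_eq minus_divide_left mult_minus1 scaleC_minus_one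
         scaleC_minus_right scaleC_scaleC)
  have "\<i> *\<^sub>C ?y = (1/2) *\<^sub>R (a - star a)"
    using scaleC_of_real[of "1/2" "a - star a"] by (simp add: scaleC_scaleC)
  then show "a = ?x + \<i> *\<^sub>C ?y"
    by (simp flip: scaleR_add_right scaleR_2)
qed

section \<open>Square roots by iteration\<close>

text \<open>The square root of \<open>1 - y\<close> is \<open>1 - w\<close> with \<open>w = (y + w\<^sup>2) / 2\<close>. Iterating this equation
  from \<open>0\<close>, the steps for \<open>y\<close> are dominated in norm by those for the real number \<open>1\<close>, which
  increase to a limit; this includes the boundary case \<open>norm y = 1\<close>.\<close>

primrec sqrt_iter :: "'a::real_normed_algebra \<Rightarrow> nat \<Rightarrow> 'a" where
  "sqrt_iter y 0 = 0"
| "sqrt_iter y (Suc n) = (1/2) *\<^sub>R (y + sqrt_iter y n * sqrt_iter y n)"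

lemma sqrt_iter_one_bounds: "0 \<le> sqrt_iter (1::real) n \<and> sqrt_iter (1::real) n \<le> 1"
proof (induction n)
  case (Suc n)
  then have "sqrt_iter (1::real) n * sqrt_iter 1 n \<le> 1 * 1" by (intro mult_mono) auto
  then show ?case using Suc by auto
qed simp

text \<open>Both bounds have to run through one induction: consecutive differences of squares factor
  by commutativity as (w' - w)(w' + w), and the bound on the iterates controls the second
  factor.\<close>

lemma norm_sqrt_iter_diff_le:
  fixes y :: "'a::comm_unital_cstar_algebra"
  assumes "norm y \<le> 1"
  shows "norm (sqrt_iter y n) \<le> sqrt_iter 1 n \<and>
    norm (sqrt_iter y (Suc n) - sqrt_iter y n) \<le> sqrt_iter (1::real) (Suc n) - sqrt_iter 1 n"
proof (induction n)
  case 0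
  then show ?case using assms by simp
next
  case (Suc n)
  let ?w = "sqrt_iter y" and ?r = "sqrt_iter (1::real)"
  have 1: "norm (?w (Suc n)) \<le> ?r (Suc n)"
    using Suc norm_triangle_ineq[of "?w (Suc n) - ?w n" "?w n"]
    by (simp del: sqrt_iter.simps)
  have "?w (Suc (Suc n)) - ?w (Suc n) = (1/2) *\<^sub>R (?w (Suc n) * ?w (Suc n) - ?w n * ?w n)"
    by (simp add: scaleR_diff_right[symmetric] del: scaleR_diff_right)
  also have "\<dots> = (1/2) *\<^sub>R ((?w (Suc n) - ?w n) * (?w (Suc n) + ?w n))"
    by (simp add: algebra_simps del: sqrt_iter.simps)
  finally have "norm (?w (Suc (Suc n)) - ?w (Suc n))
      \<le> 1/2 * (norm (?w (Suc n) - ?w n) * norm (?w (Suc n) + ?w n))"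
    by (simp add: norm_mult_ineq del: sqrt_iter.simps)
  also have "\<dots> \<le> 1/2 * ((?r (Suc n) - ?r n) * (?r (Suc n) + ?r n))"
  proof (intro mult_left_mono mult_mono)
    show "norm (?w (Suc n) + ?w n) \<le> ?r (Suc n) + ?r n"
      using 1 Suc norm_triangle_ineq[of "?w (Suc n)" "?w n"] by linarith
    show "norm (?w (Suc n) - ?w n) \<le> ?r (Suc n) - ?r n" using Suc by blast
    then show "0 \<le> ?r (Suc n) - ?r n" by (meson norm_ge_zero order_trans)
  qed auto
  also have "\<dots> = ?r (Suc (Suc n)) - ?r (Suc n)" by (simp add: algebra_simps)
  finally show ?case using 1 by blast
qed

lemma sqrt_one_minus:
  fixes y :: "'a::comm_unital_cstar_algebra"
  assumes y: "star y = y" "norm y \<le> 1"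
  obtains w where "star w = w" "norm w \<le> 1" "(1 - w) * (1 - w) = 1 - y"
proof -
  let ?w = "sqrt_iter y" and ?r = "sqrt_iter (1::real)"
  have inc: "incseq ?r"
    using norm_sqrt_iter_diff_le[OF y(2)]
    by (intro incseq_SucI) (meson diff_ge_0_iff_ge norm_ge_zero order_trans)
  obtain l where "?r \<longlonglongrightarrow> l"
    using incseq_convergent[OF inc] sqrt_iter_one_bounds by blast
  then have cr: "Cauchy ?r" by (rule LIMSEQ_imp_Cauchy)
  have diff: "norm (?w (m + k) - ?w m) \<le> ?r (m + k) - ?r m" for m k
  proof (induction k)
    case (Suc k)
    have "norm (?w (m + Suc k) - ?w m)
        \<le> norm (?w (Suc (m + k)) - ?w (m + k)) + norm (?w (m + k) - ?w m)"
      by (metis add_Suc_right diff_add_cancel norm_triangle_ineq add_diff_eq)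
    then show ?case using Suc norm_sqrt_iter_diff_le[OF y(2), of "m + k"]
      by (simp del: sqrt_iter.simps)
  qed simp
  have "Cauchy ?w"
  proof (rule CauchyI)
    fix e :: real assume "e > 0"
    then obtain M where M: "\<And>m n. m \<ge> M \<Longrightarrow> n \<ge> M \<Longrightarrow> norm (?r m - ?r n) < e"
      using CauchyD[OF cr] by blast
    have lt: "norm (?w m - ?w n) < e" if mn: "M \<le> m" "m \<le> n" for m n
    proof -
      have "norm (?w m - ?w n) \<le> ?r n - ?r m"
        using diff[of m "n - m"] mn by (simp add: norm_minus_commute)
      also have "\<dots> < e" using M[of m n] mn by simp
      finally show ?thesis .
    qed
    show "\<exists>M. \<forall>m\<ge>M. \<forall>n\<ge>M. norm (?w m - ?w n) < e"
      using lt by (metis nle_le norm_minus_commute)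
  qed
  then obtain w where w: "?w \<longlonglongrightarrow> w" using Cauchy_convergent_iff convergentD by blast
  have nw: "norm w \<le> 1"
    by (rule LIMSEQ_le_const2[OF tendsto_norm[OF w]])
      (use norm_sqrt_iter_diff_le[OF y(2)] sqrt_iter_one_bounds order_trans in blast)
  have st: "star (?w n) = ?w n" for n
    by (induction n) (auto simp: star_scaleR star_add star_mult y)
  have "star w = w"
  proof -
    have "(\<lambda>n. star (?w n)) \<longlonglongrightarrow> star w"
      using w by (subst tendsto_iff) (simp add: tendsto_iff dist_norm flip: star_diff)
    then show ?thesis using w st LIMSEQ_unique by simp
  qed
  moreover have "w = (1/2) *\<^sub>R (y + w * w)"
  proof (rule LIMSEQ_unique)
    show "(\<lambda>n. ?w (Suc n)) \<longlonglongrightarrow> w" using w by (rule LIMSEQ_Suc)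
    show "(\<lambda>n. ?w (Suc n)) \<longlonglongrightarrow> (1/2) *\<^sub>R (y + w * w)"
      unfolding sqrt_iter.simps by (intro tendsto_intros w)
  qed
  then have "w + w = y + w * w"
    by (metis scaleR_half_double scaleR_right_distrib)
  then have "(1 - w) * (1 - w) = 1 - y"
    by (simp add: algebra_simps)
  ultimately show thesis using that nw by blast
qed


section \<open>Order and norm\<close>

lemma cpositive_selfadjoint: "cpositive h \<Longrightarrow> star h = h"
  by (auto simp: cpositive_def star_mult star_star)

lemma cpositive_star_mult [simp]: "cpositive (star a * a)"
  by (auto simp: cpositive_def)

lemma cpositive_square: "star x = x \<Longrightarrow> cpositive (x * x)"
  by (metis cpositive_star_mult)

lemma cpositive_scaleR: "0 \<le> r \<Longrightarrow> cpositive h \<Longrightarrow> cpositive (r *\<^sub>R h)"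
proof -
  assume r: "0 \<le> r" and "cpositive h"
  then obtain b where "h = star b * b" by (auto simp: cpositive_def)
  then have "r *\<^sub>R h = star (sqrt r *\<^sub>R b) * (sqrt r *\<^sub>R b)"
    using r by (simp add: star_scaleR)
  then show ?thesis by (metis cpositive_star_mult)
qed

lemma cpositive_mult:
  fixes h k :: "'a::comm_unital_cstar_algebra"
  assumes "cpositive h" "cpositive k"
  shows "cpositive (h * k)"
proof -
  obtain a b where "h = star a * a" "k = star b * b" using assms by (auto simp: cpositive_def)
  then have "h * k = star (a * b) * (a * b)" by (simp add: star_mult ac_simps)
  then show ?thesis by simp
qed

text \<open>Writing h = t(1 - y) puts h within reach of the square root of 1 - y. The third
  conclusion says that the root satisfies the same ball condition, so it is itself a square of this
  kind and hence positive.\<close>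

lemma cpositive_of_ball:
  fixes h :: "'a::comm_unital_cstar_algebra"
  assumes h: "star h = h" and t: "0 \<le> t" "norm (t *\<^sub>R 1 - h) \<le> t"
  obtains c where "star c = c" "h = c * c" "\<exists>s\<ge>0. norm (s *\<^sub>R 1 - c) \<le> s"
proof (cases "t = 0")
  case True
  have "\<exists>s\<ge>0. norm (s *\<^sub>R (1::'a) - 0) \<le> s" by (intro exI[of _ 0]) simp
  then show thesis using that[of 0] t True by simp
next
  case False
  then have "t > 0" using t by simp
  define y where "y = (1/t) *\<^sub>R (t *\<^sub>R 1 - h)"
  have "star y = y" by (simp add: y_def star_scaleR star_diff h)
  moreover have "norm y \<le> 1" using t \<open>t > 0\<close> by (simp add: y_def)
  ultimately obtain w where w: "star w = w" "norm w \<le> 1" "(1 - w) * (1 - w) = 1 - y"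
    by (rule sqrt_one_minus)
  define c where "c = sqrt t *\<^sub>R (1 - w)"
  have "star c = c" by (simp add: c_def star_scaleR star_diff w)
  moreover have "c * c = h"
  proof -
    have "c * c = t *\<^sub>R ((1 - w) * (1 - w))" using t by (simp add: c_def del: scaleR_diff_right)
    then show ?thesis using \<open>t > 0\<close> by (simp add: w y_def scaleR_diff_right)
  qed
  moreover have "norm (sqrt t *\<^sub>R 1 - c) \<le> sqrt t"
    using w t by (simp add: c_def scaleR_diff_right mult_left_le)
  ultimately show thesis using that t real_sqrt_ge_zero by metis
qed

text \<open>The radius comes from a = x + i y: by commutativity a^* a = x^2 + y^2, and the balls for
  the two squares, with radii the squared norms of x and y, add up.\<close>

lemma cpositive_ball:
  fixes h :: "'a::comm_unital_cstar_algebra"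
  assumes "cpositive h"
  obtains t where "0 \<le> t" "norm (t *\<^sub>R 1 - h) \<le> t"
proof -
  have square: "norm ((norm x)\<^sup>2 *\<^sub>R 1 - x * x) \<le> (norm x)\<^sup>2" if x: "star x = x" for x :: 'a
  proof (cases "x = 0")
    case False
    define z where "z = (1 / norm x) *\<^sub>R x"
    have z: "star z = z" "norm z = 1" using False by (simp_all add: z_def star_scaleR x)
    obtain w where w: "star w = w" "(1 - w) * (1 - w) = 1 - z * z"
      using sqrt_one_minus[of "z * z"] z
      by (metis mult.left_neutral norm_mult_ineq star_mult)
    \<comment> \<open>Since (1 - w)^2 + z^2 = 1, this gives u^* u = 1. The real part 1 - w then has
      norm at most 1, and so has its square 1 - z^2.\<close>
    define u where "u = (1 - w) + \<i> *\<^sub>C z"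
    have su: "star u = (1 - w) - \<i> *\<^sub>C z"
      using scaleC_minus_one[of "\<i> *\<^sub>C z"]
      by (simp add: u_def star_add star_diff star_scaleC w z scaleC_scaleC)
    have "star u * u = (1 - w) * (1 - w) - (\<i> *\<^sub>C z) * (\<i> *\<^sub>C z)"
      by (simp only: su) (simp add: u_def algebra_simps)
    also have "\<dots> = 1"
      by (simp add: w mult_scaleC_left mult_scaleC_right scaleC_scaleC scaleC_minus_one)
    finally have "(norm u)\<^sup>2 \<le> 1" using cstar_identity[of u] norm_one_le[where 'a='a] by simp
    then have nu: "norm u \<le> 1" using power2_le_imp_le[of "norm u" 1] by simp
    have "norm (1 - w) \<le> 1"
    proof -
      have "u + star u = 2 *\<^sub>R (1 - w)" by (simp add: su) (simp add: u_def scaleR_2 algebra_simps)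
      then have "2 * norm (1 - w) = norm (u + star u)" by (metis abs_numeral norm_scaleR real_norm_def)
      then show ?thesis using norm_triangle_ineq[of u "star u"] nu by simp
    qed
    then have "norm (1 - z * z) \<le> 1"
      by (metis w(2) norm_mult_ineq order_trans mult_le_one norm_ge_zero)
    then have "norm ((norm x)\<^sup>2 *\<^sub>R (1 - z * z)) \<le> (norm x)\<^sup>2"
      by (simp add: mult_left_le)
    moreover have "(norm x)\<^sup>2 *\<^sub>R (z * z) = x * x"
      using False by (simp add: z_def power2_eq_square)
    ultimately show ?thesis by (simp add: scaleR_diff_right)
  qed (simp add: power2_eq_square)
  obtain a where a: "h = star a * a" using assms by (auto simp: cpositive_def)
  obtain x y where xy: "star x = x" "star y = y" "a = x + \<i> *\<^sub>C y"
    by (rule selfadjoint_decomposition)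
  have sa: "star a = x - \<i> *\<^sub>C y"
    using scaleC_minus_one[of "\<i> *\<^sub>C y"]
    by (simp add: xy star_add star_scaleC scaleC_scaleC)
  have "h = x * x - (\<i> *\<^sub>C y) * (\<i> *\<^sub>C y)"
    unfolding a sa by (simp add: xy(3) algebra_simps)
  then have "h = x * x + y * y"
    by (simp add: mult_scaleC_left mult_scaleC_right scaleC_scaleC scaleC_minus_one)
  then have "((norm x)\<^sup>2 + (norm y)\<^sup>2) *\<^sub>R 1 - h
      = ((norm x)\<^sup>2 *\<^sub>R 1 - x * x) + ((norm y)\<^sup>2 *\<^sub>R 1 - y * y)"
    by (simp add: scaleR_add_left)
  then have "norm (((norm x)\<^sup>2 + (norm y)\<^sup>2) *\<^sub>R 1 - h) \<le> (norm x)\<^sup>2 + (norm y)\<^sup>2"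
    using square[OF xy(1)] square[OF xy(2)] norm_triangle_le by (metis add_mono)
  then show thesis using that[of "(norm x)\<^sup>2 + (norm y)\<^sup>2"] by simp
qed

text \<open>The ball condition makes sums tractable: a sum of two elements b^* b is not visibly of
  that form, but radii add.\<close>

lemma cpositive_iff:
  fixes h :: "'a::comm_unital_cstar_algebra"
  shows "cpositive h \<longleftrightarrow> star h = h \<and> (\<exists>t\<ge>0. norm (t *\<^sub>R 1 - h) \<le> t)"
  by (metis cpositive_ball cpositive_of_ball cpositive_selfadjoint cpositive_square)

lemma cpositive_sqrt:
  fixes h :: "'a::comm_unital_cstar_algebra"
  assumes "cpositive h"
  obtains c where "cpositive c" "h = c * c"
  by (metis assms cpositive_iff cpositive_of_ball)

lemma cpositive_add:
  fixes h k :: "'a::comm_unital_cstar_algebra"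
  assumes "cpositive h" "cpositive k"
  shows "cpositive (h + k)"
proof -
  obtain s t where st: "0 \<le> s" "norm (s *\<^sub>R 1 - h) \<le> s" "0 \<le> t" "norm (t *\<^sub>R 1 - k) \<le> t"
    using assms by (metis cpositive_iff)
  have "(s + t) *\<^sub>R 1 - (h + k) = (s *\<^sub>R 1 - h) + (t *\<^sub>R 1 - k)"
    by (simp add: algebra_simps)
  then have "norm ((s + t) *\<^sub>R 1 - (h + k)) \<le> s + t"
    using st norm_triangle_le by (metis add_mono)
  moreover have "star (h + k) = h + k"
    using assms by (simp add: star_add cpositive_selfadjoint)
  ultimately show ?thesis using st unfolding cpositive_iff by (metis add_nonneg_nonneg)
qed

lemma cpositive_zero [simp]: "cpositive 0"
  by (metis cpositive_star_mult star_zero mult_zero_left)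

lemma cpositive_sum:
  fixes f :: "'b \<Rightarrow> 'a::comm_unital_cstar_algebra"
  shows "(\<And>i. i \<in> I \<Longrightarrow> cpositive (f i)) \<Longrightarrow> cpositive (sum f I)"
  by (induction I rule: infinite_finite_induct) (auto intro: cpositive_add)

lemma cpositive_norm_minus:
  fixes h :: "'a::comm_unital_cstar_algebra"
  assumes "star h = h" "norm h \<le> r"
  shows "cpositive (r *\<^sub>R 1 - h)"
proof -
  have "0 \<le> r" using assms(2) norm_ge_zero order_trans by blast
  then show ?thesis using assms unfolding cpositive_iff by (auto simp: star_diff star_scaleR)
qed

text \<open>With h = a^2 and \<open>norm k *\<^sub>R 1 - h\<close> = b^2, the element u = a + i b
  satisfies u^* u = norm k, and a is its real part. The norm of h is the square of the norm of
  a.\<close>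

lemma cpositive_norm_mono:
  fixes h k :: "'a::comm_unital_cstar_algebra"
  assumes h: "cpositive h" and hk: "cpositive (k - h)"
  shows "norm h \<le> norm k"
proof -
  have "cpositive k" using cpositive_add[OF h hk] by simp
  then have "cpositive (norm k *\<^sub>R 1 - k)"
    by (simp add: cpositive_norm_minus cpositive_selfadjoint)
  then have "cpositive (norm k *\<^sub>R 1 - h)" using cpositive_add[OF hk] by fastforce
  then obtain b where b: "cpositive b" "norm k *\<^sub>R 1 - h = b * b" by (rule cpositive_sqrt)
  obtain a where a: "cpositive a" "h = a * a" using h by (rule cpositive_sqrt)
  define u where "u = a + \<i> *\<^sub>C b"
  have su: "star u = a - \<i> *\<^sub>C b"
    using scaleC_minus_one[of "\<i> *\<^sub>C b"]
    by (simp add: u_def star_add star_scaleC scaleC_scaleC a b cpositive_selfadjoint)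
  have "star u * u = a * a - (\<i> *\<^sub>C b) * (\<i> *\<^sub>C b)"
    by (simp only: su) (simp add: u_def algebra_simps)
  also have "\<dots> = norm k *\<^sub>R 1"
    using a(2) b(2)
    by (simp add: mult_scaleC_left mult_scaleC_right scaleC_scaleC scaleC_minus_one)
      (metis add.commute diff_add_cancel)
  finally have nu: "(norm u)\<^sup>2 \<le> norm k"
    using cstar_identity[of u] mult_left_le[OF norm_one_le[where 'a='a] norm_ge_zero[of k]] by simp
  have "u + star u = 2 *\<^sub>R a" by (simp add: su) (simp add: u_def scaleR_2)
  then have "2 * norm a = norm (u + star u)" by (metis abs_numeral norm_scaleR real_norm_def)
  then have "norm a \<le> norm u" using norm_triangle_ineq[of u "star u"] by simp
  then have "(norm a)\<^sup>2 \<le> norm k" using nu by (meson norm_ge_zero order_trans power_mono)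
  then show ?thesis
    using cstar_identity[of a] a by (simp add: cpositive_selfadjoint)
qed

lemma cpositive_antisym:
  fixes h :: "'a::comm_unital_cstar_algebra"
  assumes "cpositive h" "cpositive (- h)"
  shows "h = 0"
  using cpositive_norm_mono[of h 0] assms by simp

text \<open>\<open>g = \<bar>x\<bar> + x\<close> is twice the positive part of \<open>x = h - r\<close>.\<close>

lemma spectral_cutoff:
  fixes h :: "'a::comm_unital_cstar_algebra"
  assumes h: "cpositive h" and r: "0 \<le> r" "r < norm h"
  obtains g where "star g = g" "g * g \<noteq> 0" "cpositive (g * g * (h - r *\<^sub>R 1))"
proof -
  define x where "x = h - r *\<^sub>R 1"
  have sx: "star x = x" using h by (simp add: x_def star_diff star_scaleR cpositive_selfadjoint)
  then obtain m where m: "cpositive m" "x * x = m * m"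
    using cpositive_sqrt cpositive_square by metis
  then obtain n where n: "cpositive n" "m = n * n" by (metis cpositive_sqrt)
  define g where "g = m + x"
  have sg: "star g = g" using m sx by (simp add: g_def star_add cpositive_selfadjoint)
  have "x * g = m * g" by (simp add: g_def algebra_simps m)
  then have "g * g * x = g * (m * g)" by (metis mult.assoc mult.commute)
  also have "\<dots> = (n * g) * (n * g)" by (simp add: n ac_simps)
  finally have "cpositive (g * g * x)"
    using cpositive_square[of "n * g"] n sg
    by (simp add: star_mult cpositive_selfadjoint mult.commute)
  moreover have "g * g \<noteq> 0"
  proof
    assume "g * g = 0"
    then have "g = 0" using sg by (metis star_mult_self_eq_0_iff)
    \<comment> \<open>If the positive part of h - r vanished, r - h would be positive and the norm
      of h at most r.\<close>
    then have "r *\<^sub>R 1 - h = m" by (simp add: g_def x_def algebra_simps eq_neg_iff_add_eq_0)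
    then have "norm h \<le> norm (r *\<^sub>R (1::'a))" using cpositive_norm_mono[OF h, of "r *\<^sub>R 1"] m by simp
    also have "\<dots> \<le> r" using r norm_one_le[where 'a='a] by (simp add: mult_left_le)
    finally show False using r by simp
  qed
  ultimately show thesis using that sg by (simp add: x_def)
qed

text \<open>This is contractivity of *-homomorphisms, with a seminorm in place of the target
  algebra. The device u^* u = scalar, together with q(1) \<le> 1, settles squares of positive
  elements, and a^* a is such a square.\<close>

lemma cstar_seminorm_le_norm:
  fixes q :: "'a::comm_unital_cstar_algebra \<Rightarrow> real"
  assumes add: "\<And>x y. q (x + y) \<le> q x + q y"
    and scale: "\<And>c x. q (c *\<^sub>C x) = cmod c * q x"
    and mult: "\<And>x y. q (x * y) \<le> q x * q y"
    and cstar: "\<And>x. q (star x * x) = (q x)\<^sup>2"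
  shows "q a \<le> norm a"
proof -
  have q0: "q 0 = 0" using scale[of 0 0] by simp
  have qneg: "q (- x) = q x" for x using scale[of "-1" x] by (simp add: scaleC_minus_one)
  have qpos: "0 \<le> q x" for x using add[of x "-x"] by (simp add: q0 qneg)
  have q1: "q 1 \<le> 1"
    using cstar[of 1] qpos[of 1]
    by (metis mult.left_neutral mult_cancel_right2 order.order_iff_strict power2_eq_square
        star_one zero_le_one)
  have qstar: "q (star x) = q x" for x
  proof -
    have le: "q x \<le> q (star x)" for x
      using cstar[of x] mult[of "star x" x] qpos[of x] qpos[of "star x"]
      by (cases "q x = 0") (auto simp: power2_eq_square)
    show ?thesis using le[of x] le[of "star x"] by (simp add: star_star)
  qed
  have qscaleR: "q (r *\<^sub>R x) = \<bar>r\<bar> * q x" for r x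
    using scale[of "complex_of_real r" x] by (simp add: scaleC_of_real)
  have sq: "q (c * c) \<le> norm (c * c)" if c: "cpositive c" for c
  proof -
    have "cpositive (norm (c * c) *\<^sub>R 1 - c * c)"
      by (intro cpositive_norm_minus) (simp_all add: star_mult cpositive_selfadjoint c)
    then obtain b where b: "cpositive b" "norm (c * c) *\<^sub>R 1 - c * c = b * b"
      by (rule cpositive_sqrt)
    define u where "u = c + \<i> *\<^sub>C b"
    have su: "star u = c - \<i> *\<^sub>C b"
      using scaleC_minus_one[of "\<i> *\<^sub>C b"]
      by (simp add: u_def star_add star_scaleC scaleC_scaleC c b cpositive_selfadjoint)
    have "star u * u = c * c - (\<i> *\<^sub>C b) * (\<i> *\<^sub>C b)"
      by (simp only: su) (simp add: u_def algebra_simps)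
    also have "\<dots> = norm (c * c) *\<^sub>R 1"
      using b(2)
      by (simp add: mult_scaleC_left mult_scaleC_right scaleC_scaleC scaleC_minus_one)
        (metis add.commute diff_add_cancel)
    finally have nu: "(q u)\<^sup>2 \<le> norm (c * c)"
      using cstar[of u] mult_left_le[OF q1 norm_ge_zero[of "c * c"]] by (simp add: qscaleR)
    have "u + star u = 2 *\<^sub>R c" by (simp add: su) (simp add: u_def scaleR_2)
    then have "2 * q c = q (u + star u)" by (simp add: qscaleR)
    then have "q c \<le> q u" using add[of u "star u"] by (simp add: qstar)
    then have "(q c)\<^sup>2 \<le> norm (c * c)" using nu qpos by (meson order_trans power_mono)
    then show ?thesis using cstar[of c] c by (simp add: cpositive_selfadjoint)
  qed
  have "(q a)\<^sup>2 \<le> (norm a)\<^sup>2"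
    using sq cpositive_sqrt[of "star a * a"] by (metis cstar cstar_identity cpositive_star_mult)
  then show ?thesis by (rule power2_le_imp_le) simp
qed


section \<open>Completions and the Toeplitz algebra\<close>

text \<open>Only the additive structure is recorded, so one locale serves the Toeplitz algebra, the
  module M_L and the Fock module. Homogeneity enters through the Lipschitz constants of the maps
  that are lifted.\<close>

locale seminorm =
  fixes p :: "'v::ab_group_add \<Rightarrow> real"
  assumes triangle: "p (x + y) \<le> p x + p y"
    and minus: "p (- x) = p x"
    and zero: "p 0 = 0"
begin

lemma nonneg: "0 \<le> p x"
  using triangle[of x "- x"] by (simp add: minus zero)

lemma diff_commute: "p (x - y) = p (y - x)"
  using minus[of "x - y"] by simp

lemma triangle_diff: "p (x - z) \<le> p (x - y) + p (y - z)"
  using triangle[of "x - y" "y - z"] by simp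

lemma abs_diff_le: "\<bar>p x - p y\<bar> \<le> p (x - y)"
  using triangle[of "x - y" y] triangle[of "y - x" x] by (simp add: diff_commute abs_le_iff)

lemma tendsto_zero_le:
  assumes "(\<lambda>n. p (Y n)) \<longlonglongrightarrow> 0" "\<And>n. p (X n) \<le> C * p (Y n)"
  shows "(\<lambda>n. p (X n)) \<longlonglongrightarrow> 0"
proof (rule tendsto_sandwich[OF _ _ tendsto_const])
  show "(\<lambda>n. C * p (Y n)) \<longlonglongrightarrow> 0" using tendsto_mult_right_zero[OF assms(1)] .
qed (auto simp: nonneg assms(2))

lemma tendsto_zero_add:
  assumes "(\<lambda>n. p (X n)) \<longlonglongrightarrow> 0" "(\<lambda>n. p (Y n)) \<longlonglongrightarrow> 0"
  shows "(\<lambda>n. p (X n + Y n)) \<longlonglongrightarrow> 0"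
proof (rule tendsto_sandwich[OF _ _ tendsto_const])
  show "(\<lambda>n. p (X n) + p (Y n)) \<longlonglongrightarrow> 0" using tendsto_add[OF assms] by simp
qed (auto simp: nonneg triangle)

lemma tendsto_zero_trans:
  assumes "(\<lambda>n. p (X n - Y n)) \<longlonglongrightarrow> 0" "(\<lambda>n. p (Y n - Z n)) \<longlonglongrightarrow> 0"
  shows "(\<lambda>n. p (X n - Z n)) \<longlonglongrightarrow> 0"
  using tendsto_zero_add[OF assms] by simp

lemma pcauchy_const [simp]: "pcauchy p (\<lambda>n. v)"
  by (auto simp: pcauchy_def zero)

lemma pcauchy_lipschitz:
  assumes "pcauchy p X" "\<And>u v. p (f u - f v) \<le> C * p (u - v)"
  shows "pcauchy p (\<lambda>n. f (X n))"
  unfolding pcauchy_def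
proof (intro allI impI)
  fix e :: real assume "e > 0"
  \<comment> \<open>The Lipschitz constant may be zero or negative, while the division below wants a
    positive one.\<close>
  define D where "D = max C 1"
  have "D > 0" by (simp add: D_def)
  have le: "p (f u - f v) \<le> D * p (u - v)" for u v
    using assms(2)[of u v] mult_right_mono[of C D "p (u - v)"] nonneg by (simp add: D_def)
  obtain M where M: "\<And>m n. m \<ge> M \<Longrightarrow> n \<ge> M \<Longrightarrow> p (X m - X n) < e / D"
    using assms(1) \<open>e > 0\<close> \<open>D > 0\<close> unfolding pcauchy_def by (meson divide_pos_pos)
  have "p (f (X m) - f (X n)) < e" if "m \<ge> M" "n \<ge> M" for m n
    using le[of "X m" "X n"] M[OF that] \<open>D > 0\<close> by (simp add: pos_less_divide_eq mult.commute)
  then show "\<exists>M. \<forall>m\<ge>M. \<forall>n\<ge>M. p (f (X m) - f (X n)) < e" by blast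
qed

lemma pcauchy_add:
  assumes "pcauchy p X" "pcauchy p Y"
  shows "pcauchy p (\<lambda>n. X n + Y n)"
  unfolding pcauchy_def
proof (intro allI impI)
  fix e :: real assume "e > 0"
  then have "e / 2 > 0" by simp
  then obtain M N where MN: "\<And>m n. m \<ge> M \<Longrightarrow> n \<ge> M \<Longrightarrow> p (X m - X n) < e / 2"
    "\<And>m n. m \<ge> N \<Longrightarrow> n \<ge> N \<Longrightarrow> p (Y m - Y n) < e / 2"
    using assms unfolding pcauchy_def by meson
  have "p (X m + Y m - (X n + Y n)) < e" if "m \<ge> max M N" "n \<ge> max M N" for m n
    using triangle[of "X m - X n" "Y m - Y n"] MN(1)[of m n] MN(2)[of m n] that
    by (simp add: algebra_simps)
  then show "\<exists>M. \<forall>m\<ge>M. \<forall>n\<ge>M. p (X m + Y m - (X n + Y n)) < e" by blast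
qed

lemma pcauchy_uminus: "pcauchy p X \<Longrightarrow> pcauchy p (\<lambda>n. - X n)"
  by (rule pcauchy_lipschitz[where C=1]) (auto simp: diff_commute)

lemma pcauchy_tendsto:
  assumes "pcauchy p X"
  obtains r where "(\<lambda>n. p (X n)) \<longlonglongrightarrow> r"
proof -
  have "Cauchy (\<lambda>n. p (X n))"
  proof (rule CauchyI)
    fix e :: real assume "e > 0"
    then show "\<exists>M. \<forall>m\<ge>M. \<forall>n\<ge>M. norm (p (X m) - p (X n)) < e"
      using assms unfolding pcauchy_def real_norm_def by (meson abs_diff_le le_less_trans)
  qed
  then show thesis using that by (auto simp: Cauchy_convergent_iff convergent_def)
qed

lemma pcauchy_bounded:
  assumes "pcauchy p X"
  obtains B where "0 < B" "\<And>n. p (X n) \<le> B"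
proof -
  obtain r where "(\<lambda>n. p (X n)) \<longlonglongrightarrow> r" using assms by (rule pcauchy_tendsto)
  then have "Bseq (\<lambda>n. p (X n))" by (meson convergentI convergent_imp_Bseq)
  then obtain K where "K > 0" "\<And>n. norm (p (X n)) \<le> K" by (meson BseqE)
  then show thesis using that[of K] by (simp add: nonneg)
qed

lemma pclass_eq_iff:
  assumes "pcauchy p X" "pcauchy p Y"
  shows "pclass p X = pclass p Y \<longleftrightarrow> (\<lambda>n. p (X n - Y n)) \<longlonglongrightarrow> 0"
proof
  assume "pclass p X = pclass p Y"
  moreover have "Y \<in> pclass p Y" using assms by (simp add: pclass_def zero)
  ultimately have "Y \<in> pclass p X" by simp
  then show "(\<lambda>n. p (X n - Y n)) \<longlonglongrightarrow> 0" by (simp add: pclass_def)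
next
  assume XY: "(\<lambda>n. p (X n - Y n)) \<longlonglongrightarrow> 0"
  then have YX: "(\<lambda>n. p (Y n - X n)) \<longlonglongrightarrow> 0" by (simp add: diff_commute)
  show "pclass p X = pclass p Y"
    using tendsto_zero_trans[OF XY] tendsto_zero_trans[OF YX] by (auto simp: pclass_def)
qed

lemma pclass_in_completion [intro]: "pcauchy p X \<Longrightarrow> pclass p X \<in> completion p"
  by (auto simp: completion_def)

lemma completionE:
  assumes "x \<in> completion p"
  obtains X where "pcauchy p X" "x = pclass p X"
  using assms by (auto simp: completion_def)

lemma cpl_embed_in_completion [intro, simp]: "cpl_embed p v \<in> completion p"
  by (auto simp: cpl_embed_def)

lemma mem_pclass:
  "Y \<in> pclass p X \<longleftrightarrow> pcauchy p Y \<and> (\<lambda>n. p (Y n - X n)) \<longlonglongrightarrow> 0"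
  by (simp add: pclass_def diff_commute[of "X _"])

lemma cpl_lift_pclass:
  assumes X: "pcauchy p X" and f: "\<And>u v. p (f u - f v) \<le> C * p (u - v)"
  shows "cpl_lift p f (pclass p X) = pclass p (\<lambda>n. f (X n))"
proof -
  have "pclass p (\<lambda>n. f (Y n)) = pclass p (\<lambda>n. f (X n))" if "Y \<in> pclass p X" for Y
  proof -
    have Y: "pcauchy p Y" "(\<lambda>n. p (Y n - X n)) \<longlonglongrightarrow> 0"
      using that X by (simp_all add: mem_pclass)
    have "(\<lambda>n. p (f (Y n) - f (X n))) \<longlonglongrightarrow> 0" using Y(2) f by (rule tendsto_zero_le)
    then show ?thesis using pcauchy_lipschitz[OF X f] pcauchy_lipschitz[OF Y(1) f] by (simp add: pclass_eq_iff)
  qed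
  moreover have "X \<in> pclass p X" using X by (simp add: mem_pclass zero)
  ultimately show ?thesis unfolding cpl_lift_def by blast
qed

text \<open>The hypotheses speak of Cauchy sequences instead of a Lipschitz constant because
  multiplication is Lipschitz only on bounded sets, and Cauchy sequences are bounded.\<close>

lemma cpl_lift2_pclass:
  assumes XY: "pcauchy p X" "pcauchy p Y"
    and f: "\<And>X' Y'. pcauchy p X' \<Longrightarrow> pcauchy p Y' \<Longrightarrow> pcauchy p (\<lambda>n. f (X' n) (Y' n))"
    and f_cong: "\<And>X' Y'. pcauchy p X' \<Longrightarrow> pcauchy p Y' \<Longrightarrow> (\<lambda>n. p (X' n - X n)) \<longlonglongrightarrow> 0 \<Longrightarrow>
       (\<lambda>n. p (Y' n - Y n)) \<longlonglongrightarrow> 0 \<Longrightarrow> (\<lambda>n. p (f (X' n) (Y' n) - f (X n) (Y n))) \<longlonglongrightarrow> 0"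
  shows "cpl_lift2 p f (pclass p X) (pclass p Y) = pclass p (\<lambda>n. f (X n) (Y n))"
proof -
  have "pclass p (\<lambda>n. f (X' n) (Y' n)) = pclass p (\<lambda>n. f (X n) (Y n))"
    if "X' \<in> pclass p X" "Y' \<in> pclass p Y" for X' Y'
    using that XY f f_cong by (simp add: mem_pclass pclass_eq_iff)
  moreover have "X \<in> pclass p X" "Y \<in> pclass p Y" using XY by (simp_all add: mem_pclass zero)
  ultimately show ?thesis unfolding cpl_lift2_def by blast
qed

lemma cpl_add_pclass:
  assumes "pcauchy p X" "pcauchy p Y"
  shows "cpl_lift2 p (+) (pclass p X) (pclass p Y) = pclass p (\<lambda>n. X n + Y n)"
proof (rule cpl_lift2_pclass[OF assms pcauchy_add])
  fix X' Y' assume "(\<lambda>n. p (X' n - X n)) \<longlonglongrightarrow> 0" "(\<lambda>n. p (Y' n - Y n)) \<longlonglongrightarrow> 0"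
  then have "(\<lambda>n. p ((X' n - X n) + (Y' n - Y n))) \<longlonglongrightarrow> 0" by (rule tendsto_zero_add)
  then show "(\<lambda>n. p (X' n + Y' n - (X n + Y n))) \<longlonglongrightarrow> 0" by (simp add: algebra_simps)
qed

lemma cpl_norm_pclass:
  assumes X: "pcauchy p X" and r: "(\<lambda>n. p (X n)) \<longlonglongrightarrow> r"
  shows "cpl_norm p (pclass p X) = r"
  unfolding cpl_norm_def
proof (rule the_equality)
  show "\<forall>Y\<in>pclass p X. (\<lambda>n. p (Y n)) \<longlonglongrightarrow> r"
  proof
    fix Y assume "Y \<in> pclass p X"
    then have "(\<lambda>n. p (Y n - X n)) \<longlonglongrightarrow> 0" by (simp add: mem_pclass)
    then have "(\<lambda>n. p (Y n) - p (X n)) \<longlonglongrightarrow> 0"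
      by (rule Lim_null_comparison[rotated]) (simp add: abs_diff_le)
    then show "(\<lambda>n. p (Y n)) \<longlonglongrightarrow> r" using tendsto_add[OF _ r] by fastforce
  qed
next
  fix s assume "\<forall>Y\<in>pclass p X. (\<lambda>n. p (Y n)) \<longlonglongrightarrow> s"
  then have "(\<lambda>n. p (X n)) \<longlonglongrightarrow> s" using X by (simp add: mem_pclass zero)
  then show "s = r" using r LIMSEQ_unique by blast
qed

end

locale ring_seminorm = seminorm p for p :: "'v::ring_1 \<Rightarrow> real" +
  assumes submult: "p (x * y) \<le> p x * p y"
begin

lemma tendsto_zero_mult:
  assumes "(\<lambda>n. p (X n)) \<longlonglongrightarrow> 0" "\<And>n. p (Y n) \<le> B"
  shows "(\<lambda>n. p (X n * Y n)) \<longlonglongrightarrow> 0" "(\<lambda>n. p (Y n * X n)) \<longlonglongrightarrow> 0"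
proof -
  have le: "p (X n) * p (Y n) \<le> B * p (X n)" for n
    using mult_right_mono[OF assms(2)[of n] nonneg[of "X n"]] by (simp add: mult.commute)
  have le': "p (X n * Y n) \<le> B * p (X n)" "p (Y n * X n) \<le> B * p (X n)" for n
    using submult le by (metis mult.commute order_trans)+
  show "(\<lambda>n. p (X n * Y n)) \<longlonglongrightarrow> 0" "(\<lambda>n. p (Y n * X n)) \<longlonglongrightarrow> 0"
    by (rule tendsto_zero_le[OF assms(1) le'(1)], rule tendsto_zero_le[OF assms(1) le'(2)])
qed

lemma pcauchy_mult:
  assumes "pcauchy p X" "pcauchy p Y"
  shows "pcauchy p (\<lambda>n. X n * Y n)"
  unfolding pcauchy_def
proof (intro allI impI)
  fix e :: real assume "e > 0"
  obtain B where B: "B > 0" "\<And>n. p (X n) \<le> B" using pcauchy_bounded[OF assms(1)] by blast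
  obtain C where C: "C > 0" "\<And>n. p (Y n) \<le> C" using pcauchy_bounded[OF assms(2)] by blast
  have "e / (B + C) > 0" using \<open>e > 0\<close> B C by simp
  then obtain M N where MN: "\<And>m n. m \<ge> M \<Longrightarrow> n \<ge> M \<Longrightarrow> p (X m - X n) < e / (B + C)"
    "\<And>m n. m \<ge> N \<Longrightarrow> n \<ge> N \<Longrightarrow> p (Y m - Y n) < e / (B + C)"
    using assms unfolding pcauchy_def by meson
  have "p (X m * Y m - X n * Y n) < e" if mn: "m \<ge> max M N" "n \<ge> max M N" for m n
  proof -
    have "p (X m * Y m - X n * Y n) = p ((X m - X n) * Y m + X n * (Y m - Y n))"
      by (simp add: algebra_simps)
    also have "\<dots> \<le> p (X m - X n) * p (Y m) + p (X n) * p (Y m - Y n)"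
      using triangle submult by (meson add_mono order_trans)
    also have "\<dots> \<le> p (X m - X n) * C + B * p (Y m - Y n)"
      by (intro add_mono mult_left_mono mult_right_mono nonneg B C)
    also have "\<dots> < e / (B + C) * C + B * (e / (B + C))"
      using MN(1)[of m n] MN(2)[of m n] mn B C
      by (intro add_strict_mono mult_strict_right_mono mult_strict_left_mono) auto
    also have "\<dots> = (e / (B + C)) * (B + C)" proof -
      have "d * C + B * d = d * (B + C)" for d :: real by (simp add: algebra_simps)
      then show ?thesis .
    qed
    also have "\<dots> = e" using B C by simp
    finally show ?thesis .
  qed
  then show "\<exists>M. \<forall>m\<ge>M. \<forall>n\<ge>M. p (X m * Y m - X n * Y n) < e" by blast
qed

lemma cpl_mult_pclass:
  assumes "pcauchy p X" "pcauchy p Y"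
  shows "cpl_lift2 p (*) (pclass p X) (pclass p Y) = pclass p (\<lambda>n. X n * Y n)"
proof (rule cpl_lift2_pclass[OF assms pcauchy_mult])
  fix X' Y' assume c: "pcauchy p X'" "pcauchy p Y'"
    and l: "(\<lambda>n. p (X' n - X n)) \<longlonglongrightarrow> 0" "(\<lambda>n. p (Y' n - Y n)) \<longlonglongrightarrow> 0"
  obtain B where B: "\<And>n. p (X n) \<le> B" using pcauchy_bounded[OF assms(1)] by blast
  obtain C where C: "\<And>n. p (Y' n) \<le> C" using pcauchy_bounded[OF c(2)] by blast
  have "(\<lambda>n. p ((X' n - X n) * Y' n + X n * (Y' n - Y n))) \<longlonglongrightarrow> 0"
    using tendsto_zero_mult(1)[OF l(1) C] tendsto_zero_mult(2)[OF l(2) B]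
    by (rule tendsto_zero_add)
  then show "(\<lambda>n. p (X' n * Y' n - X n * Y n)) \<longlonglongrightarrow> 0" by (simp add: algebra_simps)
qed

end


section \<open>The free *-algebra\<close>

lemma free_scale_single: "free_scale c (Poly_Mapping.single w d) = Poly_Mapping.single w (c * d)"
  by (simp add: free_scale_def mult_single plus_list_def)

lemma free_scale_scale: "free_scale c (free_scale d x) = free_scale (c * d) x"
  by (simp add: free_scale_def mult_single mult.assoc[symmetric] plus_list_def)

lemma single_Nil_one: "Poly_Mapping.single [] 1 = (1 :: 'a free_alg)"
  using single_one[where 'a="'a letter list" and 'b=complex] by (simp add: zero_list_def)

lemma free_scale_one [simp]: "free_scale 1 x = x"
  by (simp add: free_scale_def single_Nil_one)

lemma free_scale_minus_one: "free_scale (- 1) x = - x"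
  using single_Nil_one[where 'a='a] by (simp add: free_scale_def single_uminus)

lemma single_Cons: "Poly_Mapping.single (l # w) 1 = letter l * Poly_Mapping.single w 1"
  by (simp add: letter_def mult_single plus_list_def)

lemma poly_mapping_sum_single:
  fixes x :: "'k \<Rightarrow>\<^sub>0 'b::comm_monoid_add"
  shows "x = (\<Sum>w\<in>Poly_Mapping.keys x. Poly_Mapping.single w (Poly_Mapping.lookup x w))"
proof (rule poly_mapping_eqI)
  fix v
  have "(\<Sum>w\<in>Poly_Mapping.keys x. Poly_Mapping.lookup x w when w = v) = Poly_Mapping.lookup x v"
    using sum.delta[OF finite_keys[of x], of v "Poly_Mapping.lookup x"]
    by (auto simp: when_def in_keys_iff)
  then show "Poly_Mapping.lookup x v = Poly_Mapping.lookup
      (\<Sum>w\<in>Poly_Mapping.keys x. Poly_Mapping.single w (Poly_Mapping.lookup x w)) v"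
    by (simp add: lookup_sum lookup_single)
qed

lemma poly_mapping_single_induct [case_names zero single_add]:
  fixes x :: "'k \<Rightarrow>\<^sub>0 'b::comm_monoid_add"
  assumes "P 0" and "\<And>w c x. P x \<Longrightarrow> P (Poly_Mapping.single w c + x)"
  shows "P x"
proof -
  have "P (\<Sum>w\<in>I. Poly_Mapping.single w (Poly_Mapping.lookup x w))" if "finite I" for I
    using that by induction (use assms in auto)
  then show ?thesis using poly_mapping_sum_single[of x] by (metis finite_keys)
qed

text \<open>\<open>free_star\<close> sums over the support, which changes under addition; a common
  finite superset lets all sums run over one index set.\<close>

lemma free_star_superset:
  assumes "finite B" "Poly_Mapping.keys x \<subseteq> B"
  shows "free_star x =
    (\<Sum>w\<in>B. Poly_Mapping.single (rev (map letter_adj w)) (cnj (Poly_Mapping.lookup x w)))"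
  unfolding free_star_def
  by (rule sum.mono_neutral_left) (use assms in \<open>auto simp: in_keys_iff\<close>)

lemma free_star_add: "free_star (x + y) = free_star x + free_star y"
proof -
  let ?B = "Poly_Mapping.keys x \<union> Poly_Mapping.keys y"
  have "Poly_Mapping.keys (x + y) \<subseteq> ?B" by (rule keys_add)
  then show ?thesis
    by (simp add: free_star_superset[of ?B] lookup_add single_add sum.distrib)
qed

lemma free_star_single [simp]:
  "free_star (Poly_Mapping.single w c) = Poly_Mapping.single (rev (map letter_adj w)) (cnj c)"
  by (subst free_star_superset[of "{w}"]) auto

lemma free_star_zero [simp]: "free_star 0 = 0"
  by (simp add: free_star_def)

lemma free_star_minus: "free_star (- x) = - free_star x"
  using free_star_add[of x "- x"] by (simp add: eq_neg_iff_add_eq_0 add.commute)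

lemma free_star_diff: "free_star (x - y) = free_star x - free_star y"
  using free_star_add[of x "- y"] by (simp add: free_star_minus)

lemma letter_adj_adj: "letter_adj (letter_adj l) = (l :: 'a::unital_cstar_algebra letter)"
  by (cases l) (auto simp: star_star)

lemma free_star_star: "free_star (free_star x) = (x :: 'a::unital_cstar_algebra free_alg)"
  by (induction x rule: poly_mapping_single_induct)
    (auto simp: free_star_add rev_map comp_def letter_adj_adj)

lemma free_star_letter [simp]: "free_star (letter l) = letter (letter_adj l)"
  by (simp add: letter_def)

section \<open>C*-seminorms that respect the Toeplitz relations\<close>

lemma cstar_seminorm_ring_seminorm:
  assumes "cstar_seminorm p"
  shows "ring_seminorm p"
proof
  show "p (- x) = p x" for x
    using assms unfolding cstar_seminorm_def
    by (metis free_scale_minus_one mult_1 norm_minus_cancel norm_one)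
  show "p 0 = 0"
    using assms unfolding cstar_seminorm_def
    by (metis free_scale_def mult_zero_left norm_zero single_zero)
qed (use assms in \<open>auto simp: cstar_seminorm_def\<close>)

lemma cstar_seminorm_star:
  fixes p :: "'a::unital_cstar_algebra free_alg \<Rightarrow> real"
  assumes "cstar_seminorm p"
  shows "p (free_star x) = p x"
proof -
  interpret ring_seminorm p by (rule cstar_seminorm_ring_seminorm) fact
  have le: "p x \<le> p (free_star x)" for x
  proof (cases "p x = 0")
    case False
    then have "p x > 0" using nonneg[of x] by simp
    moreover have "p x * p x \<le> p (free_star x) * p x"
      using assms submult[of "free_star x" x] by (simp add: cstar_seminorm_def power2_eq_square)
    ultimately show ?thesis by simp
  qed (simp add: nonneg)
  show ?thesis using le[of x] le[of "free_star x"] by (simp add: free_star_star)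
qed

definition toeplitz_cstar_seminorm ::
  "('a::unital_cstar_algebra \<Rightarrow> 'a) \<Rightarrow> ('a \<Rightarrow> 'a) \<Rightarrow> ('a free_alg \<Rightarrow> real) \<Rightarrow> bool" where
  "toeplitz_cstar_seminorm \<alpha> L p \<longleftrightarrow> cstar_seminorm p \<and> (\<forall>r\<in>toeplitz_relations \<alpha> L. p r = 0)"

lemma cstar_seminorm_one_le:
  assumes "cstar_seminorm (p :: 'a::unital_cstar_algebra free_alg \<Rightarrow> real)"
  shows "p 1 \<le> 1"
proof -
  interpret ring_seminorm p by (rule cstar_seminorm_ring_seminorm) fact
  have "free_star 1 = (1 :: 'a free_alg)"
    using free_star_single[of "[]" 1] by (simp add: single_Nil_one)
  then have "p 1 = p 1 * p 1" using assms by (metis cstar_seminorm_def mult_1 power2_eq_square)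
  then show ?thesis by (metis mult_cancel_right1 order_refl zero_le_one)
qed

context
  fixes \<alpha> L :: "'a::comm_unital_cstar_algebra \<Rightarrow> 'a" and p
  assumes p: "toeplitz_cstar_seminorm \<alpha> L p"
begin

interpretation ring_seminorm p
  using p by (auto simp: toeplitz_cstar_seminorm_def intro: cstar_seminorm_ring_seminorm)

lemma toeplitz_seminorm_cong:
  assumes "x - y \<in> toeplitz_relations \<alpha> L"
  shows "p x = p y"
  using p assms abs_diff_le[of x y] by (simp add: toeplitz_cstar_seminorm_def)

text \<open>The relations turn p, read on the letters of A, into a C*-seminorm on A itself, and
  those are dominated by the norm.\<close>

lemma toeplitz_seminorm_Elem_le: "p (letter (Elem a)) \<le> norm a"
proof (rule cstar_seminorm_le_norm)
  have cs: "cstar_seminorm p" using p by (simp add: toeplitz_cstar_seminorm_def)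
  fix x y :: 'a and c
  have "p (letter (Elem (x + y))) = p (letter (Elem x) + letter (Elem y))"
    by (rule toeplitz_seminorm_cong) (auto simp: toeplitz_relations_def)
  then show "p (letter (Elem (x + y))) \<le> p (letter (Elem x)) + p (letter (Elem y))"
    using triangle by simp
  have "p (letter (Elem (c *\<^sub>C x))) = p (free_scale c (letter (Elem x)))"
    by (rule toeplitz_seminorm_cong) (auto simp: toeplitz_relations_def)
  then show "p (letter (Elem (c *\<^sub>C x))) = cmod c * p (letter (Elem x))"
    using cs by (simp add: cstar_seminorm_def)
  have m: "p (letter (Elem (x * y))) = p (letter (Elem x) * letter (Elem y))" for x y
    by (rule toeplitz_seminorm_cong) (auto simp: toeplitz_relations_def)
  then show "p (letter (Elem (x * y))) \<le> p (letter (Elem x)) * p (letter (Elem y))"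
    using submult by simp
  show "p (letter (Elem (star x * x))) = (p (letter (Elem x)))\<^sup>2"
    using m[of "star x" x] cs unfolding cstar_seminorm_def
    by (metis free_star_letter letter_adj.simps(1))
qed

lemma toeplitz_seminorm_Gen_le: "(p (letter Gen))\<^sup>2 \<le> norm (L 1)"
proof -
  have cs: "cstar_seminorm p" using p by (simp add: toeplitz_cstar_seminorm_def)
  have 1: "p (letter (Elem 1) - 1) = 0"
    using p by (auto simp: toeplitz_cstar_seminorm_def toeplitz_relations_def)
  \<comment> \<open>The relation for L has a letter between S^* and S, whereas the C*-identity
    produces S^* S. The letter of 1 is inserted at the cost of a term containing 1 - i_A(1), which
    has seminorm zero.\<close>
  have "p (letter Gen_adj * letter Gen - letter Gen_adj * letter (Elem 1) * letter Gen) \<le>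
      p (letter Gen_adj) * p (1 - letter (Elem 1)) * p (letter Gen)"
    using submult[of "letter Gen_adj * (1 - letter (Elem 1))" "letter Gen"]
      mult_right_mono[OF submult[of "letter Gen_adj" "1 - letter (Elem 1)"] nonneg[of "letter Gen"]]
    by (simp add: algebra_simps)
  then have "p (letter Gen_adj * letter Gen) =
      p (letter Gen_adj * letter (Elem 1) * letter Gen)"
    using abs_diff_le[of "letter Gen_adj * letter Gen"
        "letter Gen_adj * letter (Elem 1) * letter Gen"] 1
    by (simp add: diff_commute[of 1])
  also have "\<dots> = p (letter (Elem (L 1)))"
    by (rule toeplitz_seminorm_cong) (auto simp: toeplitz_relations_def)
  also have "\<dots> \<le> norm (L 1)" by (rule toeplitz_seminorm_Elem_le)
  finally show ?thesis using cs unfolding cstar_seminorm_def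
    by (metis free_star_letter letter_adj.simps(2))
qed

end

text \<open>Only such a bound gives the real supremum in \<open>toeplitz_seminorm\<close> its
  meaning. Letters are bounded independently of p, hence so are words and their linear
  combinations.\<close>

lemma toeplitz_cstar_seminorm_bounded:
  fixes \<alpha> L :: "'a::comm_unital_cstar_algebra \<Rightarrow> 'a"
  shows "\<exists>B. \<forall>p. toeplitz_cstar_seminorm \<alpha> L p \<longrightarrow> p x \<le> B"
proof (induction x rule: poly_mapping_single_induct)
  case zero
  have "p 0 \<le> 0" if "toeplitz_cstar_seminorm \<alpha> L p" for p
    using cstar_seminorm_ring_seminorm[of p] that
    by (simp add: toeplitz_cstar_seminorm_def ring_seminorm_def seminorm_def)
  then show ?case by blast
next
  case (single_add w c x)
  have "\<exists>B. \<forall>p. toeplitz_cstar_seminorm \<alpha> L p \<longrightarrow> p (letter l) \<le> B" for l :: "'a letter"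
  proof (cases l)
    case (Elem a)
    then show ?thesis using toeplitz_seminorm_Elem_le by blast
  next
    case Gen
    have "p (letter Gen) \<le> sqrt (norm (L 1))" if "toeplitz_cstar_seminorm \<alpha> L p" for p
      using toeplitz_seminorm_Gen_le[OF that] by (simp add: real_le_rsqrt)
    then show ?thesis using Gen by blast
  next
    case Gen_adj
    have "p (letter Gen_adj) \<le> sqrt (norm (L 1))" if "toeplitz_cstar_seminorm \<alpha> L p" for p
      using toeplitz_seminorm_Gen_le[OF that] that cstar_seminorm_star[of p "letter Gen"]
      by (simp add: real_le_rsqrt toeplitz_cstar_seminorm_def)
    then show ?thesis using Gen_adj by blast
  qed
  then obtain b where b: "\<And>l p. toeplitz_cstar_seminorm \<alpha> L p \<Longrightarrow> p (letter l) \<le> b l" by metis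
  have "\<exists>B. \<forall>p. toeplitz_cstar_seminorm \<alpha> L p \<longrightarrow> p (Poly_Mapping.single w 1) \<le> B"
  proof (induction w)
    case Nil
    then show ?case using cstar_seminorm_one_le
      by (metis single_Nil_one toeplitz_cstar_seminorm_def)
  next
    case (Cons l w)
    then obtain B where B: "\<And>p. toeplitz_cstar_seminorm \<alpha> L p \<Longrightarrow> p (Poly_Mapping.single w 1) \<le> B"
      by blast
    have "p (Poly_Mapping.single (l # w) 1) \<le> b l * B" if p: "toeplitz_cstar_seminorm \<alpha> L p" for p
    proof -
      interpret ring_seminorm p
        using p by (auto simp: toeplitz_cstar_seminorm_def intro: cstar_seminorm_ring_seminorm)
      have "p (Poly_Mapping.single (l # w) 1) \<le> p (letter l) * p (Poly_Mapping.single w 1)"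
        by (simp add: single_Cons submult)
      also have "\<dots> \<le> b l * B"
        using b[OF p, of l] B[OF p] nonneg by (intro mult_mono) (auto intro: order_trans)
      finally show ?thesis .
    qed
    then show ?case by blast
  qed
  then obtain B where B: "\<And>p. toeplitz_cstar_seminorm \<alpha> L p \<Longrightarrow> p (Poly_Mapping.single w 1) \<le> B"
    by blast
  obtain C where C: "\<And>p. toeplitz_cstar_seminorm \<alpha> L p \<Longrightarrow> p x \<le> C"
    using single_add.IH by blast
  have "p (Poly_Mapping.single w c + x) \<le> cmod c * B + C" if p: "toeplitz_cstar_seminorm \<alpha> L p" for p
  proof -
    have cs: "cstar_seminorm p" using p by (simp add: toeplitz_cstar_seminorm_def)
    have "p (Poly_Mapping.single w c) = cmod c * p (Poly_Mapping.single w 1)"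
      using cs free_scale_single[of c w 1] unfolding cstar_seminorm_def by (metis mult.right_neutral)
    moreover have "p (Poly_Mapping.single w c + x) \<le> p (Poly_Mapping.single w c) + p x"
      using cs by (simp add: cstar_seminorm_def)
    ultimately show ?thesis
      using C[OF p] mult_left_mono[OF B[OF p] norm_ge_zero[of c]] by linarith
  qed
  then show ?case by blast
qed

lemma toeplitz_seminorm_upper:
  fixes \<alpha> L :: "'a::comm_unital_cstar_algebra \<Rightarrow> 'a"
  assumes "toeplitz_cstar_seminorm \<alpha> L p"
  shows "p x \<le> toeplitz_seminorm \<alpha> L x"
  unfolding toeplitz_seminorm_def
proof (rule cSup_upper)
  obtain B where "\<forall>p. toeplitz_cstar_seminorm \<alpha> L p \<longrightarrow> p x \<le> B"
    using toeplitz_cstar_seminorm_bounded[of \<alpha> L x] by blast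
  then show "bdd_above {p x |p. cstar_seminorm p \<and> (\<forall>r\<in>toeplitz_relations \<alpha> L. p r = 0)}"
    unfolding bdd_above_def toeplitz_cstar_seminorm_def by blast
qed (use assms in \<open>auto simp: toeplitz_cstar_seminorm_def\<close>)

lemma toeplitz_seminorm_least:
  fixes \<alpha> L :: "'a::comm_unital_cstar_algebra \<Rightarrow> 'a"
  assumes "\<And>p. toeplitz_cstar_seminorm \<alpha> L p \<Longrightarrow> p x \<le> r"
  shows "toeplitz_seminorm \<alpha> L x \<le> r"
  unfolding toeplitz_seminorm_def
proof (rule cSup_least)
  have "cstar_seminorm (\<lambda>x :: 'a free_alg. 0)" by (simp add: cstar_seminorm_def)
  then show "{p x |p. cstar_seminorm p \<and> (\<forall>r\<in>toeplitz_relations \<alpha> L. p r = 0)} \<noteq> {}" by force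
qed (use assms in \<open>auto simp: toeplitz_cstar_seminorm_def\<close>)

text \<open>Each axiom is inherited by a pointwise supremum; for the C*-identity this uses that
  squaring is monotone on nonnegative numbers. The universal seminorm is therefore admissible
  itself, and all facts proved for p apply to it.\<close>

lemma toeplitz_cstar_seminorm_toeplitz_seminorm:
  fixes \<alpha> L :: "'a::comm_unital_cstar_algebra \<Rightarrow> 'a"
  shows "toeplitz_cstar_seminorm \<alpha> L (toeplitz_seminorm \<alpha> L)"
proof -
  let ?P = "toeplitz_seminorm \<alpha> L"
  note up = toeplitz_seminorm_upper and le = toeplitz_seminorm_least
  have zero: "toeplitz_cstar_seminorm \<alpha> L (\<lambda>x. 0)"
    by (simp add: toeplitz_cstar_seminorm_def cstar_seminorm_def)
  have pos: "0 \<le> ?P x" for x using up[OF zero] .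
  note cs = toeplitz_cstar_seminorm_def cstar_seminorm_def
  have nn: "0 \<le> p x" if "toeplitz_cstar_seminorm \<alpha> L p" for p x
  proof -
    interpret ring_seminorm p
      using that by (auto simp: toeplitz_cstar_seminorm_def intro: cstar_seminorm_ring_seminorm)
    show ?thesis by (rule nonneg)
  qed
  have add: "?P (x + y) \<le> ?P x + ?P y" for x y
  proof (rule le)
    fix p assume p: "toeplitz_cstar_seminorm \<alpha> L p"
    then have "p (x + y) \<le> p x + p y" by (simp add: cs)
    then show "p (x + y) \<le> ?P x + ?P y" using up[OF p, of x] up[OF p, of y] by linarith
  qed
  have scale_le: "?P (free_scale c x) \<le> cmod c * ?P x" for c x
  proof (rule le)
    fix p assume p: "toeplitz_cstar_seminorm \<alpha> L p"
    then have "p (free_scale c x) = cmod c * p x" by (simp add: cs)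
    then show "p (free_scale c x) \<le> cmod c * ?P x" using up[OF p, of x] by (simp add: mult_left_mono)
  qed
  have scale: "?P (free_scale c x) = cmod c * ?P x" for c x
  proof (cases "c = 0")
    case True
    then show ?thesis using scale_le[of c x] pos[of "free_scale c x"] by simp
  next
    case False
    have "?P x \<le> cmod (inverse c) * ?P (free_scale c x)"
      using scale_le[of "inverse c" "free_scale c x"] False by (simp add: free_scale_scale)
    then have "cmod c * ?P x \<le> ?P (free_scale c x)"
      using False by (simp add: norm_divide field_simps)
    then show ?thesis using scale_le[of c x] by simp
  qed
  have mult: "?P (x * y) \<le> ?P x * ?P y" for x y
  proof (rule le)
    fix p assume p: "toeplitz_cstar_seminorm \<alpha> L p"
    then have "p (x * y) \<le> p x * p y" by (simp add: cs)
    also have "\<dots> \<le> ?P x * ?P y"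
      using up[OF p] nn[OF p] pos by (intro mult_mono) auto
    finally show "p (x * y) \<le> ?P x * ?P y" .
  qed
  have star: "?P (free_star x * x) = (?P x)\<^sup>2" for x
  proof (rule antisym)
    show "?P (free_star x * x) \<le> (?P x)\<^sup>2"
    proof (rule le)
      fix p assume p: "toeplitz_cstar_seminorm \<alpha> L p"
      then have "p (free_star x * x) = (p x)\<^sup>2" by (simp add: cs)
      also have "\<dots> \<le> (?P x)\<^sup>2" using up[OF p] nn[OF p] by (rule power_mono)
      finally show "p (free_star x * x) \<le> (?P x)\<^sup>2" .
    qed
    have "?P x \<le> sqrt (?P (free_star x * x))"
    proof (rule le)
      fix p assume p: "toeplitz_cstar_seminorm \<alpha> L p"
      then have "(p x)\<^sup>2 = p (free_star x * x)" by (simp add: cs)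
      also have "\<dots> \<le> ?P (free_star x * x)" by (rule up[OF p])
      finally show "p x \<le> sqrt (?P (free_star x * x))" by (rule real_le_rsqrt)
    qed
    then show "(?P x)\<^sup>2 \<le> ?P (free_star x * x)"
      using power_mono[of "?P x" "sqrt (?P (free_star x * x))" 2] pos by simp
  qed
  have "?P r = 0" if "r \<in> toeplitz_relations \<alpha> L" for r
    using le[of \<alpha> L r 0] pos[of r] that by (simp add: toeplitz_cstar_seminorm_def antisym)
  then show ?thesis using add scale mult star by (simp add: cs)
qed


section \<open>Ring structure and closed ideals of the Toeplitz algebra\<close>

context
  fixes \<alpha> L :: "'a::comm_unital_cstar_algebra \<Rightarrow> 'a"
begin

private abbreviation (input) "pT \<equiv> toeplitz_seminorm \<alpha> L"
private abbreviation (input) "T \<equiv> toeplitz \<alpha> L"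

interpretation ring_seminorm pT
  using toeplitz_cstar_seminorm_toeplitz_seminorm[of \<alpha> L]
  by (auto simp: toeplitz_cstar_seminorm_def intro: cstar_seminorm_ring_seminorm)

lemma toeplitz_simps:
  "carrier T = completion pT" "mult T = cpl_lift2 pT (*)" "one T = cpl_embed pT 1"
  "zero T = cpl_embed pT 0" "add T = cpl_lift2 pT (+)" "scal T c = cpl_lift pT (free_scale c)"
  "adj T = cpl_lift pT free_star" "nrm T = cpl_norm pT"
  by (simp_all add: toeplitz_def Let_def)

lemma toeplitz_ring: "ring T"
proof (rule ringI)
  note simps = toeplitz_simps cpl_embed_def cpl_add_pclass pcauchy_add pclass_in_completion
  show "abelian_group T"
  proof (rule abelian_groupI)
    fix x assume "x \<in> carrier T"
    then obtain X where X: "pcauchy pT X" "x = pclass pT X"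
      by (auto simp: toeplitz_simps elim: completionE)
    then show "\<exists>y\<in>carrier T. y \<oplus>\<^bsub>T\<^esub> x = \<zero>\<^bsub>T\<^esub>"
      using pcauchy_uminus[OF X(1)] by (intro bexI[of _ "pclass pT (\<lambda>n. - X n)"]) (auto simp: simps)
  qed (auto simp: simps ac_simps elim!: completionE)
  show "monoid T"
    by (rule monoidI)
      (auto simp: simps cpl_mult_pclass pcauchy_mult mult.assoc elim!: completionE)
qed (auto simp: toeplitz_simps cpl_add_pclass pcauchy_add cpl_mult_pclass pcauchy_mult
  algebra_simps elim!: completionE)

interpretation T: ring T by (rule toeplitz_ring)

lemma toeplitz_minus_pclass:
  assumes "pcauchy pT X" "pcauchy pT Y"
  shows "pclass pT X \<ominus>\<^bsub>T\<^esub> pclass pT Y = pclass pT (\<lambda>n. X n - Y n)"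
proof -
  have Y: "pcauchy pT (\<lambda>n. - Y n)" using assms by (simp add: pcauchy_uminus)
  have "\<ominus>\<^bsub>T\<^esub> pclass pT Y = pclass pT (\<lambda>n. - Y n)"
    by (rule T.minus_equality)
      (use assms Y in \<open>auto simp: toeplitz_simps cpl_add_pclass cpl_embed_def\<close>)
  then show ?thesis using assms Y by (simp add: a_minus_def toeplitz_simps cpl_add_pclass)
qed

text \<open>The kernel of the canonical map from the Toeplitz algebra to the completion for p, when
  p is one of the admissible seminorms. Membership in the redundancy ideal will be tested against
  it.\<close>

definition null_ideal where
  "null_ideal p = {pclass pT X |X. pcauchy pT X \<and> (\<lambda>n. p (X n)) \<longlonglongrightarrow> (0::real)}"

context
  fixes p assumes p: "toeplitz_cstar_seminorm \<alpha> L p"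
begin

interpretation p: ring_seminorm p
  using p by (auto simp: toeplitz_cstar_seminorm_def intro: cstar_seminorm_ring_seminorm)

lemma pcauchy_toeplitz_cstar_seminorm: "pcauchy pT X \<Longrightarrow> pcauchy p X"
  unfolding pcauchy_def using toeplitz_seminorm_upper[OF p] by (meson le_less_trans)

lemma pclass_null_ideal_iff:
  assumes "pcauchy pT X"
  shows "pclass pT X \<in> null_ideal p \<longleftrightarrow> (\<lambda>n. p (X n)) \<longlonglongrightarrow> 0"
proof
  assume "pclass pT X \<in> null_ideal p"
  then obtain Y where Y: "pcauchy pT Y" "pclass pT X = pclass pT Y" "(\<lambda>n. p (Y n)) \<longlonglongrightarrow> 0"
    by (auto simp: null_ideal_def)
  then have lim: "(\<lambda>n. pT (X n - Y n)) \<longlonglongrightarrow> 0" using assms by (simp add: pclass_eq_iff)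
  have "(\<lambda>n. p (X n - Y n)) \<longlonglongrightarrow> 0"
    by (rule tendsto_sandwich[OF _ _ tendsto_const lim])
      (auto simp: p.nonneg toeplitz_seminorm_upper[OF p])
  then have "(\<lambda>n. p (X n - Y n + Y n)) \<longlonglongrightarrow> 0" using Y(3) by (rule p.tendsto_zero_add)
  then show "(\<lambda>n. p (X n)) \<longlonglongrightarrow> 0" by simp
qed (use assms in \<open>auto simp: null_ideal_def\<close>)

lemma null_ideal: "ideal (null_ideal p) T"
proof (rule idealI)
  show "ring T" by (rule toeplitz_ring)
  show "subgroup (null_ideal p) (add_monoid T)"
  proof
    show "null_ideal p \<subseteq> carrier (add_monoid T)" by (auto simp: null_ideal_def toeplitz_simps)
    show "\<one>\<^bsub>add_monoid T\<^esub> \<in> null_ideal p"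
      by (simp add: toeplitz_simps cpl_embed_def pclass_null_ideal_iff p.zero)
    fix x assume "x \<in> null_ideal p"
    then obtain X where X: "pcauchy pT X" "x = pclass pT X" "(\<lambda>n. p (X n)) \<longlonglongrightarrow> 0"
      by (auto simp: null_ideal_def)
    show "inv\<^bsub>add_monoid T\<^esub> x \<in> null_ideal p"
    proof -
      have "x \<in> carrier T" using X by (auto simp: toeplitz_simps)
      then have "\<ominus>\<^bsub>T\<^esub> x = \<zero>\<^bsub>T\<^esub> \<ominus>\<^bsub>T\<^esub> x" by (simp add: a_minus_def)
      also have "\<dots> = pclass pT (\<lambda>n. - X n)"
        using toeplitz_minus_pclass[of "\<lambda>n. 0" X] X by (simp add: toeplitz_simps cpl_embed_def)
      finally show ?thesis
        using X pcauchy_uminus[OF X(1)] by (simp add: a_inv_def[symmetric] pclass_null_ideal_iff p.minus)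
    qed
    fix y assume "y \<in> null_ideal p"
    then obtain Y where Y: "pcauchy pT Y" "y = pclass pT Y" "(\<lambda>n. p (Y n)) \<longlonglongrightarrow> 0"
      by (auto simp: null_ideal_def)
    then show "x \<otimes>\<^bsub>add_monoid T\<^esub> y \<in> null_ideal p"
      using X by (simp add: toeplitz_simps cpl_add_pclass pcauchy_add pclass_null_ideal_iff
          p.tendsto_zero_add)
  qed
  fix x y assume "x \<in> null_ideal p" "y \<in> carrier T"
  then obtain X Y where X: "pcauchy pT X" "x = pclass pT X" "(\<lambda>n. p (X n)) \<longlonglongrightarrow> 0"
    and Y: "pcauchy pT Y" "y = pclass pT Y"
    by (auto simp: null_ideal_def toeplitz_simps elim: completionE)
  obtain B where B: "\<And>n. p (Y n) \<le> B"
    using p.pcauchy_bounded[OF pcauchy_toeplitz_cstar_seminorm[OF Y(1)]] by blast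
  then show "y \<otimes>\<^bsub>T\<^esub> x \<in> null_ideal p" "x \<otimes>\<^bsub>T\<^esub> y \<in> null_ideal p"
    using X Y p.tendsto_zero_mult[OF X(3) B]
    by (simp_all add: toeplitz_simps cpl_mult_pclass pcauchy_mult pclass_null_ideal_iff)
qed

text \<open>Since p \<le> \<open>pT\<close>, approximation in the Toeplitz norm is approximation for
  p.\<close>

lemma null_ideal_closed: "norm_closure T (null_ideal p) \<subseteq> null_ideal p"
proof
  fix x assume x: "x \<in> norm_closure T (null_ideal p)"
  then obtain X where X: "pcauchy pT X" "x = pclass pT X"
    by (auto simp: norm_closure_def toeplitz_simps elim: completionE)
  have "(\<lambda>n. p (X n)) \<longlonglongrightarrow> 0"
  proof (rule tendstoI)
    fix e :: real assume "e > 0"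
    then have "e / 2 > 0" by simp
    then obtain y where y: "y \<in> null_ideal p" "nrm T (x \<ominus>\<^bsub>T\<^esub> y) < e / 2"
      using x unfolding norm_closure_def by blast
    then obtain Y where Y: "pcauchy pT Y" "y = pclass pT Y" "(\<lambda>n. p (Y n)) \<longlonglongrightarrow> 0"
      by (auto simp: null_ideal_def)
    have XY: "pcauchy pT (\<lambda>n. X n - Y n)"
      using pcauchy_add[OF X(1) pcauchy_uminus[OF Y(1)]] by simp
    then obtain r where r: "(\<lambda>n. pT (X n - Y n)) \<longlonglongrightarrow> r" by (rule pcauchy_tendsto)
    have "r < e / 2"
      using y(2) cpl_norm_pclass[OF XY r] X Y by (simp add: toeplitz_minus_pclass toeplitz_simps)
    then have "\<forall>\<^sub>F n in sequentially. pT (X n - Y n) < e / 2" by (rule order_tendstoD(2)[OF r])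
    moreover have "\<forall>\<^sub>F n in sequentially. p (Y n) < e / 2"
      using Y(3) \<open>e / 2 > 0\<close> by (rule order_tendstoD)
    ultimately show "\<forall>\<^sub>F n in sequentially. dist (p (X n)) 0 < e"
    proof eventually_elim
      case (elim n)
      then show ?case
        using p.triangle[of "X n - Y n" "Y n"] toeplitz_seminorm_upper[OF p, of "X n - Y n"]
          p.nonneg[of "X n"] by simp
    qed
  qed
  then show "x \<in> null_ideal p" using X by (simp add: pclass_null_ideal_iff)
qed

end

lemma pT_relation: "r \<in> toeplitz_relations \<alpha> L \<Longrightarrow> pT r = 0"
  using toeplitz_cstar_seminorm_toeplitz_seminorm[of \<alpha> L] by (simp add: toeplitz_cstar_seminorm_def)

lemma pT_mult_zero: "pT x = 0 \<Longrightarrow> pT (y * x) = 0" "pT x = 0 \<Longrightarrow> pT (x * y) = 0"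
  using submult[of y x] submult[of x y] nonneg[of "y * x"] nonneg[of "x * y"] by auto

lemma pT_cong: "pT (x - y) = 0 \<Longrightarrow> pT x = pT y"
  using abs_diff_le[of x y] by simp

lemma cpl_embed_eq_iff: "cpl_embed pT x = cpl_embed pT y \<longleftrightarrow> pT (x - y) = 0"
  by (simp add: cpl_embed_def pclass_eq_iff LIMSEQ_const_iff)

lemma pT_Elem_diff: "pT (letter (Elem (a - b)) - (letter (Elem a) - letter (Elem b))) = 0"
proof -
  have "pT (letter (Elem ((a - b) + b)) - (letter (Elem (a - b)) + letter (Elem b))) = 0"
    by (rule pT_relation) (unfold toeplitz_relations_def, blast)
  then show ?thesis
    using diff_commute[of "letter (Elem a)" "letter (Elem (a - b)) + letter (Elem b)"]
    by (simp add: algebra_simps)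
qed

lemma i_A_diff: "i_A \<alpha> L a \<ominus>\<^bsub>T\<^esub> i_A \<alpha> L b = i_A \<alpha> L (a - b)"
  using cpl_embed_eq_iff[of "letter (Elem (a - b))" "letter (Elem a) - letter (Elem b)"]
  by (simp add: i_A_def cpl_embed_def toeplitz_minus_pclass pT_Elem_diff)

lemma i_A_carrier [simp]: "i_A \<alpha> L a \<in> carrier T"
  by (simp add: i_A_def toeplitz_simps)

lemma redundancy_ideal: "ideal (redundancy_ideal \<alpha> L) T"
  unfolding redundancy_ideal_def closed_ideal_gen_def
proof (rule T.i_Intersect)
  \<comment> \<open>With k in the carrier, the whole algebra contains all generators, so the family
    being intersected is not empty.\<close>
  have "k \<in> carrier T" if "redundancy \<alpha> L a k" for a k
    using that by (auto simp: redundancy_def Let_def norm_closure_def)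
  then show "{I. ideal I T \<and> norm_closure T I \<subseteq> I \<and>
      {i_A \<alpha> L a \<ominus>\<^bsub>T\<^esub> k |a k. a \<in> range_ideal \<alpha> \<and> redundancy \<alpha> L a k} \<subseteq> I} \<noteq> {}"
    using T.oneideal by (force simp: norm_closure_def)
qed auto

lemma inj_j_A_iff:
  "inj (j_A \<alpha> L) \<longleftrightarrow> (\<forall>a. i_A \<alpha> L a \<in> redundancy_ideal \<alpha> L \<longrightarrow> a = 0)"
proof -
  interpret I: ideal "redundancy_ideal \<alpha> L" T by (rule redundancy_ideal)
  have "j_A \<alpha> L a = j_A \<alpha> L b \<longleftrightarrow> i_A \<alpha> L (a - b) \<in> redundancy_ideal \<alpha> L" for a b
  proof -
    have "i_A \<alpha> L a \<in> redundancy_ideal \<alpha> L +>\<^bsub>T\<^esub> i_A \<alpha> L b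
        \<longleftrightarrow> i_A \<alpha> L (a - b) \<in> redundancy_ideal \<alpha> L"
      using I.a_rcos_module_minus[OF toeplitz_ring, of "i_A \<alpha> L b" "i_A \<alpha> L a"]
      by (simp add: i_A_diff)
    moreover have "i_A \<alpha> L a \<in> redundancy_ideal \<alpha> L +>\<^bsub>T\<^esub> i_A \<alpha> L a"
      by (simp add: I.a_rcos_self)
    ultimately show ?thesis
      using T.a_repr_independence[of "i_A \<alpha> L a" "redundancy_ideal \<alpha> L" "i_A \<alpha> L b"] I.a_subgroup
      by (auto simp: j_A_def Q_map_def)
  qed
  then show ?thesis unfolding inj_def by (metis diff_0_right right_minus_eq)
qed

text \<open>In the Toeplitz algebra (c S)^* (c S) = S^* c^* c S = L(c^* c), so a null vector c of
  the form gives c S = 0.\<close>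

lemma pT_Elem_Gen_sq: "(pT (letter (Elem c) * letter Gen))\<^sup>2 \<le> norm (L (star c * c))"
proof -
  let ?a = "letter (Elem (star c))" and ?b = "letter (Elem c)" and ?S = "letter Gen" and ?S' = "letter Gen_adj"
  have cs: "cstar_seminorm pT"
    using toeplitz_cstar_seminorm_toeplitz_seminorm[of \<alpha> L] by (simp add: toeplitz_cstar_seminorm_def)
  have fs: "free_star (letter (Elem c) * letter Gen) = ?S' * ?a"
    by (simp add: letter_def mult_single plus_list_def)
  have "pT (letter (Elem (star c * c)) - ?a * ?b) = 0"
    by (rule pT_relation) (auto simp: toeplitz_relations_def)
  then have "pT (?S' * (letter (Elem (star c * c)) - ?a * ?b) * ?S) = 0"
    by (intro pT_mult_zero)
  then have 1: "pT (?S' * ?a * (?b * ?S)) = pT (?S' * letter (Elem (star c * c)) * ?S)"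
    by (intro pT_cong[symmetric]) (simp add: algebra_simps)
  have "(pT (letter (Elem c) * letter Gen))\<^sup>2 = pT (?S' * ?a * (?b * ?S))"
    using cs fs unfolding cstar_seminorm_def by metis
  also have "\<dots> = pT (letter (Elem (L (star c * c))))"
    unfolding 1 by (rule pT_cong, rule pT_relation) (auto simp: toeplitz_relations_def)
  also have "\<dots> \<le> norm (L (star c * c))"
    by (rule toeplitz_seminorm_Elem_le[OF toeplitz_cstar_seminorm_toeplitz_seminorm])
  finally show ?thesis .
qed

text \<open>The hypothesis runs over all products a b because a redundancy compares i_A(a) i_A(b) S
  with k i_A(b) S, here for k = 0.\<close>

lemma i_A_in_redundancy_ideal:
  assumes a: "a \<in> range_ideal \<alpha>" and L: "\<And>b. L (star (a * b) * (a * b)) = 0"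
  shows "i_A \<alpha> L a \<in> redundancy_ideal \<alpha> L"
proof -
  have "i_A \<alpha> L a \<otimes>\<^bsub>T\<^esub> i_A \<alpha> L b \<otimes>\<^bsub>T\<^esub> toeplitz_S \<alpha> L = \<zero>\<^bsub>T\<^esub> \<otimes>\<^bsub>T\<^esub> i_A \<alpha> L b \<otimes>\<^bsub>T\<^esub> toeplitz_S \<alpha> L"
    for b
  proof -
    have "pT (letter (Elem (a * b)) - letter (Elem a) * letter (Elem b)) = 0"
      by (rule pT_relation) (auto simp: toeplitz_relations_def)
    then have "pT ((letter (Elem (a * b)) - letter (Elem a) * letter (Elem b)) * letter Gen) = 0"
      by (rule pT_mult_zero)
    then have "pT (letter (Elem a) * letter (Elem b) * letter Gen) = pT (letter (Elem (a * b)) * letter Gen)"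
      by (intro pT_cong[symmetric]) (simp add: algebra_simps)
    also have "\<dots> = 0" using pT_Elem_Gen_sq[of "a * b"] L[of b] by simp
    finally have "cpl_embed pT (letter (Elem a) * letter (Elem b) * letter Gen) = cpl_embed pT 0"
      by (simp add: cpl_embed_eq_iff)
    then show ?thesis
      by (simp add: i_A_def toeplitz_S_def toeplitz_simps cpl_embed_def cpl_mult_pclass)
  qed
  moreover have "\<zero>\<^bsub>T\<^esub> \<in> closed_cspan T
      {i_A \<alpha> L b \<otimes>\<^bsub>T\<^esub> toeplitz_S \<alpha> L \<otimes>\<^bsub>T\<^esub> adj T (toeplitz_S \<alpha> L) \<otimes>\<^bsub>T\<^esub> i_A \<alpha> L c |b c. True}" (is "_ \<in> closed_cspan T ?B")
  proof -
    have "nrm T \<zero>\<^bsub>T\<^esub> = 0"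
      unfolding toeplitz_simps cpl_embed_def by (rule cpl_norm_pclass) (simp_all add: zero)
    moreover have "\<zero>\<^bsub>T\<^esub> \<ominus>\<^bsub>T\<^esub> \<zero>\<^bsub>T\<^esub> = \<zero>\<^bsub>T\<^esub>" by (simp add: a_minus_def)
    ultimately show ?thesis
      using cspan.zero[of T ?B] unfolding norm_closure_def by (auto intro!: bexI[of _ "\<zero>\<^bsub>T\<^esub>"])
  qed
  ultimately have "redundancy \<alpha> L a \<zero>\<^bsub>T\<^esub>" by (simp add: redundancy_def Let_def)
  then have "i_A \<alpha> L a \<ominus>\<^bsub>T\<^esub> \<zero>\<^bsub>T\<^esub> \<in> redundancy_ideal \<alpha> L"
    using a unfolding redundancy_ideal_def closed_ideal_gen_def by blast
  then show ?thesis by (simp add: a_minus_def)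
qed

text \<open>The span that approximates second components of redundancies, taken in the free algebra.
  Scalar coefficients are absorbed into the first entry of each pair.\<close>

definition rank_sum :: "('a \<times> 'a) list \<Rightarrow> 'a free_alg" where
  "rank_sum bs = (\<Sum>(b, c)\<leftarrow>bs. letter (Elem b) * letter Gen * letter Gen_adj * letter (Elem c))"

text \<open>Moves a redundancy out of the completion: k is replaced by a Cauchy sequence in the free
  algebra, where the Fock representation is defined, and both conditions become limits of
  seminorms.\<close>

lemma redundancyE:
  assumes "redundancy \<alpha> L a k"
  obtains X where "pcauchy pT X" "k = pclass pT X"
    "\<And>b. (\<lambda>n. pT ((letter (Elem a) - X n) * letter (Elem b) * letter Gen)) \<longlonglongrightarrow> 0"
    "\<And>e. e > 0 \<Longrightarrow> \<exists>bs. \<forall>\<^sub>F n in sequentially. pT (X n - rank_sum bs) < e"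
proof -
  let ?S = "toeplitz_S \<alpha> L"
  let ?B = "{i_A \<alpha> L b \<otimes>\<^bsub>T\<^esub> ?S \<otimes>\<^bsub>T\<^esub> adj T ?S \<otimes>\<^bsub>T\<^esub> i_A \<alpha> L c |b c. True}"
  have k: "k \<in> closed_cspan T ?B"
    "\<And>b. i_A \<alpha> L a \<otimes>\<^bsub>T\<^esub> i_A \<alpha> L b \<otimes>\<^bsub>T\<^esub> ?S = k \<otimes>\<^bsub>T\<^esub> i_A \<alpha> L b \<otimes>\<^bsub>T\<^esub> ?S"
    using assms by (simp_all add: redundancy_def Let_def)
  then obtain X where X: "pcauchy pT X" "k = pclass pT X"
    by (auto simp: norm_closure_def toeplitz_simps elim: completionE)
  have cs: "cstar_seminorm pT"
    using toeplitz_cstar_seminorm_toeplitz_seminorm[of \<alpha> L] by (simp add: toeplitz_cstar_seminorm_def)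
  have star_lip: "pT (free_star u - free_star v) \<le> 1 * pT (u - v)" for u v
    using cstar_seminorm_star[OF cs, of "u - v"] by (simp add: free_star_diff)
  have scale_lip: "pT (free_scale c u - free_scale c v) \<le> cmod c * pT (u - v)" for c u v
    using cs by (simp add: cstar_seminorm_def free_scale_def flip: right_diff_distrib)
  have span: "\<exists>bs. y = cpl_embed pT (rank_sum bs)" if "y \<in> cspan T ?B" for y
    using that
  proof induction
    case zero
    then show ?case by (intro exI[of _ "[]"]) (simp add: toeplitz_simps rank_sum_def)
  next
    case (add b y s)
    then obtain bs where bs: "y = cpl_embed pT (rank_sum bs)" by blast
    obtain c d where b: "b = i_A \<alpha> L c \<otimes>\<^bsub>T\<^esub> ?S \<otimes>\<^bsub>T\<^esub> adj T ?S \<otimes>\<^bsub>T\<^esub> i_A \<alpha> L d" using add by blast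
    let ?w = "letter Gen * letter Gen_adj * letter (Elem d)"
    have adjS: "adj T ?S = cpl_embed pT (letter Gen_adj)"
      using cpl_lift_pclass[of "\<lambda>n. letter Gen", OF _ star_lip]
      by (simp add: toeplitz_S_def toeplitz_simps cpl_embed_def)
    have "b = cpl_embed pT (letter (Elem c) * ?w)"
      unfolding b adjS
      by (simp add: i_A_def toeplitz_S_def toeplitz_simps cpl_embed_def cpl_mult_pclass mult.assoc)
    then have "scal T s b = cpl_embed pT (free_scale s (letter (Elem c) * ?w))"
      using cpl_lift_pclass[of "\<lambda>n. letter (Elem c) * ?w", OF _ scale_lip]
      by (simp add: toeplitz_simps cpl_embed_def)
    \<comment> \<open>A relation carries the scalar into the letter of c, so a scaled generator is
      again a term of \<open>rank_sum\<close>.\<close>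
    moreover have "pT ((letter (Elem (s *\<^sub>C c)) - free_scale s (letter (Elem c))) * ?w) = 0"
      by (rule pT_mult_zero, rule pT_relation) (auto simp: toeplitz_relations_def)
    ultimately have "scal T s b = cpl_embed pT (letter (Elem (s *\<^sub>C c)) * ?w)"
      using diff_commute[of "free_scale s (letter (Elem c) * ?w)"]
      by (simp add: cpl_embed_eq_iff left_diff_distrib free_scale_def mult.assoc)
    then have "scal T s b \<oplus>\<^bsub>T\<^esub> y = cpl_embed pT (rank_sum ((s *\<^sub>C c, d) # bs))"
      by (simp add: bs cpl_embed_def toeplitz_simps cpl_add_pclass rank_sum_def mult.assoc)
    then show ?case by blast
  qed
  show thesis
  proof (rule that[OF X])
    fix b
    have "pcauchy pT (\<lambda>n. X n * letter (Elem b) * letter Gen)"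
      using X by (intro pcauchy_mult) auto
    then show "(\<lambda>n. pT ((letter (Elem a) - X n) * letter (Elem b) * letter Gen)) \<longlonglongrightarrow> 0"
      using k(2)[of b] X
      by (simp add: i_A_def toeplitz_S_def toeplitz_simps cpl_embed_def cpl_mult_pclass pcauchy_mult
          pclass_eq_iff left_diff_distrib)
  next
    fix e :: real assume "e > 0"
    then obtain y where y: "y \<in> cspan T ?B" "nrm T (k \<ominus>\<^bsub>T\<^esub> y) < e"
      using k(1) unfolding norm_closure_def by blast
    then obtain bs where bs: "y = cpl_embed pT (rank_sum bs)" using span by blast
    have XY: "pcauchy pT (\<lambda>n. X n - rank_sum bs)"
      using pcauchy_add[OF X(1) pcauchy_const[of "- rank_sum bs"]] by simp
    then obtain r where r: "(\<lambda>n. pT (X n - rank_sum bs)) \<longlonglongrightarrow> r" by (rule pcauchy_tendsto)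
    have "r < e"
      using y(2) cpl_norm_pclass[OF XY r] X bs
      by (simp add: toeplitz_minus_pclass toeplitz_simps cpl_embed_def)
    then show "\<exists>bs. \<forall>\<^sub>F n in sequentially. pT (X n - rank_sum bs) < e"
      using order_tendstoD(2)[OF r] by blast
  qed
qed

end


section \<open>The Fock module\<close>

text \<open>Read \<open>bd x r\<close> as: r is an admissible bound for x. The hypothesis on the
  star gives only one inequality of the C*-identity; it already forces invariance under the star,
  and submultiplicativity gives the other inequality.\<close>

lemma cstar_seminorm_Inf:
  fixes bd :: "'a::unital_cstar_algebra free_alg \<Rightarrow> real \<Rightarrow> bool"
  assumes pos: "\<And>x r. bd x r \<Longrightarrow> 0 \<le> r" and ex: "\<And>x. \<exists>r. bd x r"
    and add: "\<And>x y r s. bd x r \<Longrightarrow> bd y s \<Longrightarrow> bd (x + y) (r + s)"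
    and mult: "\<And>x y r s. bd x r \<Longrightarrow> bd y s \<Longrightarrow> bd (x * y) (r * s)"
    and scale: "\<And>c x r. bd x r \<Longrightarrow> bd (free_scale c x) (cmod c * r)"
    and star: "\<And>x r. bd (free_star x * x) r \<Longrightarrow> bd x (sqrt r)"
  shows "cstar_seminorm (\<lambda>x. Inf {r. bd x r})"
proof -
  define p where "p x = Inf {r. bd x r}" for x
  have lower: "p x \<le> r" if "bd x r" for x r
    unfolding p_def by (rule cInf_lower) (use that pos in \<open>auto simp: bdd_below_def\<close>)
  have greatest: "t \<le> p x" if "\<And>r. bd x r \<Longrightarrow> t \<le> r" for x t
    unfolding p_def by (rule cInf_greatest) (use that ex in auto)
  have p0: "0 \<le> p x" for x by (rule greatest) (rule pos)
  have padd: "p (x + y) \<le> p x + p y" for x y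
  proof -
    have "p (x + y) - s \<le> p x" if s: "bd y s" for s
      using greatest[of x "p (x + y) - s"] lower[OF add[OF _ s]] by (simp add: diff_le_eq)
    then have "p (x + y) - p x \<le> p y" using greatest[of y "p (x + y) - p x"] by fastforce
    then show ?thesis by simp
  qed
  have pscale_le: "p (free_scale c x) \<le> cmod c * p x" for c x
  proof (cases "c = 0")
    case True
    then show ?thesis using ex[of x] lower[OF scale[of x _ c]] by auto
  next
    case False
    have "p (free_scale c x) / cmod c \<le> p x"
    proof (rule greatest)
      fix r assume "bd x r"
      then show "p (free_scale c x) / cmod c \<le> r"
        using lower[OF scale[of x r c]] False by (simp add: divide_le_eq mult.commute)
    qed
    then show ?thesis using False by (simp add: divide_le_eq mult.commute)
  qed
  have pscale: "p (free_scale c x) = cmod c * p x" for c x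
  proof (cases "c = 0")
    case True
    then show ?thesis using pscale_le[of c x] p0[of "free_scale c x"] by simp
  next
    case False
    have "p x \<le> cmod (1 / c) * p (free_scale c x)"
      using pscale_le[of "1 / c" "free_scale c x"] False by (simp add: free_scale_scale)
    then have "cmod c * p x \<le> p (free_scale c x)"
      using False by (simp add: norm_divide field_simps)
    then show ?thesis using pscale_le[of c x] by simp
  qed
  have le_mult: "t \<le> p x * s" if "0 \<le> s" "\<And>r. bd x r \<Longrightarrow> t \<le> r * s" for x s t
  proof (cases "s = 0")
    case True
    then show ?thesis using that ex[of x] by auto
  next
    case False
    then have "t / s \<le> p x" using that by (intro greatest) (simp add: divide_le_eq)
    then show ?thesis using False that by (simp add: divide_le_eq)
  qed
  have pmult: "p (x * y) \<le> p x * p y" for x y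
  proof -
    have "p (x * y) \<le> p x * s" if s: "bd y s" for s
      by (rule le_mult[OF pos[OF s]]) (rule lower[OF mult[OF _ s]])
    then show ?thesis using le_mult[OF p0[of x], of y "p (x * y)"] by (simp add: mult.commute)
  qed
  have star_le: "(p x)\<^sup>2 \<le> p (free_star x * x)" for x
  proof (rule greatest)
    fix r assume r: "bd (free_star x * x) r"
    then have "p x \<le> sqrt r" by (intro lower star)
    then show "(p x)\<^sup>2 \<le> r" using power_mono[of "p x" "sqrt r" 2] p0 pos[OF r] by simp
  qed
  have "p x \<le> p (free_star x)" for x
  proof (cases "p x = 0")
    case False
    then have "p x > 0" using p0[of x] by simp
    moreover have "p x * p x \<le> p (free_star x) * p x"
      using star_le[of x] pmult[of "free_star x" x] by (simp add: power2_eq_square)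
    ultimately show ?thesis by simp
  qed (simp add: p0)
  then have "p (free_star x) = p x" for x by (metis antisym free_star_star)
  then have "p (free_star x * x) = (p x)\<^sup>2" for x
    using star_le[of x] pmult[of "free_star x" x] by (simp add: power2_eq_square)
  then show ?thesis using padd pscale pmult unfolding cstar_seminorm_def p_def by blast
qed

section \<open>Iterates of the endomorphism and the transfer operator\<close>

locale exel_system =
  fixes \<alpha> L :: "'a::comm_unital_cstar_algebra \<Rightarrow> 'a"
  assumes alpha_star_hom: "star_hom \<alpha>" and L_transfer: "transfer_operator \<alpha> L"
begin

lemma alpha_add: "\<alpha> (x + y) = \<alpha> x + \<alpha> y" and alpha_scaleC: "\<alpha> (c *\<^sub>C x) = c *\<^sub>C \<alpha> x"
  and alpha_mult: "\<alpha> (x * y) = \<alpha> x * \<alpha> y" and alpha_star: "\<alpha> (star x) = star (\<alpha> x)"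
  using alpha_star_hom by (auto simp: star_hom_def clinear_map_def)

lemma alpha_zero [simp]: "\<alpha> 0 = 0"
  using alpha_add[of 0 0] by simp

lemma L_add: "L (x + y) = L x + L y" and L_scaleC: "L (c *\<^sub>C x) = c *\<^sub>C L x"
  and L_cpositive: "cpositive x \<Longrightarrow> cpositive (L x)" and L_alpha: "L (\<alpha> a * b) = a * L b"
  using L_transfer by (auto simp: transfer_operator_def clinear_map_def)

lemma L_zero [simp]: "L 0 = 0"
  using L_add[of 0 0] by simp

lemma L_minus: "L (- x) = - L x"
  using L_scaleC[of "-1" x] by (simp add: scaleC_minus_one)

lemma L_diff: "L (x - y) = L x - L y"
  using L_add[of x "- y"] by (simp add: L_minus)

text \<open>Positivity is what ties L to the star: a self-adjoint x is the difference of the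
  positive elements \<open>norm x *\<^sub>R 1\<close> and \<open>norm x *\<^sub>R 1 - x\<close>,
  whose images are positive and hence self-adjoint.\<close>

lemma L_star: "L (star x) = star (L x)"
proof -
  have real: "star (L x) = L x" if x: "star x = x" for x
  proof -
    have "star (L (norm x *\<^sub>R 1 - x)) = L (norm x *\<^sub>R 1 - x)"
      and "star (L (norm x *\<^sub>R 1)) = L (norm x *\<^sub>R 1)"
      using cpositive_scaleR[OF norm_ge_zero[of x] cpositive_star_mult[of "1::'a"]]
      by (auto intro!: cpositive_selfadjoint L_cpositive cpositive_norm_minus x)
    then show ?thesis by (simp add: L_diff star_diff)
  qed
  obtain u v where "star u = u" "star v = v" "x = u + \<i> *\<^sub>C v" by (rule selfadjoint_decomposition)
  then show ?thesis by (simp add: star_add star_scaleC L_add L_scaleC real)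
qed

lemma alpha_pow_mult: "(\<alpha> ^^ n) (x * y) = (\<alpha> ^^ n) x * (\<alpha> ^^ n) y"
  by (induction n) (auto simp: alpha_mult)

lemma L_pow_add: "(L ^^ n) (x + y) = (L ^^ n) x + (L ^^ n) y"
  and L_pow_zero [simp]: "(L ^^ n) 0 = 0"
  and L_pow_scaleC: "(L ^^ n) (c *\<^sub>C x) = c *\<^sub>C (L ^^ n) x"
  and L_pow_star: "(L ^^ n) (star x) = star ((L ^^ n) x)"
  and L_pow_cpositive: "cpositive x \<Longrightarrow> cpositive ((L ^^ n) x)"
  by (induction n) (auto simp: L_add L_star L_cpositive L_scaleC)

lemma L_pow_diff: "(L ^^ n) (x - y) = (L ^^ n) x - (L ^^ n) y"
  by (induction n) (auto simp: L_diff)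

lemma L_pow_scaleR: "(L ^^ n) (r *\<^sub>R x) = r *\<^sub>R (L ^^ n) x"
  using L_pow_scaleC[of n "complex_of_real r" x] by (simp add: scaleC_of_real)

text \<open>\<open>L ^^ n\<close> behaves as a transfer operator for \<open>\<alpha> ^^ n\<close>;
  this makes the form on level n linear for the right action there.\<close>

lemma L_pow_alpha: "(L ^^ n) ((\<alpha> ^^ n) a * b) = a * (L ^^ n) b"
proof (induction n arbitrary: b)
  case (Suc n)
  have "(L ^^ Suc n) ((\<alpha> ^^ Suc n) a * b) = (L ^^ n) (L (\<alpha> ((\<alpha> ^^ n) a) * b))"
    by (simp add: funpow_swap1)
  also have "\<dots> = a * (L ^^ n) (L b)" by (simp add: L_alpha Suc)
  finally show ?case by (simp add: funpow_swap1)
qed simp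

section \<open>The algebraic Fock module\<close>

text \<open>By commutativity \<open>\<langle>a, b\<rangle> = L\<^sup>n (a\<^sup>* b)\<close> turns \<open>A\<close> into the \<open>n\<close>-th tensor power of \<open>M_L\<close>, so
  the algebraic Fock module consists of the finitely supported sequences in \<open>A\<close>.\<close>

abbreviation (input) entry :: "(nat \<Rightarrow>\<^sub>0 'a) \<Rightarrow> nat \<Rightarrow> 'a" where "entry \<equiv> Poly_Mapping.lookup"

definition left_mult :: "'a \<Rightarrow> (nat \<Rightarrow>\<^sub>0 'a) \<Rightarrow> (nat \<Rightarrow>\<^sub>0 'a)" where
  "left_mult a f = Poly_Mapping.map ((*) a) f"

text \<open>Creation by the class of 1: when q(a) tensor q(b) is identified with the class of a
  \<alpha>(b), tensoring 1 from the left sends x to \<alpha>(x).\<close>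

definition shift :: "(nat \<Rightarrow>\<^sub>0 'a) \<Rightarrow> (nat \<Rightarrow>\<^sub>0 'a)" where
  "shift f = Abs_poly_mapping (\<lambda>n. case n of 0 \<Rightarrow> 0 | Suc m \<Rightarrow> \<alpha> (entry f m))"

text \<open>Annihilation by the class of 1, which discards the vacuum component.\<close>

definition unshift :: "(nat \<Rightarrow>\<^sub>0 'a) \<Rightarrow> (nat \<Rightarrow>\<^sub>0 'a)" where
  "unshift f = Abs_poly_mapping (\<lambda>n. L (entry f (Suc n)))"

text \<open>Each of the n tensor factors contributes one twist m a = m \<alpha>(a) to the right
  action.\<close>

definition right_mult :: "'a \<Rightarrow> (nat \<Rightarrow>\<^sub>0 'a) \<Rightarrow> (nat \<Rightarrow>\<^sub>0 'a)" where
  "right_mult a f = Abs_poly_mapping (\<lambda>n. entry f n * (\<alpha> ^^ n) a)"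

definition tail :: "nat \<Rightarrow> (nat \<Rightarrow>\<^sub>0 'a) \<Rightarrow> (nat \<Rightarrow>\<^sub>0 'a)" where
  "tail N f = Abs_poly_mapping (\<lambda>n. if N \<le> n then entry f n else 0)"

lemma left_mult_at [simp]: "entry (left_mult a f) n = a * entry f n"
  by (simp add: left_mult_def map.rep_eq when_def)

lemma shift_at [simp]: "entry (shift f) n = (case n of 0 \<Rightarrow> 0 | Suc m \<Rightarrow> \<alpha> (entry f m))"
proof -
  have "{n. (case n of 0 \<Rightarrow> 0 | Suc m \<Rightarrow> \<alpha> (entry f m)) \<noteq> 0} \<subseteq> Suc ` Poly_Mapping.keys f"
  proof
    fix n assume "n \<in> {n. (case n of 0 \<Rightarrow> 0 | Suc m \<Rightarrow> \<alpha> (entry f m)) \<noteq> 0}"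
    then show "n \<in> Suc ` Poly_Mapping.keys f" by (cases n) (auto simp: in_keys_iff intro!: imageI)
  qed
  then show ?thesis
    unfolding shift_def by (subst lookup_Abs_poly_mapping) (auto intro: finite_subset)
qed

lemma unshift_at [simp]: "entry (unshift f) n = L (entry f (Suc n))"
proof -
  have "{n. L (entry f (Suc n)) \<noteq> 0} \<subseteq> Suc -` Poly_Mapping.keys f"
    by (auto simp: in_keys_iff)
  then have "finite {n. L (entry f (Suc n)) \<noteq> 0}"
    by (rule finite_subset) (simp add: finite_vimageI)
  then show ?thesis unfolding unshift_def by (simp add: lookup_Abs_poly_mapping)
qed

lemma right_mult_at [simp]: "entry (right_mult a f) n = entry f n * (\<alpha> ^^ n) a"
proof -
  have "{n. entry f n * (\<alpha> ^^ n) a \<noteq> 0} \<subseteq> Poly_Mapping.keys f" by (auto simp: in_keys_iff)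
  then show ?thesis
    unfolding right_mult_def by (subst lookup_Abs_poly_mapping) (auto intro: finite_subset)
qed

lemma tail_at [simp]: "entry (tail N f) n = (if N \<le> n then entry f n else 0)"
proof -
  have "{n. (if N \<le> n then entry f n else 0) \<noteq> 0} \<subseteq> Poly_Mapping.keys f" by (auto simp: in_keys_iff)
  then show ?thesis
    unfolding tail_def by (subst lookup_Abs_poly_mapping) (auto intro: finite_subset)
qed

definition finner :: "(nat \<Rightarrow>\<^sub>0 'a) \<Rightarrow> (nat \<Rightarrow>\<^sub>0 'a) \<Rightarrow> 'a" where
  "finner f g = (\<Sum>n\<in>Poly_Mapping.keys f. (L ^^ n) (star (entry f n) * entry g n))"

lemma finner_superset:
  assumes "finite B" "Poly_Mapping.keys f \<subseteq> B \<or> Poly_Mapping.keys g \<subseteq> B"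
  shows "finner f g = (\<Sum>n\<in>B. (L ^^ n) (star (entry f n) * entry g n))"
proof -
  let ?h = "\<lambda>n. (L ^^ n) (star (entry f n) * entry g n)"
  have "finner f g = sum ?h (Poly_Mapping.keys f \<inter> Poly_Mapping.keys g)"
    unfolding finner_def by (rule sum.mono_neutral_right) (auto simp: in_keys_iff)
  also have "\<dots> = sum ?h B"
    by (rule sum.mono_neutral_left) (use assms in \<open>auto simp: in_keys_iff\<close>)
  finally show ?thesis .
qed

lemma finner_add_right: "finner f (g + h) = finner f g + finner f h"
  by (simp add: finner_def lookup_add distrib_left L_pow_add sum.distrib)

lemma finner_diff_right: "finner f (g - h) = finner f g - finner f h"
  by (simp add: finner_def lookup_minus right_diff_distrib L_pow_diff sum_subtractf)

lemma star_finner: "star (finner f g) = finner g f"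
proof -
  have "star (finner f g) = (\<Sum>n\<in>Poly_Mapping.keys f. (L ^^ n) (star (entry g n) * entry f n))"
    by (simp add: finner_def star_sum star_mult star_star flip: L_pow_star)
  then show ?thesis by (simp add: finner_superset[of "Poly_Mapping.keys f" g f])
qed

lemma finner_add_left: "finner (f + g) h = finner f h + finner g h"
  by (metis finner_add_right star_add star_finner)

lemma finner_diff_left: "finner (f - g) h = finner f h - finner g h"
  by (metis finner_diff_right star_diff star_finner)

lemma finner_left_mult: "finner (left_mult a f) g = finner f (left_mult (star a) g)"
proof -
  have "Poly_Mapping.keys (left_mult a f) \<subseteq> Poly_Mapping.keys f" by (auto simp: in_keys_iff)
  then have "finner (left_mult a f) g =
      (\<Sum>n\<in>Poly_Mapping.keys f. (L ^^ n) (star (entry (left_mult a f) n) * entry g n))"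
    by (intro finner_superset) auto
  then show ?thesis by (simp add: finner_def star_mult ac_simps)
qed

lemma finner_left_mult_scaleR: "finner f (left_mult (r *\<^sub>R 1) g) = r *\<^sub>R finner f g"
  by (simp add: finner_def L_pow_scaleR scaleR_sum_right)

lemma finner_right_mult: "finner f (right_mult a g) = finner f g * a"
proof -
  have "(L ^^ n) (star (entry f n) * (entry g n * (\<alpha> ^^ n) a)) = (L ^^ n) (star (entry f n) * entry g n) * a" for n
    using L_pow_alpha[of n a "star (entry f n) * entry g n"] by (simp add: ac_simps)
  then show ?thesis by (simp add: finner_def sum_distrib_right)
qed

lemma finner_right_mult_left: "finner (right_mult a f) g = star a * finner f g"
  by (metis finner_right_mult star_finner star_mult)

lemma cpositive_finner: "cpositive (finner f f)"
  unfolding finner_def by (intro cpositive_sum L_pow_cpositive) simp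

text \<open>Adjointness of creation and annihilation is the identity
  \<open>L (\<alpha> a * b) = a * L b\<close>, applied once at the innermost of the n + 1 copies of
  L.\<close>

lemma finner_shift: "finner (shift f) g = finner f (unshift g)"
proof -
  have "Poly_Mapping.keys (shift f) \<subseteq> Suc ` Poly_Mapping.keys f"
    by (auto simp: in_keys_iff image_iff split: nat.splits)
  then have "finner (shift f) g
      = (\<Sum>n\<in>Suc ` Poly_Mapping.keys f. (L ^^ n) (star (entry (shift f) n) * entry g n))"
    by (intro finner_superset) auto
  also have "\<dots> = (\<Sum>n\<in>Poly_Mapping.keys f. (L ^^ n) (L (\<alpha> (star (entry f n)) * entry g (Suc n))))"
    by (simp add: sum.reindex alpha_star funpow_swap1)
  finally show ?thesis by (simp add: finner_def L_alpha)
qed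

lemma finner_unshift: "finner (unshift f) g = finner f (shift g)"
  by (metis finner_shift star_finner)

definition fnorm :: "(nat \<Rightarrow>\<^sub>0 'a) \<Rightarrow> real" where
  "fnorm f = sqrt (norm (finner f f))"

lemma fnorm_nonneg [simp]: "0 \<le> fnorm f"
  by (simp add: fnorm_def)

lemma fnorm_sq: "(fnorm f)\<^sup>2 = norm (finner f f)"
  by (simp add: fnorm_def)

lemma cauchy_schwarz: "norm (finner f g) \<le> fnorm f * fnorm g"
proof -
  have le: "(norm (finner f g))\<^sup>2 \<le> t * norm (finner g g)" if t: "t > norm (finner f f)" for t
  proof -
    define a where "a = finner f g"
    \<comment> \<open>Positivity of the form at f a - t g, with a = \<langle>f, g\<rangle>, gives 2t
      a^* a \<le> a^* \<langle>f, f\<rangle> a + t^2 \<langle>g, g\<rangle>, and the first term on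
      the right is at most t a^* a.\<close>
    define k where "k = right_mult a f - left_mult (t *\<^sub>R 1) g"
    have t0: "t > 0" using t norm_ge_zero le_less_trans by blast
    have sa: "star a = finner g f" by (simp add: a_def star_finner)
    have gl: "finner (left_mult (t *\<^sub>R 1) g) h = t *\<^sub>R finner g h" for h
      by (simp add: finner_left_mult star_scaleR finner_left_mult_scaleR)
    have "finner k k = star a * finner f f * a - (2 * t) *\<^sub>R (star a * a) + (t * t) *\<^sub>R finner g g"
      by (simp add: k_def finner_diff_left finner_diff_right finner_right_mult finner_right_mult_left
          gl finner_left_mult_scaleR sa algebra_simps scaleR_add_left[symmetric] flip: a_def)
    moreover have "cpositive (t *\<^sub>R (star a * a) - star a * finner f f * a)"
    proof -
      have "cpositive (t *\<^sub>R 1 - finner f f)"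
        using t by (intro cpositive_norm_minus) (auto simp: star_finner)
      then have "cpositive ((t *\<^sub>R 1 - finner f f) * (star a * a))"
        by (rule cpositive_mult) simp
      then show ?thesis by (simp add: algebra_simps)
    qed
    ultimately have "cpositive (star a * finner f f * a - (2 * t) *\<^sub>R (star a * a) +
        (t * t) *\<^sub>R finner g g + (t *\<^sub>R (star a * a) - star a * finner f f * a))"
      using cpositive_add[OF cpositive_finner[of k]] by metis
    moreover have "(2 * t) *\<^sub>R x = t *\<^sub>R x + t *\<^sub>R x" for x :: 'a
      by (simp flip: scaleR_add_left)
    ultimately have "cpositive ((t * t) *\<^sub>R finner g g - t *\<^sub>R (star a * a))"
      by (simp add: algebra_simps)
    then have "cpositive ((1 / t) *\<^sub>R ((t * t) *\<^sub>R finner g g - t *\<^sub>R (star a * a)))"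
      using t0 by (intro cpositive_scaleR) auto
    then have "cpositive (t *\<^sub>R finner g g - star a * a)"
      using t0 by (simp add: scaleR_diff_right)
    then have "norm (star a * a) \<le> norm (t *\<^sub>R finner g g)"
      by (intro cpositive_norm_mono) auto
    then show ?thesis using t0 by (simp add: cstar_identity a_def)
  qed
  have "(norm (finner f g))\<^sup>2 \<le> norm (finner f f) * norm (finner g g)"
  proof (rule field_le_epsilon)
    fix e :: real assume e: "e > 0"
    \<comment> \<open>The number t must exceed the norm of \<langle>f, f\<rangle> strictly in order
      to be positive; an excess of d costs at most e. The added 1 keeps the denominator
      positive.\<close>
    define d where "d = e / (norm (finner g g) + 1)"
    have "d > 0" using e by (simp add: d_def add_nonneg_pos)
    then have "(norm (finner f g))\<^sup>2 \<le> (norm (finner f f) + d) * norm (finner g g)"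
      by (intro le) simp
    also have "d * norm (finner g g) \<le> e"
      using e by (simp add: d_def divide_le_eq add_nonneg_pos mult_left_mono)
    then have "(norm (finner f f) + d) * norm (finner g g) \<le> norm (finner f f) * norm (finner g g) + e"
      by (simp add: distrib_right)
    finally show "(norm (finner f g))\<^sup>2 \<le> norm (finner f f) * norm (finner g g) + e" .
  qed
  then have "(norm (finner f g))\<^sup>2 \<le> (fnorm f * fnorm g)\<^sup>2"
    by (simp add: power_mult_distrib fnorm_sq)
  then show ?thesis by (rule power2_le_imp_le) simp
qed

lemma fnorm_triangle: "fnorm (f + g) \<le> fnorm f + fnorm g"
proof -
  have "(fnorm (f + g))\<^sup>2 = norm ((finner f f + finner f g) + (finner g f + finner g g))"
    by (simp add: fnorm_sq finner_add_left finner_add_right algebra_simps)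
  also have "\<dots> \<le> (norm (finner f f) + norm (finner f g)) + (norm (finner g f) + norm (finner g g))"
    by (intro norm_triangle_mono norm_triangle_ineq)
  also have "\<dots> \<le> (fnorm f + fnorm g)\<^sup>2"
  proof -
    have "norm (finner g f) \<le> fnorm f * fnorm g"
      using cauchy_schwarz[of g f] by (simp add: mult.commute)
    then show ?thesis
      using cauchy_schwarz[of f g] by (simp add: power2_sum fnorm_sq)
  qed
  finally show ?thesis by (rule power2_le_imp_le) simp
qed

lemma fnorm_minus: "fnorm (- f) = fnorm f"
  using finner_diff_left[of 0 f "- f"] finner_diff_right[of f 0 f]
  by (simp add: fnorm_def finner_def)

lemma fnorm_zero [simp]: "fnorm 0 = 0"
  by (simp add: fnorm_def finner_def)

sublocale fnorm: seminorm fnorm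
  by standard (simp_all add: fnorm_triangle fnorm_minus)

text \<open>By commutativity the positive element
  \<open>(norm a)\<^sup>2 *\<^sub>R 1 - star a * a\<close> can be moved next to the squared entries,
  so the difference of the two forms is positive level by level.\<close>

lemma fnorm_left_mult: "fnorm (left_mult a f) \<le> norm a * fnorm f"
proof -
  have "cpositive ((norm a)\<^sup>2 *\<^sub>R finner f f - finner (left_mult a f) (left_mult a f))"
  proof -
    have "cpositive ((norm a)\<^sup>2 *\<^sub>R 1 - star a * a)"
      by (intro cpositive_norm_minus) (auto simp: star_mult star_star cstar_identity)
    then have "cpositive (\<Sum>n\<in>Poly_Mapping.keys f.
        (L ^^ n) (((norm a)\<^sup>2 *\<^sub>R 1 - star a * a) * (star (entry f n) * entry f n)))"
      by (intro cpositive_sum L_pow_cpositive cpositive_mult[OF _ cpositive_star_mult])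
    also have "(\<Sum>n\<in>Poly_Mapping.keys f.
        (L ^^ n) (((norm a)\<^sup>2 *\<^sub>R 1 - star a * a) * (star (entry f n) * entry f n))) =
        (norm a)\<^sup>2 *\<^sub>R finner f f - finner f (left_mult (star a) (left_mult a f))"
    proof -
      have "(L ^^ n) (((norm a)\<^sup>2 *\<^sub>R 1 - star a * a) * (star x * x)) =
          (norm a)\<^sup>2 *\<^sub>R (L ^^ n) (star x * x) - (L ^^ n) (star x * (star a * (a * x)))" for n x
        by (simp add: left_diff_distrib L_pow_diff L_pow_scaleR) (simp add: ac_simps)
      then show ?thesis by (simp add: finner_def sum_subtractf scaleR_sum_right)
    qed
    finally show ?thesis by (simp add: finner_left_mult)
  qed
  then have "norm (finner (left_mult a f) (left_mult a f)) \<le> norm ((norm a)\<^sup>2 *\<^sub>R finner f f)"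
    by (intro cpositive_norm_mono cpositive_finner)
  then have "(fnorm (left_mult a f))\<^sup>2 \<le> (norm a * fnorm f)\<^sup>2"
    by (simp add: fnorm_sq power_mult_distrib)
  then show ?thesis by (rule power2_le_imp_le) simp
qed

lemma fnorm_right_mult: "fnorm (right_mult a f) \<le> norm a * fnorm f"
proof -
  have "(fnorm (right_mult a f))\<^sup>2 = norm (star a * finner f f * a)"
    by (simp add: fnorm_sq finner_right_mult finner_right_mult_left)
  also have "\<dots> \<le> norm (star a) * norm (finner f f) * norm a"
    by (meson mult_right_mono norm_ge_zero norm_mult_ineq order_trans)
  also have "\<dots> = (norm a * fnorm f)\<^sup>2"
    by (simp add: power_mult_distrib fnorm_sq) (simp add: power2_eq_square)
  finally show ?thesis by (rule power2_le_imp_le) simp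
qed

lemma fnorm_shift: "fnorm (shift f) \<le> sqrt (norm (L 1)) * fnorm f"
proof -
  have "L (\<alpha> x) = L 1 * x" for x using L_alpha[of x 1] by (simp add: mult.commute)
  \<comment> \<open>S^* S acts as left multiplication by L(1), which explains the constant.\<close>
  then have "unshift (shift f) = left_mult (L 1) f"
    by (intro poly_mapping_eqI) simp
  then have "(fnorm (shift f))\<^sup>2 = norm (finner f (left_mult (L 1) f))"
    by (simp add: fnorm_sq finner_shift)
  also have "\<dots> \<le> fnorm f * (norm (L 1) * fnorm f)"
    using cauchy_schwarz[of f "left_mult (L 1) f"] fnorm_left_mult[of "L 1" f]
    by (meson fnorm_nonneg mult_left_mono order_trans)
  also have "\<dots> = (sqrt (norm (L 1)) * fnorm f)\<^sup>2"
    by (simp add: power_mult_distrib power2_eq_square)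
  finally show ?thesis by (rule power2_le_imp_le) simp
qed

lemma fnorm_unshift: "fnorm (unshift f) \<le> sqrt (norm (L 1)) * fnorm f"
proof (cases "fnorm (unshift f) = 0")
  case False
  then have pos: "fnorm (unshift f) > 0" using fnorm_nonneg[of "unshift f"] by linarith
  have "fnorm (unshift f) * fnorm (unshift f) = norm (finner f (shift (unshift f)))"
    using fnorm_sq[of "unshift f"] by (simp add: finner_unshift power2_eq_square)
  also have "\<dots> \<le> fnorm f * (sqrt (norm (L 1)) * fnorm (unshift f))"
    using cauchy_schwarz fnorm_shift by (meson fnorm_nonneg mult_left_mono order_trans)
  finally show ?thesis using pos by (simp add: ac_simps)
qed simp

lemma fnorm_tail: "fnorm (tail N f) \<le> fnorm f"
proof -
  let ?K = "Poly_Mapping.keys f"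
  have "Poly_Mapping.keys (tail N f) \<subseteq> ?K" by (auto simp: in_keys_iff split: if_splits)
  then have "finner (tail N f) (tail N f)
      = (\<Sum>n\<in>?K. (L ^^ n) (star (entry (tail N f) n) * entry (tail N f) n))"
    by (intro finner_superset) auto
  moreover have "(L ^^ n) (star (entry f n) * entry f n) - (L ^^ n) (star (entry (tail N f) n) * entry (tail N f) n)
      = (L ^^ n) (star (entry (f - tail N f) n) * entry (f - tail N f) n)" for n
    by (simp add: lookup_minus)
  ultimately have "cpositive (finner f f - finner (tail N f) (tail N f))"
    unfolding finner_def[of f f] by (simp add: cpositive_sum L_pow_cpositive flip: sum_subtractf)
  then show ?thesis unfolding fnorm_def by (simp add: cpositive_norm_mono cpositive_finner)
qed


section \<open>The Fock representation of the free algebra\<close>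

fun act :: "'a letter \<Rightarrow> (nat \<Rightarrow>\<^sub>0 'a) \<Rightarrow> (nat \<Rightarrow>\<^sub>0 'a)" where
  "act (Elem a) = left_mult a"
| "act Gen = shift"
| "act Gen_adj = unshift"

definition act_word :: "'a letter list \<Rightarrow> (nat \<Rightarrow>\<^sub>0 'a) \<Rightarrow> (nat \<Rightarrow>\<^sub>0 'a)" where
  "act_word w f = foldr act w f"

text \<open>Complex scalars act through left multiplication by \<open>c *\<^sub>C 1\<close>, so
  linearity in x becomes a property of \<open>left_mult\<close>.\<close>

definition rep :: "'a free_alg \<Rightarrow> (nat \<Rightarrow>\<^sub>0 'a) \<Rightarrow> (nat \<Rightarrow>\<^sub>0 'a)" where
  "rep x f = (\<Sum>w\<in>Poly_Mapping.keys x. left_mult (Poly_Mapping.lookup x w *\<^sub>C 1) (act_word w f))"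

lemma act_add: "act l (f + g) = act l f + act l g"
  by (cases l; intro poly_mapping_eqI)
    (auto simp: lookup_add distrib_left alpha_add L_add split: nat.splits)

lemma act_scale: "act l (left_mult (c *\<^sub>C 1) f) = left_mult (c *\<^sub>C 1) (act l f)"
  by (cases l; intro poly_mapping_eqI)
    (auto simp: mult_scaleC_left mult_scaleC_right alpha_scaleC L_scaleC split: nat.splits)

text \<open>Fock operators are linear for the right action of A. The cutoffs modulo K_\<alpha> are
  right multiplications and will therefore commute with the whole representation.\<close>

lemma act_right_mult: "act l (right_mult a f) = right_mult a (act l f)"
proof (cases l)
  case (Elem b)
  then show ?thesis by (intro poly_mapping_eqI) (simp add: mult.assoc)
next
  case Gen
  then show ?thesis by (intro poly_mapping_eqI) (simp add: alpha_mult split: nat.split)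
next
  case Gen_adj
  have "L (x * \<alpha> y) = L x * y" for x y using L_alpha[of y x] by (simp add: mult.commute)
  then show ?thesis using Gen_adj by (intro poly_mapping_eqI) simp
qed

lemma finner_act: "finner (act l f) g = finner f (act (letter_adj l) g)"
  by (cases l) (simp_all add: finner_left_mult finner_shift finner_unshift)

lemma left_mult_add: "left_mult a (f + g) = left_mult a f + left_mult a g"
  by (intro poly_mapping_eqI) (simp add: lookup_add distrib_left)

lemma left_mult_zero [simp]: "left_mult a 0 = 0" "left_mult 0 f = 0"
  by (intro poly_mapping_eqI; simp)+

lemma left_mult_one [simp]: "left_mult 1 f = f"
  by (intro poly_mapping_eqI) simp

lemma left_mult_left_mult: "left_mult a (left_mult b f) = left_mult (a * b) f"
  by (intro poly_mapping_eqI) (simp add: mult.assoc)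

lemma left_mult_add_left: "left_mult (a + b) f = left_mult a f + left_mult b f"
  by (intro poly_mapping_eqI) (simp add: lookup_add distrib_right)

lemma right_mult_add: "right_mult a (f + g) = right_mult a f + right_mult a g"
  by (intro poly_mapping_eqI) (simp add: lookup_add distrib_right)

lemma right_mult_zero [simp]: "right_mult a 0 = 0"
  by (intro poly_mapping_eqI) simp

lemma left_right_mult: "left_mult a (right_mult b f) = right_mult b (left_mult a f)"
  by (intro poly_mapping_eqI) (simp add: mult.assoc)

lemma act_word_Nil [simp]: "act_word [] f = f"
  and act_word_Cons [simp]: "act_word (l # w) f = act l (act_word w f)"
  and act_word_append: "act_word (v @ w) f = act_word v (act_word w f)"
  by (simp_all add: act_word_def)

lemma act_word_add: "act_word w (f + g) = act_word w f + act_word w g"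
  by (induction w) (simp_all add: act_add)

lemma act_word_scale: "act_word w (left_mult (c *\<^sub>C 1) f) = left_mult (c *\<^sub>C 1) (act_word w f)"
  by (induction w) (simp_all add: act_scale)

lemma act_word_right_mult: "act_word w (right_mult a f) = right_mult a (act_word w f)"
  by (induction w) (simp_all add: act_right_mult)

lemma finner_act_word: "finner (act_word w f) g = finner f (act_word (rev (map letter_adj w)) g)"
  by (induction w arbitrary: g) (simp_all add: finner_act act_word_append)

lemma rep_superset:
  assumes "finite B" "Poly_Mapping.keys x \<subseteq> B"
  shows "rep x f = (\<Sum>w\<in>B. left_mult (Poly_Mapping.lookup x w *\<^sub>C 1) (act_word w f))"
  unfolding rep_def by (rule sum.mono_neutral_left) (use assms in \<open>auto simp: in_keys_iff\<close>)

lemma rep_zero [simp]: "rep 0 f = 0"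
  by (simp add: rep_def)

lemma rep_add: "rep (x + y) f = rep x f + rep y f"
proof -
  let ?B = "Poly_Mapping.keys x \<union> Poly_Mapping.keys y"
  have "Poly_Mapping.keys (x + y) \<subseteq> ?B" by (rule keys_add)
  then show ?thesis
    by (simp add: rep_superset[of ?B] lookup_add scaleC_add_left left_mult_add_left sum.distrib)
qed

lemma rep_minus: "rep (- x) f = - rep x f"
  using rep_add[of x "- x" f] by (simp add: eq_neg_iff_add_eq_0 add.commute)

lemma rep_diff: "rep (x - y) f = rep x f - rep y f"
  using rep_add[of x "- y" f] by (simp add: rep_minus)

lemma rep_single [simp]: "rep (Poly_Mapping.single w c) f = left_mult (c *\<^sub>C 1) (act_word w f)"
  by (subst rep_superset[of "{w}"]) auto

lemma rep_letter [simp]: "rep (letter l) f = act l f"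
  by (simp add: letter_def)

lemma rep_one [simp]: "rep 1 f = f"
  using rep_single[of "[]" 1 f] by (simp add: single_Nil_one)

lemma rep_add_right: "rep x (f + g) = rep x f + rep x g"
  by (simp add: rep_def act_word_add left_mult_add sum.distrib)

lemma rep_right_mult: "rep x (right_mult a f) = right_mult a (rep x f)"
  by (induction x rule: poly_mapping_single_induct)
    (simp_all add: rep_add act_word_right_mult right_mult_add left_right_mult)

lemma rep_single_mult: "rep (Poly_Mapping.single v c * y) f = left_mult (c *\<^sub>C 1) (act_word v (rep y f))"
proof (induction y rule: poly_mapping_single_induct)
  case zero
  have "act_word v 0 = 0" using act_word_add[of v 0 0] by simp
  then show ?case by simp
next
  case (single_add w d y)
  have "left_mult ((c * d) *\<^sub>C 1) (act_word (v @ w) f) =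
      left_mult (c *\<^sub>C 1) (act_word v (left_mult (d *\<^sub>C 1) (act_word w f)))"
    by (simp add: act_word_append act_word_scale left_mult_left_mult mult_scaleC_left scaleC_scaleC)
  then show ?case
    using single_add
    by (simp add: distrib_left rep_add mult_single plus_list_def act_word_add left_mult_add)
qed

lemma rep_mult: "rep (x * y) f = rep x (rep y f)"
  by (induction x rule: poly_mapping_single_induct)
    (simp_all add: distrib_right rep_add rep_single_mult)

lemma rep_free_scale: "rep (free_scale c x) f = left_mult (c *\<^sub>C 1) (rep x f)"
  by (simp add: free_scale_def rep_mult)

lemma finner_rep: "finner (rep x f) g = finner f (rep (free_star x) g)"
proof (induction x rule: poly_mapping_single_induct)
  case zero
  then show ?case by (simp add: finner_def)
next
  case (single_add w c x)
  have "finner (left_mult (c *\<^sub>C 1) (act_word w f)) g =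
      finner f (left_mult (cnj c *\<^sub>C 1) (act_word (rev (map letter_adj w)) g))"
    by (simp add: finner_left_mult finner_act_word star_scaleC act_word_scale)
  then show ?case
    using single_add
    by (simp add: rep_add finner_add_left finner_add_right free_star_add)
qed

lemma rep_bounded: "\<exists>B\<ge>0. \<forall>f. fnorm (rep x f) \<le> B * fnorm f"
proof (induction x rule: poly_mapping_single_induct)
  case zero
  then show ?case by (intro exI[of _ 0]) simp
next
  case (single_add w c x)
  have letter: "\<exists>B\<ge>0. \<forall>f. fnorm (act l f) \<le> B * fnorm f" for l
  proof (cases l)
    case (Elem a)
    then show ?thesis using fnorm_left_mult[of a] by (intro exI[of _ "norm a"]) simp
  next
    case Gen
    then show ?thesis using fnorm_shift by (intro exI[of _ "sqrt (norm (L 1))"]) simp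
  next
    case Gen_adj
    then show ?thesis using fnorm_unshift by (intro exI[of _ "sqrt (norm (L 1))"]) simp
  qed
  have "\<exists>B\<ge>0. \<forall>f. fnorm (act_word w f) \<le> B * fnorm f"
  proof (induction w)
    case Nil
    then show ?case by (intro exI[of _ 1]) simp
  next
    case (Cons l w)
    then obtain B where B: "B \<ge> 0" "\<And>f. fnorm (act_word w f) \<le> B * fnorm f" by blast
    obtain C where C: "C \<ge> 0" "\<And>f. fnorm (act l f) \<le> C * fnorm f" using letter[of l] by blast
    have "fnorm (act l (act_word w f)) \<le> C * (B * fnorm f)" for f
      using C B by (meson mult_left_mono order_trans)
    then show ?case using B C by (intro exI[of _ "C * B"]) (simp add: mult.assoc)
  qed
  then obtain B where B: "B \<ge> 0" "\<And>f. fnorm (act_word w f) \<le> B * fnorm f" by blast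
  obtain C where C: "C \<ge> 0" "\<And>f. fnorm (rep x f) \<le> C * fnorm f" using single_add by blast
  have "fnorm (rep (Poly_Mapping.single w c + x) f) \<le> (norm (c *\<^sub>C (1::'a)) * B + C) * fnorm f" for f
  proof -
    have "fnorm (left_mult (c *\<^sub>C 1) (act_word w f)) \<le> norm (c *\<^sub>C (1::'a)) * (B * fnorm f)"
      using fnorm_left_mult B by (meson mult_left_mono norm_ge_zero order_trans)
    then show ?thesis
      using fnorm_triangle[of "left_mult (c *\<^sub>C 1) (act_word w f)" "rep x f"] C(2)[of f]
      by (simp add: rep_add distrib_right mult.assoc)
  qed
  then show ?case using B C by (intro exI[of _ "norm (c *\<^sub>C (1::'a)) * B + C"]) auto
qed

text \<open>The relation S^* a S = L(a) holds because L(a \<alpha>(x)) = L(a) x on each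
  entry.\<close>

lemma rep_relation: "r \<in> toeplitz_relations \<alpha> L \<Longrightarrow> rep r f = 0"
proof -
  have 1: "shift (left_mult a f) = left_mult (\<alpha> a) (shift f)" for a
    by (intro poly_mapping_eqI) (auto simp: alpha_mult split: nat.splits)
  have "L (x * \<alpha> y) = L x * y" for x y using L_alpha[of y x] by (simp add: mult.commute)
  then have 2: "unshift (left_mult a (shift f)) = left_mult (L a) f" for a
    by (intro poly_mapping_eqI) simp
  show "rep r f = 0" if "r \<in> toeplitz_relations \<alpha> L"
    using that unfolding toeplitz_relations_def
    by (auto simp: rep_diff rep_add rep_mult rep_free_scale left_mult_add_left left_mult_left_mult
        mult_scaleC_left 1 2)
qed

section \<open>Seminorms from cutoffs\<close>

text \<open>A family \<open>C\<close> of contractive cutoffs yields the seminorm \<open>x \<mapsto> inf \<parallel>rep x \<circ> c\<parallel>\<close> over \<open>c \<in> C\<close>,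
  which plays the role of the norm in a quotient of the algebra of operators on the Fock module.\<close>

definition cut_bound :: "((nat \<Rightarrow>\<^sub>0 'a) \<Rightarrow> (nat \<Rightarrow>\<^sub>0 'a)) set \<Rightarrow> 'a free_alg \<Rightarrow> real \<Rightarrow> bool" where
  "cut_bound C x r \<longleftrightarrow> 0 \<le> r \<and> (\<exists>c\<in>C. \<forall>f. fnorm (rep x (c f)) \<le> r * fnorm f)"

definition cut_seminorm :: "((nat \<Rightarrow>\<^sub>0 'a) \<Rightarrow> (nat \<Rightarrow>\<^sub>0 'a)) set \<Rightarrow> 'a free_alg \<Rightarrow> real" where
  "cut_seminorm C x = Inf {r. cut_bound C x r}"

text \<open>A common refinement of two cutoffs yields subadditivity of the infimum. The last clause
  yields submultiplicativity: behind a suitable cutoff e, the image of y lies in the range of c,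
  with a preimage whose norm is controlled by y on the range of d.\<close>

definition cutoff_family :: "((nat \<Rightarrow>\<^sub>0 'a) \<Rightarrow> (nat \<Rightarrow>\<^sub>0 'a)) set \<Rightarrow> bool" where
  "cutoff_family C \<longleftrightarrow> C \<noteq> {} \<and> (\<forall>c\<in>C. \<forall>f. fnorm (c f) \<le> fnorm f) \<and>
     (\<forall>c\<in>C. \<forall>d\<in>C. \<exists>e\<in>C. \<forall>f. \<exists>g h. e f = c g \<and> e f = d h \<and> fnorm g \<le> fnorm f \<and> fnorm h \<le> fnorm f) \<and>
     (\<forall>c\<in>C. \<forall>d\<in>C. \<forall>y. \<exists>e\<in>C. \<forall>f. \<exists>g h.
        rep y (e f) = c g \<and> fnorm g \<le> fnorm (rep y (d h)) \<and> fnorm h \<le> fnorm f)"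

lemma cut_seminorm_lower: "cut_bound C x r \<Longrightarrow> cut_seminorm C x \<le> r"
  unfolding cut_seminorm_def by (rule cInf_lower) (auto simp: cut_bound_def bdd_below_def)

lemma cut_boundI: "0 \<le> r \<Longrightarrow> c \<in> C \<Longrightarrow> (\<And>f. fnorm (rep x (c f)) \<le> r * fnorm f) \<Longrightarrow> cut_bound C x r"
  by (auto simp: cut_bound_def)

lemma cut_bound_ex: "cutoff_family C \<Longrightarrow> \<exists>r. cut_bound C x r"
proof -
  assume C: "cutoff_family C"
  then have "C \<noteq> {}" "\<And>c f. c \<in> C \<Longrightarrow> fnorm (c f) \<le> fnorm f" unfolding cutoff_family_def by blast+
  then obtain c where c: "c \<in> C" "\<And>f. fnorm (c f) \<le> fnorm f" by blast
  obtain B where B: "B \<ge> 0" "\<And>f. fnorm (rep x f) \<le> B * fnorm f" using rep_bounded by blast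
  have "fnorm (rep x (c f)) \<le> B * fnorm f" for f
    using B c(2) by (meson mult_left_mono order_trans)
  then show ?thesis using B c by (blast intro: cut_boundI)
qed

lemma cut_seminorm_greatest:
  "cutoff_family C \<Longrightarrow> (\<And>r. cut_bound C x r \<Longrightarrow> t \<le> r) \<Longrightarrow> t \<le> cut_seminorm C x"
  unfolding cut_seminorm_def by (rule cInf_greatest) (use cut_bound_ex in auto)

lemma cut_seminorm_less:
  "cutoff_family C \<Longrightarrow> cut_seminorm C x < t \<Longrightarrow> \<exists>r<t. cut_bound C x r"
  using cut_seminorm_greatest[of C x t] by (meson not_le)

lemma toeplitz_cstar_seminorm_cut_seminorm:
  assumes C: "cutoff_family C"
  shows "toeplitz_cstar_seminorm \<alpha> L (cut_seminorm C)"
proof -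
  have contr: "fnorm (c f) \<le> fnorm f" if "c \<in> C" for c f
    using C that unfolding cutoff_family_def by blast
  have "cstar_seminorm (\<lambda>x. Inf {r. cut_bound C x r})"
  proof (rule cstar_seminorm_Inf)
    show "0 \<le> r" if "cut_bound C x r" for x r using that by (simp add: cut_bound_def)
    show "\<exists>r. cut_bound C x r" for x using C by (rule cut_bound_ex)
    fix x y r s assume "cut_bound C x r" "cut_bound C y s"
    then obtain c d where c: "c \<in> C" "0 \<le> r" "\<And>f. fnorm (rep x (c f)) \<le> r * fnorm f"
      and d: "d \<in> C" "0 \<le> s" "\<And>f. fnorm (rep y (d f)) \<le> s * fnorm f"
      unfolding cut_bound_def by blast
    obtain e where e: "e \<in> C"
      "\<And>f. \<exists>g h. e f = c g \<and> e f = d h \<and> fnorm g \<le> fnorm f \<and> fnorm h \<le> fnorm f"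
      using C c(1) d(1) unfolding cutoff_family_def by blast
    show "cut_bound C (x + y) (r + s)"
    proof (rule cut_boundI[OF _ e(1)])
      fix f
      obtain g h where gh: "e f = c g" "e f = d h" "fnorm g \<le> fnorm f" "fnorm h \<le> fnorm f"
        using e(2) by blast
      have "fnorm (rep (x + y) (e f)) \<le> fnorm (rep x (c g)) + fnorm (rep y (d h))"
        using fnorm_triangle[of "rep x (e f)" "rep y (e f)"] gh by (simp add: rep_add)
      also have "\<dots> \<le> r * fnorm f + s * fnorm f"
        using c d gh by (meson add_mono mult_left_mono order_trans)
      finally show "fnorm (rep (x + y) (e f)) \<le> (r + s) * fnorm f" by (simp add: distrib_right)
    qed (use c d in simp)
    obtain e where e: "e \<in> C" "\<And>f. \<exists>g h.
        rep y (e f) = c g \<and> fnorm g \<le> fnorm (rep y (d h)) \<and> fnorm h \<le> fnorm f"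
      using C c(1) d(1) unfolding cutoff_family_def by blast
    show "cut_bound C (x * y) (r * s)"
    proof (rule cut_boundI[OF _ e(1)])
      fix f
      obtain g h where gh: "rep y (e f) = c g" "fnorm g \<le> fnorm (rep y (d h))" "fnorm h \<le> fnorm f"
        using e(2) by blast
      have "fnorm g \<le> s * fnorm f" using gh d by (meson mult_left_mono order_trans)
      then have "fnorm (rep x (c g)) \<le> r * (s * fnorm f)" using c by (meson mult_left_mono order_trans)
      then show "fnorm (rep (x * y) (e f)) \<le> r * s * fnorm f" by (simp add: rep_mult gh mult.assoc)
    qed (use c d in simp)
  next
    fix k x r assume "cut_bound C x r"
    then obtain c where c: "c \<in> C" "0 \<le> r" "\<And>f. fnorm (rep x (c f)) \<le> r * fnorm f"
      unfolding cut_bound_def by blast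
    show "cut_bound C (free_scale k x) (cmod k * r)"
    proof (rule cut_boundI[OF _ c(1)])
      fix f
      have "norm (k *\<^sub>C (1::'a)) \<le> cmod k" by (simp add: norm_scaleC mult_left_le norm_one_le)
      then have "fnorm (rep (free_scale k x) (c f)) \<le> cmod k * fnorm (rep x (c f))"
        unfolding rep_free_scale using fnorm_left_mult by (meson fnorm_nonneg mult_right_mono order_trans)
      also have "\<dots> \<le> cmod k * (r * fnorm f)" using c by (simp add: mult_left_mono)
      finally show "fnorm (rep (free_scale k x) (c f)) \<le> cmod k * r * fnorm f" by (simp add: mult.assoc)
    qed (use c in simp)
  next
    fix x r assume "cut_bound C (free_star x * x) r"
    then obtain c where c: "c \<in> C" "0 \<le> r" "\<And>f. fnorm (rep (free_star x * x) (c f)) \<le> r * fnorm f"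
      unfolding cut_bound_def by blast
    show "cut_bound C x (sqrt r)"
    proof (rule cut_boundI[OF _ c(1)])
      fix f
      \<comment> \<open>Cauchy-Schwarz at the vector c f turns a bound for x^* x behind the cutoff
        into its square root for x; contractivity replaces the remaining c f by f.\<close>
      have "(fnorm (rep x (c f)))\<^sup>2 = norm (finner (c f) (rep (free_star x * x) (c f)))"
        by (simp add: fnorm_sq finner_rep rep_mult)
      also have "\<dots> \<le> fnorm (c f) * fnorm (rep (free_star x * x) (c f))" by (rule cauchy_schwarz)
      also have "\<dots> \<le> fnorm f * (r * fnorm f)" using c contr by (intro mult_mono) auto
      also have "\<dots> = (sqrt r * fnorm f)\<^sup>2" using c by (simp add: power_mult_distrib power2_eq_square)
      finally show "fnorm (rep x (c f)) \<le> sqrt r * fnorm f" using c by (auto intro: power2_le_imp_le)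
    qed (use c in simp)
  qed
  moreover have "cut_seminorm C r = 0" if r: "r \<in> toeplitz_relations \<alpha> L" for r
  proof (rule antisym)
    obtain c where "c \<in> C" using C unfolding cutoff_family_def by blast
    then have "cut_bound C r 0" by (rule cut_boundI[OF order_refl]) (simp add: rep_relation r)
    then show "cut_seminorm C r \<le> 0" by (rule cut_seminorm_lower)
    show "0 \<le> cut_seminorm C r" by (rule cut_seminorm_greatest[OF C]) (simp add: cut_bound_def)
  qed
  ultimately show ?thesis by (simp add: toeplitz_cstar_seminorm_def cut_seminorm_def[abs_def])
qed

text \<open>The identity alone is a cutoff family, and its seminorm is the operator norm of the Fock
  representation; universality compares it with the Toeplitz norm.\<close>

lemma fnorm_rep_le: "fnorm (rep x f) \<le> toeplitz_seminorm \<alpha> L x * fnorm f"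
proof -
  have C: "cutoff_family {\<lambda>f. f}" unfolding cutoff_family_def by auto
  have "fnorm (rep x f) \<le> cut_seminorm {\<lambda>f. f} x * fnorm f"
  proof (cases "fnorm f = 0")
    \<comment> \<open>A null vector cannot be normalised; boundedness shows that its image is null
      as well.\<close>
    case True
    obtain B where "fnorm (rep x f) \<le> B * fnorm f" using rep_bounded by blast
    then show ?thesis using True by simp
  next
    case False
    then have "fnorm f > 0" using fnorm_nonneg[of f] by linarith
    then have "fnorm (rep x f) / fnorm f \<le> cut_seminorm {\<lambda>f. f} x"
      by (intro cut_seminorm_greatest[OF C]) (auto simp: cut_bound_def divide_le_eq)
    then show ?thesis using \<open>fnorm f > 0\<close> by (simp add: divide_le_eq)
  qed
  also have "\<dots> \<le> toeplitz_seminorm \<alpha> L x * fnorm f"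
    by (intro mult_right_mono toeplitz_seminorm_upper toeplitz_cstar_seminorm_cut_seminorm C) simp
  finally show ?thesis .
qed

end


section \<open>Compact operators on the module\<close>

context exel_system
begin

abbreviation (input) "pM \<equiv> module_seminorm L"

section \<open>M_L as the completion of level one\<close>

lemma finner_single: "finner (Poly_Mapping.single n x) (Poly_Mapping.single n y) = (L ^^ n) (star x * y)"
  by (subst finner_superset[of "{n}"]) auto

text \<open>Identifies the pre-Hilbert module behind M_L with level one of the Fock module, so that
  Cauchy-Schwarz and the bounds for both actions are inherited.\<close>

lemma module_seminorm_eq: "pM x = fnorm (Poly_Mapping.single 1 x)"
  by (simp add: module_seminorm_def fnorm_def finner_single[of 1, simplified])

sublocale pM: seminorm pM
proof
  fix x y
  show "pM (x + y) \<le> pM x + pM y" by (simp add: module_seminorm_eq single_add fnorm_triangle)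
  show "pM (- x) = pM x" by (simp add: module_seminorm_eq single_uminus fnorm_minus)
  show "pM 0 = 0" by (simp add: module_seminorm_eq)
qed

lemma L_cauchy_schwarz: "norm (L (star x * y)) \<le> pM x * pM y"
  using cauchy_schwarz[of "Poly_Mapping.single 1 x" "Poly_Mapping.single 1 y"]
  by (simp add: module_seminorm_eq finner_single[of 1, simplified])

lemma pM_mult: "pM (a * x) \<le> norm a * pM x"
proof -
  have "left_mult a (Poly_Mapping.single 1 x) = Poly_Mapping.single 1 (a * x)"
    by (intro poly_mapping_eqI) (simp add: lookup_single when_def)
  then show ?thesis
    using fnorm_left_mult[of a "Poly_Mapping.single 1 x"] by (simp add: module_seminorm_eq)
qed

lemma pM_mult_alpha: "pM (x * \<alpha> a) \<le> norm a * pM x"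
proof -
  have "right_mult a (Poly_Mapping.single 1 x) = Poly_Mapping.single 1 (x * \<alpha> a)"
    by (intro poly_mapping_eqI) (auto simp: lookup_single when_def)
  then show ?thesis
    using fnorm_right_mult[of a "Poly_Mapping.single 1 x"] by (simp add: module_seminorm_eq)
qed

lemma L_form_diff: "L (star x * y) - L (star u * v) = L (star (x - u) * y) + L (star u * (y - v))"
  by (simp add: star_diff left_diff_distrib right_diff_distrib L_diff)

lemma L_form_convergent:
  assumes X: "pcauchy pM X" and Y: "pcauchy pM Y"
  obtains v where "(\<lambda>n. L (star (X n) * Y n)) \<longlonglongrightarrow> v"
proof -
  have "Cauchy (\<lambda>n. L (star (X n) * Y n))"
  proof (rule CauchyI)
    fix e :: real assume "e > 0"
    obtain B where B: "B > 0" "\<And>n. pM (X n) \<le> B" using pM.pcauchy_bounded[OF X] by blast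
    obtain C where C: "C > 0" "\<And>n. pM (Y n) \<le> C" using pM.pcauchy_bounded[OF Y] by blast
    define d where "d = e / (B + C)"
    have "d * C + B * d = d * (B + C)" by (simp add: algebra_simps)
    then have d: "d > 0" "d * C + B * d = e" using \<open>e > 0\<close> B C by (simp_all add: d_def)
    obtain M N where MN: "\<And>m n. m \<ge> M \<Longrightarrow> n \<ge> M \<Longrightarrow> pM (X m - X n) < d"
      "\<And>m n. m \<ge> N \<Longrightarrow> n \<ge> N \<Longrightarrow> pM (Y m - Y n) < d"
      using X Y d unfolding pcauchy_def by meson
    have "norm (L (star (X m) * Y m) - L (star (X n) * Y n)) < e"
      if mn: "m \<ge> max M N" "n \<ge> max M N" for m n
    proof -
      have "norm (L (star (X m) * Y m) - L (star (X n) * Y n))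
          \<le> pM (X m - X n) * pM (Y m) + pM (X n) * pM (Y m - Y n)"
        unfolding L_form_diff using L_cauchy_schwarz by (meson add_mono norm_triangle_le)
      also have "\<dots> \<le> pM (X m - X n) * C + B * pM (Y m - Y n)"
        by (intro add_mono mult_left_mono mult_right_mono pM.nonneg B C)
      also have "\<dots> < d * C + B * d"
        using MN(1)[of m n] MN(2)[of m n] mn B C
        by (intro add_strict_mono mult_strict_right_mono mult_strict_left_mono) auto
      finally show ?thesis by (simp add: d)
    qed
    then show "\<exists>M. \<forall>m\<ge>M. \<forall>n\<ge>M. norm (L (star (X m) * Y m) - L (star (X n) * Y n)) < e" by blast
  qed
  then show thesis using that by (auto simp: Cauchy_convergent_iff convergent_def)
qed

text \<open>\<open>mod_inner\<close> is a definite description over all representing sequences, so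
  the limit has to be independent of the representatives.\<close>

lemma L_form_tendsto_cong:
  assumes X: "pcauchy pM X" and Y: "pcauchy pM Y'"
    and XY: "(\<lambda>n. pM (X' n - X n)) \<longlonglongrightarrow> 0" "(\<lambda>n. pM (Y' n - Y n)) \<longlonglongrightarrow> 0"
    and v: "(\<lambda>n. L (star (X n) * Y n)) \<longlonglongrightarrow> v"
  shows "(\<lambda>n. L (star (X' n) * Y' n)) \<longlonglongrightarrow> v"
proof -
  obtain B where B: "B > 0" "\<And>n. pM (X n) \<le> B" using pM.pcauchy_bounded[OF X] by blast
  obtain C where C: "C > 0" "\<And>n. pM (Y' n) \<le> C" using pM.pcauchy_bounded[OF Y] by blast
  have "(\<lambda>n. L (star (X' n) * Y' n) - L (star (X n) * Y n)) \<longlonglongrightarrow> 0"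
  proof (rule Lim_null_comparison)
    show "\<forall>\<^sub>F n in sequentially. norm (L (star (X' n) * Y' n) - L (star (X n) * Y n))
        \<le> pM (X' n - X n) * C + B * pM (Y' n - Y n)"
    proof (intro always_eventually allI)
      fix n
      have "norm (L (star (X' n) * Y' n) - L (star (X n) * Y n))
          \<le> pM (X' n - X n) * pM (Y' n) + pM (X n) * pM (Y' n - Y n)"
        unfolding L_form_diff using L_cauchy_schwarz by (meson add_mono norm_triangle_le)
      also have "\<dots> \<le> pM (X' n - X n) * C + B * pM (Y' n - Y n)"
        by (intro add_mono mult_left_mono mult_right_mono pM.nonneg B C)
      finally show "norm (L (star (X' n) * Y' n) - L (star (X n) * Y n))
          \<le> pM (X' n - X n) * C + B * pM (Y' n - Y n)" .
    qed
    show "(\<lambda>n. pM (X' n - X n) * C + B * pM (Y' n - Y n)) \<longlonglongrightarrow> 0"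
      using tendsto_add[OF tendsto_mult_left_zero[OF XY(1)] tendsto_mult_right_zero[OF XY(2)]] by simp
  qed
  then show ?thesis using tendsto_add[OF _ v] by fastforce
qed

lemma mod_inner_pclass:
  assumes X: "pcauchy pM X" and Y: "pcauchy pM Y"
    and v: "(\<lambda>n. L (star (X n) * Y n)) \<longlonglongrightarrow> v"
  shows "mod_inner L (pclass pM X) (pclass pM Y) = v"
  unfolding mod_inner_def
proof (rule the_equality)
  show "\<forall>X'\<in>pclass pM X. \<forall>Y'\<in>pclass pM Y. (\<lambda>n. L (star (X' n) * Y' n)) \<longlonglongrightarrow> v"
    using L_form_tendsto_cong[OF X _ _ _ v] by (simp add: pM.mem_pclass)
  fix w assume "\<forall>X'\<in>pclass pM X. \<forall>Y'\<in>pclass pM Y. (\<lambda>n. L (star (X' n) * Y' n)) \<longlonglongrightarrow> w"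
  then have "(\<lambda>n. L (star (X n) * Y n)) \<longlonglongrightarrow> w" using X Y by (simp add: pM.mem_pclass pM.zero)
  then show "w = v" using v LIMSEQ_unique by blast
qed

lemma mod_norm_pclass:
  assumes X: "pcauchy pM X"
  shows "(\<lambda>n. pM (X n)) \<longlonglongrightarrow> mod_norm L (pclass pM X)"
proof -
  obtain v where v: "(\<lambda>n. L (star (X n) * X n)) \<longlonglongrightarrow> v" using L_form_convergent[OF X X] .
  show ?thesis
    unfolding mod_norm_def mod_inner_pclass[OF X X v] module_seminorm_def
    by (intro tendsto_intros v)
qed

section \<open>Operators on M_L extended from A\<close>

text \<open>These are the maps on A that extend to M_L. Additivity is phrased with differences
  because the extension rests on a Lipschitz bound.\<close>

definition M_bounded :: "('a \<Rightarrow> 'a) \<Rightarrow> bool" where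
  "M_bounded f \<longleftrightarrow> (\<forall>u v. f (u - v) = f u - f v) \<and> (\<exists>C. \<forall>u. pM (f u) \<le> C * pM u)"

definition M_op :: "('a \<Rightarrow> 'a) \<Rightarrow> 'a hmod \<Rightarrow> 'a hmod" where
  "M_op f = (\<lambda>x\<in>M_L L. cpl_lift pM f x)"

lemma M_bounded_lipschitz: "M_bounded f \<Longrightarrow> \<exists>C. \<forall>u v. pM (f u - f v) \<le> C * pM (u - v)"
  unfolding M_bounded_def by metis

lemma M_bounded_pcauchy: "M_bounded f \<Longrightarrow> pcauchy pM X \<Longrightarrow> pcauchy pM (\<lambda>n. f (X n))"
  using M_bounded_lipschitz[of f] pM.pcauchy_lipschitz[of X f] by blast

lemma M_bounded_uminus: "M_bounded f \<Longrightarrow> M_bounded (\<lambda>x. - f x)"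
  unfolding M_bounded_def by (simp add: pM.minus)

lemma M_bounded_add:
  assumes "M_bounded f" "M_bounded g"
  shows "M_bounded (\<lambda>x. f x + g x)"
proof -
  obtain C D where C: "\<And>u. pM (f u) \<le> C * pM u" and D: "\<And>u. pM (g u) \<le> D * pM u"
    using assms unfolding M_bounded_def by blast
  have "pM (f u + g u) \<le> (C + D) * pM u" for u
    using pM.triangle[of "f u" "g u"] C[of u] D[of u] by (simp add: distrib_right)
  moreover have "f (u - v) + g (u - v) = (f u + g u) - (f v + g v)" for u v
    using assms unfolding M_bounded_def by simp
  ultimately show ?thesis unfolding M_bounded_def by blast
qed

lemma M_LE:
  assumes "x \<in> M_L L"
  obtains X where "pcauchy pM X" "x = pclass pM X"
  using assms unfolding M_L_def by (rule pM.completionE)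

lemma pclass_in_M_L: "pcauchy pM X \<Longrightarrow> pclass pM X \<in> M_L L"
  unfolding M_L_def by (rule pM.pclass_in_completion)

lemma M_op_pclass:
  assumes "M_bounded f" "pcauchy pM X"
  shows "M_op f (pclass pM X) = pclass pM (\<lambda>n. f (X n))"
proof -
  obtain C where "\<And>u v. pM (f u - f v) \<le> C * pM (u - v)" using M_bounded_lipschitz[OF assms(1)] by blast
  then have "cpl_lift pM f (pclass pM X) = pclass pM (\<lambda>n. f (X n))" by (rule pM.cpl_lift_pclass[OF assms(2)])
  then show ?thesis using pclass_in_M_L[OF assms(2)] by (simp add: M_op_def)
qed

lemma M_op_extensional:
  assumes f: "M_bounded f"
  shows "M_op f \<in> M_L L \<rightarrow>\<^sub>E M_L L"
proof (rule PiE_I)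
  fix x assume "x \<in> M_L L"
  then obtain X where X: "pcauchy pM X" "x = pclass pM X" by (rule M_LE)
  show "M_op f x \<in> M_L L"
    unfolding X(2) M_op_pclass[OF f X(1)] by (rule pclass_in_M_L[OF M_bounded_pcauchy[OF f X(1)]])
qed (simp add: M_op_def)

lemma M_op_carrier:
  assumes f: "M_bounded f" and g: "M_bounded g"
    and adj: "\<And>x y. L (star (f x) * y) = L (star x * g y)"
  shows "M_op f \<in> carrier (adjointable_ops L)"
proof -
  have "mod_inner L (M_op f x) y = mod_inner L x (M_op g y)" if "x \<in> M_L L" "y \<in> M_L L" for x y
  proof -
    obtain X where X: "pcauchy pM X" "x = pclass pM X" using \<open>x \<in> M_L L\<close> by (rule M_LE)
    obtain Y where Y: "pcauchy pM Y" "y = pclass pM Y" using \<open>y \<in> M_L L\<close> by (rule M_LE)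
    note fX = M_bounded_pcauchy[OF f X(1)] and gY = M_bounded_pcauchy[OF g Y(1)]
    obtain v where v: "(\<lambda>n. L (star (f (X n)) * Y n)) \<longlonglongrightarrow> v"
      by (rule L_form_convergent[OF fX Y(1)])
    then have v': "(\<lambda>n. L (star (X n) * g (Y n))) \<longlonglongrightarrow> v" unfolding adj .
    show ?thesis
      unfolding X(2) Y(2) M_op_pclass[OF f X(1)] M_op_pclass[OF g Y(1)]
        mod_inner_pclass[OF fX Y(1) v] mod_inner_pclass[OF X(1) gY v'] ..
  qed
  then have "is_adjoint L (M_op f) (M_op g)"
    using M_op_extensional[OF g] unfolding is_adjoint_def by blast
  then show ?thesis using M_op_extensional[OF f] unfolding adjointable_ops_def by auto
qed

lemma M_op_add:
  assumes f: "M_bounded f" and g: "M_bounded g"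
  shows "M_op f \<oplus>\<^bsub>adjointable_ops L\<^esub> M_op g = M_op (\<lambda>x. f x + g x)"
proof -
  have "mod_add L (M_op f x) (M_op g x) = cpl_lift pM (\<lambda>x. f x + g x) x" if x: "x \<in> M_L L" for x
  proof -
    obtain X where X: "pcauchy pM X" "x = pclass pM X" using x by (rule M_LE)
    have "mod_add L (M_op f x) (M_op g x) = pclass pM (\<lambda>n. f (X n) + g (X n))"
      unfolding X(2) M_op_pclass[OF f X(1)] M_op_pclass[OF g X(1)] mod_add_def
      by (rule pM.cpl_add_pclass[OF M_bounded_pcauchy[OF f X(1)] M_bounded_pcauchy[OF g X(1)]])
    also have "\<dots> = M_op (\<lambda>x. f x + g x) x"
      unfolding X(2) by (rule M_op_pclass[OF M_bounded_add[OF f g] X(1), symmetric])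
    finally show ?thesis using x by (simp add: M_op_def)
  qed
  then show ?thesis
    unfolding M_op_def[of "\<lambda>x. f x + g x"] adjointable_ops_def by (auto intro: restrict_ext)
qed

lemma M_op_zero: "M_op (\<lambda>x. 0) = \<zero>\<^bsub>adjointable_ops L\<^esub>"
proof -
  have "cpl_lift pM (\<lambda>x. 0) x = mod_zero L" if "x \<in> M_L L" for x
    using that pM.cpl_lift_pclass[of _ "\<lambda>x. 0" 0]
    by (auto simp: M_L_def mod_zero_def cpl_embed_def pM.zero elim!: pM.completionE)
  then show ?thesis by (auto simp: adjointable_ops_def M_op_def intro: restrict_ext)
qed

text \<open>Subtraction in the operator record goes through a definite description of the additive
  inverse. Uniqueness is checked directly: if T is any inverse of \<open>M_op f\<close>, evaluating
  the sum at a class x determines T x.\<close>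

lemma M_op_a_inv:
  assumes f: "M_bounded f" and g: "M_bounded g"
    and adj: "\<And>x y. L (star (f x) * y) = L (star x * g y)"
  shows "\<ominus>\<^bsub>adjointable_ops L\<^esub> M_op f = M_op (\<lambda>x. - f x)"
proof -
  let ?V = "adjointable_ops L"
  have carr: "M_op (\<lambda>x. - f x) \<in> carrier ?V"
    by (rule M_op_carrier[OF M_bounded_uminus[OF f] M_bounded_uminus[OF g]])
      (simp add: star_minus L_minus adj)
  have f': "M_bounded (\<lambda>x. - f x)" using f by (rule M_bounded_uminus)
  have "(THE T. T \<in> carrier ?V \<and> M_op f \<oplus>\<^bsub>?V\<^esub> T = \<zero>\<^bsub>?V\<^esub> \<and> T \<oplus>\<^bsub>?V\<^esub> M_op f = \<zero>\<^bsub>?V\<^esub>) = M_op (\<lambda>x. - f x)"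
  proof (rule the_equality)
    show "M_op (\<lambda>x. - f x) \<in> carrier ?V \<and> M_op f \<oplus>\<^bsub>?V\<^esub> M_op (\<lambda>x. - f x) = \<zero>\<^bsub>?V\<^esub> \<and>
        M_op (\<lambda>x. - f x) \<oplus>\<^bsub>?V\<^esub> M_op f = \<zero>\<^bsub>?V\<^esub>"
      using carr f f' by (simp add: M_op_add M_op_zero)
    fix T assume T: "T \<in> carrier ?V \<and> M_op f \<oplus>\<^bsub>?V\<^esub> T = \<zero>\<^bsub>?V\<^esub> \<and> T \<oplus>\<^bsub>?V\<^esub> M_op f = \<zero>\<^bsub>?V\<^esub>"
    then have TM: "T \<in> M_L L \<rightarrow>\<^sub>E M_L L" by (simp add: adjointable_ops_def)
    show "T = M_op (\<lambda>x. - f x)"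
    proof (rule PiE_ext[OF TM M_op_extensional[OF f']])
      fix x assume x: "x \<in> M_L L"
      then obtain X where X: "pcauchy pM X" "x = pclass pM X" by (rule M_LE)
      obtain Z where Z: "pcauchy pM Z" "T x = pclass pM Z"
        by (rule M_LE[OF PiE_mem[OF TM x]])
      have "T \<oplus>\<^bsub>?V\<^esub> M_op f = \<zero>\<^bsub>?V\<^esub>" using T by blast
      then have "(T \<oplus>\<^bsub>?V\<^esub> M_op f) x = \<zero>\<^bsub>?V\<^esub> x" by simp
      then have "mod_add L (T x) (M_op f x) = mod_zero L" using x by (simp add: adjointable_ops_def)
      then have "pclass pM (\<lambda>n. Z n + f (X n)) = pclass pM (\<lambda>n. 0)"
        unfolding Z(2) unfolding X(2) M_op_pclass[OF f X(1)] mod_add_def mod_zero_def cpl_embed_def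
        by (simp only: pM.cpl_add_pclass[OF Z(1) M_bounded_pcauchy[OF f X(1)]])
      then have "(\<lambda>n. pM (Z n - - f (X n))) \<longlonglongrightarrow> 0"
        using pM.pclass_eq_iff[OF pM.pcauchy_add[OF Z(1) M_bounded_pcauchy[OF f X(1)]] pM.pcauchy_const]
        by simp
      then show "T x = M_op (\<lambda>x. - f x) x"
        unfolding Z(2) unfolding X(2) M_op_pclass[OF f' X(1)]
        using pM.pclass_eq_iff[OF Z(1) M_bounded_pcauchy[OF f' X(1)]] by blast
    qed
  qed
  then show ?thesis by (simp add: a_inv_def m_inv_def)
qed

lemma nrm_M_op_le:
  assumes f: "M_bounded f" and e: "0 \<le> e" "\<And>u. pM (f u) \<le> e * pM u"
  shows "nrm (adjointable_ops L) (M_op f) \<le> e"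
proof -
  have "mod_norm L (M_op f x) \<le> e" if x: "x \<in> M_L L" "mod_norm L x \<le> 1" for x
  proof -
    obtain X where X: "pcauchy pM X" "x = pclass pM X" using x(1) by (rule M_LE)
    have "(\<lambda>n. pM (f (X n))) \<longlonglongrightarrow> mod_norm L (M_op f x)"
      unfolding X(2) M_op_pclass[OF f X(1)] by (rule mod_norm_pclass[OF M_bounded_pcauchy[OF f X(1)]])
    moreover have "(\<lambda>n. e * pM (X n)) \<longlonglongrightarrow> e * mod_norm L x"
      unfolding X(2) by (intro tendsto_mult tendsto_const mod_norm_pclass[OF X(1)])
    ultimately have "mod_norm L (M_op f x) \<le> e * mod_norm L x" by (rule LIMSEQ_le) (use e in auto)
    also have "\<dots> \<le> e" using x e by (simp add: mult_left_le)
    finally show ?thesis .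
  qed
  \<comment> \<open>The zero vector shows that the supremum defining the operator norm runs over a
    nonempty set.\<close>
  moreover have "mod_zero L \<in> M_L L" "mod_norm L (mod_zero L) \<le> 1"
  proof -
    show "mod_zero L \<in> M_L L" by (simp add: mod_zero_def M_L_def)
    have "(\<lambda>n. pM 0) \<longlonglongrightarrow> mod_norm L (mod_zero L)"
      using mod_norm_pclass[of "\<lambda>n. 0"] by (simp add: mod_zero_def cpl_embed_def)
    then show "mod_norm L (mod_zero L) \<le> 1" by (simp add: pM.zero LIMSEQ_const_iff)
  qed
  ultimately show ?thesis
    unfolding adjointable_ops_def by simp (rule cSup_least, blast, blast)
qed

section \<open>Finite rank operators\<close>

text \<open>A sum of operators Theta read on A: each term is Theta for the classes of b and c^*,
  applied to the class of m.\<close>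

definition finite_rank :: "('a \<times> 'a) list \<Rightarrow> 'a \<Rightarrow> 'a" where
  "finite_rank bs m = (\<Sum>(b, c)\<leftarrow>bs. b * \<alpha> (L (c * m)))"

lemma M_bounded_rank_one: "M_bounded (\<lambda>m. b * \<alpha> (L (c * m)))"
  unfolding M_bounded_def
proof (intro conjI allI)
  fix u v
  have "\<alpha> (x - y) = \<alpha> x - \<alpha> y" for x y
    using alpha_add[of "x - y" y] by (simp add: eq_diff_eq)
  then show "b * \<alpha> (L (c * (u - v))) = b * \<alpha> (L (c * u)) - b * \<alpha> (L (c * v))"
    by (simp add: right_diff_distrib L_diff)
  have "pM (b * \<alpha> (L (c * u))) \<le> (pM (star c) * pM b) * pM u" for u
  proof -
    have "pM (b * \<alpha> (L (c * u))) \<le> norm (L (c * u)) * pM b" by (rule pM_mult_alpha)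
    also have "\<dots> \<le> (pM (star c) * pM u) * pM b"
      using L_cauchy_schwarz[of "star c" u] by (intro mult_right_mono pM.nonneg) (simp add: star_star)
    finally show ?thesis by (simp add: ac_simps)
  qed
  then show "\<exists>C. \<forall>u. pM (b * \<alpha> (L (c * u))) \<le> C * pM u" by blast
qed

lemma M_bounded_finite_rank: "M_bounded (finite_rank bs)"
proof (induction bs)
  case Nil
  show ?case by (auto simp: M_bounded_def finite_rank_def pM.zero intro: exI[of _ 0])
next
  case (Cons p bs)
  obtain b c where "p = (b, c)" by (cases p)
  then show ?case
    using M_bounded_add[OF M_bounded_rank_one Cons, of b c] by (simp add: finite_rank_def[abs_def])
qed

lemma rank_one_adjoint: "L (star (b * \<alpha> (L (c * x))) * y) = L (star x * (star c * \<alpha> (L (star b * y))))"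
proof -
  have "L (star (b * \<alpha> (L (c * x))) * y) = L (\<alpha> (star (L (c * x))) * (star b * y))"
    by (simp add: star_mult alpha_star ac_simps)
  also have "\<dots> = L (star (c * x)) * L (star b * y)" by (simp add: L_alpha L_star)
  also have "\<dots> = L (\<alpha> (L (star b * y)) * star (c * x))"
    unfolding L_alpha by (rule mult.commute)
  finally show ?thesis by (simp add: star_mult ac_simps)
qed

lemma finite_rank_adjoint:
  "L (star (finite_rank bs x) * y) = L (star x * finite_rank (map (\<lambda>(b, c). (star c, star b)) bs) y)"
proof (induction bs)
  case (Cons p bs)
  obtain b c where "p = (b, c)" by (cases p)
  then show ?case
    using Cons rank_one_adjoint[of b c x y]
    by (simp add: finite_rank_def star_add distrib_left distrib_right L_add)
qed (simp add: finite_rank_def)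

lemma Theta_embed:
  "Theta \<alpha> L (cpl_embed pM b) (cpl_embed pM c) = M_op (\<lambda>m. b * \<alpha> (L (star c * m)))"
proof -
  have "mod_act \<alpha> L (cpl_embed pM b) (mod_inner L (cpl_embed pM c) z)
      = cpl_lift pM (\<lambda>m. b * \<alpha> (L (star c * m))) z" if z: "z \<in> M_L L" for z
  proof -
    obtain Z where Z: "pcauchy pM Z" "z = pclass pM Z" using z by (rule M_LE)
    obtain v where v: "(\<lambda>n. L (star c * Z n)) \<longlonglongrightarrow> v"
      using L_form_convergent[OF pM.pcauchy_const[of c] Z(1)] .
    have inner: "mod_inner L (cpl_embed pM c) z = v"
      using mod_inner_pclass[OF pM.pcauchy_const[of c] Z(1) v] by (simp add: cpl_embed_def Z)
    have lip: "pM (u * \<alpha> v - w * \<alpha> v) \<le> norm v * pM (u - w)" for u w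
      using pM_mult_alpha[of "u - w" v] by (simp add: left_diff_distrib)
    have act: "mod_act \<alpha> L (cpl_embed pM b) v = pclass pM (\<lambda>n. b * \<alpha> v)"
      unfolding mod_act_def cpl_embed_def by (rule pM.cpl_lift_pclass[OF pM.pcauchy_const lip])
    have lift: "cpl_lift pM (\<lambda>m. b * \<alpha> (L (star c * m))) z = pclass pM (\<lambda>n. b * \<alpha> (L (star c * Z n)))"
      using M_op_pclass[OF M_bounded_rank_one Z(1), of b "star c"] z Z(2) by (simp add: M_op_def)
    \<comment> \<open>The inner product v is only the limit of L(c^* Z_n); boundedness of the right
      action in the algebra element shows that both sequences represent the same class.\<close>
    have "(\<lambda>n. pM (b * \<alpha> v - b * \<alpha> (L (star c * Z n)))) \<longlonglongrightarrow> 0"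
    proof (rule tendsto_sandwich[OF _ _ tendsto_const])
      have "(\<lambda>n. norm (v - L (star c * Z n)) * pM b) \<longlonglongrightarrow> norm (v - v) * pM b"
        by (intro tendsto_intros v)
      then show "(\<lambda>n. norm (v - L (star c * Z n)) * pM b) \<longlonglongrightarrow> 0" by simp
      have "\<alpha> (x - y) = \<alpha> x - \<alpha> y" for x y
        using alpha_add[of "x - y" y] by (simp add: eq_diff_eq)
      then show "\<forall>\<^sub>F n in sequentially. pM (b * \<alpha> v - b * \<alpha> (L (star c * Z n)))
          \<le> norm (v - L (star c * Z n)) * pM b"
        using pM_mult_alpha[of b "v - L (star c * Z _)"] by (simp add: right_diff_distrib)
    qed (simp add: pM.nonneg)
    then show ?thesis
      unfolding inner act lift
      by (subst pM.pclass_eq_iff) (auto intro: M_bounded_pcauchy[OF M_bounded_rank_one Z(1)])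
  qed
  then show ?thesis by (auto simp: Theta_def M_op_def intro: restrict_ext)
qed

lemma M_op_finite_rank_cspan:
  "M_op (finite_rank bs)
    \<in> cspan (adjointable_ops L) {Theta \<alpha> L x y |x y. x \<in> M_L L \<and> y \<in> M_L L}" (is "_ \<in> cspan ?V ?B")
proof (induction bs)
  case Nil
  show ?case using cspan.zero[of ?V ?B] by (simp add: finite_rank_def[abs_def] M_op_zero)
next
  case (Cons p bs)
  obtain b c where p: "p = (b, c)" by (cases p)
  let ?f = "\<lambda>m. b * \<alpha> (L (c * m))"
  have Theta: "M_op ?f = Theta \<alpha> L (cpl_embed pM b) (cpl_embed pM (star c))"
    by (simp add: Theta_embed star_star)
  have "M_op ?f \<in> ?B"
    unfolding Theta by (auto simp: M_L_def)
  then have "scal ?V 1 (M_op ?f) \<oplus>\<^bsub>?V\<^esub> M_op (finite_rank bs) \<in> cspan ?V ?B"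
    using Cons by (rule cspan.add)
  \<comment> \<open>Generators enter the span with a complex coefficient, so multiplication by 1 on
    the completion has to be recognised as the identity.\<close>
  moreover have "scal ?V 1 (M_op ?f) = M_op ?f"
  proof -
    have scaleC_id: "(*\<^sub>C) 1 = (\<lambda>x::'a. x)" by auto
    have "cpl_lift pM (\<lambda>x. x) y = y" if y: "y \<in> M_L L" for y
    proof -
      obtain Y where "pcauchy pM Y" "y = pclass pM Y" using y by (rule M_LE)
      then show ?thesis using pM.cpl_lift_pclass[of Y "\<lambda>x. x" 1] by simp
    qed
    moreover have "M_op ?f x \<in> M_L L" if "x \<in> M_L L" for x
      using that M_op_extensional[OF M_bounded_rank_one] by blast
    ultimately have "mod_scale L 1 (M_op ?f x) = M_op ?f x" if "x \<in> M_L L" for x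
      using that by (simp add: mod_scale_def scaleC_id)
    then show ?thesis by (auto simp: adjointable_ops_def M_op_def fun_eq_iff)
  qed
  ultimately show ?case
    using M_op_add[OF M_bounded_rank_one M_bounded_finite_rank, of b c bs]
    by (simp add: p finite_rank_def[abs_def])
qed

text \<open>Membership in \<open>J(M_L)\<close> expressed on \<open>A\<close> itself, without the completion.\<close>

lemma J_M_I:
  assumes "\<And>e. e > 0 \<Longrightarrow> \<exists>bs. \<forall>m. pM (a * m - finite_rank bs m) \<le> e * pM m"
  shows "a \<in> J_M \<alpha> L"
proof -
  let ?V = "adjointable_ops L" and ?B = "{Theta \<alpha> L x y |x y. x \<in> M_L L \<and> y \<in> M_L L}"
  have bd: "M_bounded (\<lambda>m. a * m)" for a
    unfolding M_bounded_def using pM_mult[of a] by (auto simp: right_diff_distrib)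
  have op: "left_act L a = M_op (\<lambda>m. a * m)" by (simp add: left_act_def M_op_def)
  have adj: "L (star (a * x) * y) = L (star x * (star a * y))" for x y
    by (simp add: star_mult ac_simps)
  have "M_op (\<lambda>m. a * m) \<in> closed_cspan ?V ?B"
    unfolding norm_closure_def
  proof (intro CollectI conjI allI impI)
    show "M_op (\<lambda>m. a * m) \<in> carrier ?V" by (rule M_op_carrier[OF bd bd adj])
    fix e :: real assume "e > 0"
    \<comment> \<open>Half of e, because the norm estimate is not strict while the closure asks for
      a strict one.\<close>
    then obtain bs where bs: "\<And>m. pM (a * m - finite_rank bs m) \<le> e / 2 * pM m"
      using assms[of "e / 2"] by auto
    have "M_op (\<lambda>m. a * m) \<ominus>\<^bsub>?V\<^esub> M_op (finite_rank bs)
        = M_op (\<lambda>m. a * m) \<oplus>\<^bsub>?V\<^esub> M_op (\<lambda>m. - finite_rank bs m)"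
      unfolding a_minus_def
      by (subst M_op_a_inv[OF M_bounded_finite_rank M_bounded_finite_rank finite_rank_adjoint]) simp
    also have "\<dots> = M_op (\<lambda>m. a * m - finite_rank bs m)"
      by (simp add: M_op_add bd M_bounded_uminus M_bounded_finite_rank)
    finally have "nrm ?V (M_op (\<lambda>m. a * m) \<ominus>\<^bsub>?V\<^esub> M_op (finite_rank bs)) \<le> e / 2"
      using nrm_M_op_le[of "\<lambda>m. a * m - finite_rank bs m" "e / 2"] bs \<open>e > 0\<close>
        M_bounded_add[OF bd M_bounded_uminus[OF M_bounded_finite_rank], of a bs] by simp
    then show "\<exists>y\<in>cspan ?V ?B. nrm ?V (M_op (\<lambda>m. a * m) \<ominus>\<^bsub>?V\<^esub> y) < e"
      using M_op_finite_rank_cspan \<open>e > 0\<close> by (intro bexI[of _ "M_op (finite_rank bs)"]) auto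
  qed
  then show ?thesis by (simp add: J_M_def compact_ops_def op)
qed

end


section \<open>The redundancy ideal\<close>

text \<open>The element 1 - e plays the part of an approximate unit of the ideal K: it nearly fixes
  a. The choice is e = (1 - y)^N with y the normalised a^* a; then 1 - e is a multiple of y, and the
  norm of a e decays like N^(-1/2).\<close>

lemma approximate_unit:
  fixes a :: "'a::comm_unital_cstar_algebra"
  assumes K_mult: "\<And>x b. x \<in> K \<Longrightarrow> b * x \<in> K" and K_add: "\<And>x y. x \<in> K \<Longrightarrow> y \<in> K \<Longrightarrow> x + y \<in> K"
    and a: "a \<in> K" and d: "d > 0"
  obtains e where "norm e \<le> 1" "1 - e \<in> K" "norm (a * e) \<le> d"
proof (cases "a = 0")
  case True
  have "1 - (1::'a) \<in> K" using K_mult[OF a, of 0] by simp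
  then show thesis using that[of 1] True d norm_one_le by simp
next
  case False
  define y where "y = (1 / (norm a)\<^sup>2) *\<^sub>R (star a * a)"
  have y: "cpositive y" unfolding y_def by (intro cpositive_scaleR) auto
  have ny: "norm y \<le> 1" using False by (simp add: y_def cstar_identity)
  have yK: "y \<in> K"
    using K_mult[OF a, of "(1 / (norm a)\<^sup>2) *\<^sub>R star a"] by (simp add: y_def)
  define z where "z = 1 - y"
  have z: "cpositive z"
    using cpositive_norm_minus[OF cpositive_selfadjoint[OF y] ny] by (simp add: z_def)
  have nz: "norm z \<le> 1"
    using cpositive_norm_mono[of z 1] z y norm_one_le[where 'a='a] by (simp add: z_def)
  have zp: "cpositive (z ^ n)" for n
    by (induction n) (use z cpositive_star_mult[of "1::'a"] in \<open>auto intro: cpositive_mult\<close>)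
  have nzp: "norm (z ^ n) \<le> 1" for n
  proof (induction n)
    case (Suc n)
    then show ?case using nz norm_mult_ineq[of z "z ^ n"] mult_le_one[of "norm z" "norm (z ^ n)"] by simp
  qed (simp add: norm_one_le)
  have zK: "1 - z ^ n \<in> K" for n
  proof (induction n)
    case 0
    then show ?case using K_mult[OF a, of 0] by simp
  next
    case (Suc n)
    have eq: "1 - z ^ Suc n = (1 - z ^ n) + z ^ n * y" by (simp add: z_def algebra_simps)
    show ?case unfolding eq by (rule K_add[OF Suc K_mult[OF yK]])
  qed
  \<comment> \<open>As the powers of z decrease, n y z^n is at most y (1 + z + ... + z^(n-1)) = 1 -
    z^n. The induction exhibits the difference as a sum of positive terms.\<close>
  have bern: "cpositive (1 - z ^ n - real n *\<^sub>R (y * z ^ n))" for n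
  proof (induction n)
    case (Suc n)
    have eq: "1 - z ^ Suc n - real (Suc n) *\<^sub>R (y * z ^ Suc n)
        = (1 - z ^ n - real n *\<^sub>R (y * z ^ n)) + real (Suc n) *\<^sub>R (y * y * z ^ n)"
      by (simp add: z_def algebra_simps)
    show ?case
      unfolding eq
      by (intro cpositive_add[OF Suc] cpositive_scaleR cpositive_mult y zp of_nat_0_le_iff)
  qed simp
  have small: "real n * norm (y * z ^ n) \<le> 1" for n
  proof -
    have "cpositive (1 - real n *\<^sub>R (y * z ^ n))"
      using cpositive_add[OF bern[of n] zp[of n]] by (simp add: algebra_simps)
    then have "norm (real n *\<^sub>R (y * z ^ n)) \<le> norm (1::'a)"
      using y zp by (intro cpositive_norm_mono cpositive_scaleR cpositive_mult) auto
    then show ?thesis using norm_one_le[where 'a='a] by simp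
  qed
  obtain N :: nat where N: "real N > (norm a)\<^sup>2 / d\<^sup>2" using reals_Archimedean2 by blast
  have "N > 0" using N d by (metis gr0I of_nat_0 divide_nonneg_nonneg not_less zero_le_power2)
  have "norm (a * z ^ N) ^ 2 = norm (star (a * z ^ N) * (a * z ^ N))" by (simp add: cstar_identity)
  also have "star (a * z ^ N) * (a * z ^ N) = ((norm a)\<^sup>2 *\<^sub>R (y * z ^ N)) * z ^ N"
    using False by (simp add: star_mult cpositive_selfadjoint zp y_def ac_simps)
  also have "norm \<dots> \<le> (norm a)\<^sup>2 * norm (y * z ^ N) * 1"
    using nzp[of N] norm_mult_ineq[of "(norm a)\<^sup>2 *\<^sub>R (y * z ^ N)" "z ^ N"]
      mult_left_mono[OF nzp[of N], of "(norm a)\<^sup>2 * norm (y * z ^ N)"] by simp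
  also have "norm (y * z ^ N) \<le> 1 / real N"
    using small[of N] \<open>N > 0\<close> by (simp add: pos_le_divide_eq mult.commute)
  then have "(norm a)\<^sup>2 * norm (y * z ^ N) * 1 \<le> (norm a)\<^sup>2 * (1 / real N)"
    by (simp only: mult_1_right) (rule mult_left_mono, simp_all)
  also have "\<dots> \<le> d\<^sup>2"
    using N d \<open>N > 0\<close> by (simp add: divide_less_eq divide_le_eq mult.commute less_imp_le)
  finally have "norm (a * z ^ N) \<le> d" by (rule power2_le_imp_le) (use d in simp)
  then show thesis using that[of "z ^ N"] nzp zK by blast
qed

context exel_system
begin

section \<open>The ideal K_\<alpha> seen from A\<close>

text \<open>Compactness of the left action is expressed on A by uniform approximation in the
  seminorm. The set lies in \<open>K_ideal\<close>, so faithfulness there applies to its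
  elements.\<close>

definition compact_ideal :: "'a set" where
  "compact_ideal = {a \<in> range_ideal \<alpha>. \<forall>e>0. \<exists>bs. \<forall>m. pM (a * m - finite_rank bs m) \<le> e * pM m}"

lemma compact_idealD:
  "a \<in> compact_ideal \<Longrightarrow> e > 0 \<Longrightarrow> \<exists>bs. \<forall>m. pM (a * m - finite_rank bs m) \<le> e * pM m"
  by (simp add: compact_ideal_def)

lemma compact_ideal_subset: "compact_ideal \<subseteq> K_ideal \<alpha> L"
  by (auto simp: compact_ideal_def K_ideal_def intro!: J_M_I)

lemma range_ideal_mult: "a \<in> range_ideal \<alpha> \<Longrightarrow> b * a \<in> range_ideal \<alpha>"
proof -
  assume a: "a \<in> range_ideal \<alpha>"
  let ?G = "{a * \<alpha> b * c |a b c. True}"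
  have "b * x \<in> span ?G" if "x \<in> span ?G" for x
    using that
  proof (induction rule: span_induct_alt)
    case base
    then show ?case by (simp add: span_zero)
  next
    case (step c x y)
    then obtain u v w where "x = u * \<alpha> v * w" by blast
    then have "b * x = (b * u) * \<alpha> v * w" by (simp add: mult.assoc)
    then have "b * x \<in> ?G" by blast
    then have "c *\<^sub>R (b * x) + b * y \<in> span ?G"
      using step by (intro span_add[OF span_scale[OF span_base]])
    then show ?case by (simp add: distrib_left)
  qed
  then have "(*) b ` span ?G \<subseteq> span ?G" by blast
  then have "(*) b ` closure (span ?G) \<subseteq> closure (span ?G)"
    by (intro image_closure_subset continuous_intros) (auto intro: closure_subset[THEN subsetD])
  then show ?thesis using a by (auto simp: range_ideal_def)
qed

lemma compact_ideal_mult: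
  assumes a: "a \<in> compact_ideal"
  shows "b * a \<in> compact_ideal"
proof -
  have "\<exists>bs. \<forall>m. pM (b * a * m - finite_rank bs m) \<le> e * pM m" if e: "e > 0" for e
  proof -
    define d where "d = e / (norm b + 1)"
    have d: "d > 0" "norm b * d \<le> e"
      using e by (simp_all add: d_def add_nonneg_pos divide_le_eq mult.commute mult_left_mono)
    obtain bs where bs: "\<And>m. pM (a * m - finite_rank bs m) \<le> d * pM m"
      using compact_idealD[OF a d(1)] by blast
    have fr: "finite_rank (map (\<lambda>(x, y). (b * x, y)) bs) m = b * finite_rank bs m" for m
      by (induction bs) (auto simp: finite_rank_def distrib_left mult.assoc)
    have "pM (b * a * m - finite_rank (map (\<lambda>(x, y). (b * x, y)) bs) m) \<le> e * pM m" for m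
    proof -
      have "pM (b * (a * m - finite_rank bs m)) \<le> norm b * (d * pM m)"
        using pM_mult bs by (meson mult_left_mono norm_ge_zero order_trans)
      also have "\<dots> \<le> e * pM m"
        using mult_right_mono[OF d(2) pM.nonneg[of m]] by (simp add: mult.assoc)
      finally show ?thesis by (simp add: fr right_diff_distrib mult.assoc)
    qed
    then show ?thesis by blast
  qed
  then show ?thesis using a by (simp add: compact_ideal_def range_ideal_mult)
qed

lemma compact_ideal_add:
  assumes a: "a \<in> compact_ideal" and b: "b \<in> compact_ideal"
  shows "a + b \<in> compact_ideal"
proof -
  have "\<exists>bs. \<forall>m. pM ((a + b) * m - finite_rank bs m) \<le> e * pM m" if e: "e > 0" for e
  proof -
    obtain bs where bs: "\<And>m. pM (a * m - finite_rank bs m) \<le> e / 2 * pM m"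
      using compact_idealD[OF a half_gt_zero[OF e]] by blast
    obtain cs where cs: "\<And>m. pM (b * m - finite_rank cs m) \<le> e / 2 * pM m"
      using compact_idealD[OF b half_gt_zero[OF e]] by blast
    have "pM ((a + b) * m - finite_rank (bs @ cs) m) \<le> e * pM m" for m
    proof -
      have "(a + b) * m - finite_rank (bs @ cs) m
          = (a * m - finite_rank bs m) + (b * m - finite_rank cs m)"
        by (simp add: finite_rank_def distrib_right)
      then show ?thesis
        using pM.triangle[of "a * m - finite_rank bs m" "b * m - finite_rank cs m"] bs[of m] cs[of m]
        by simp
    qed
    then show ?thesis by blast
  qed
  moreover have "a + b \<in> range_ideal \<alpha>"
  proof -
    obtain X Y where "\<And>n. X n \<in> span {a * \<alpha> b * c |a b c. True}" "X \<longlonglongrightarrow> a"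
      "\<And>n. Y n \<in> span {a * \<alpha> b * c |a b c. True}" "Y \<longlonglongrightarrow> b"
      using a b unfolding compact_ideal_def range_ideal_def closure_sequential by auto
    then show ?thesis
      unfolding range_ideal_def closure_sequential
      by (intro exI[of _ "\<lambda>n. X n + Y n"]) (auto intro: span_add tendsto_add)
  qed
  ultimately show ?thesis by (simp add: compact_ideal_def)
qed

lemma zero_compact_ideal: "0 \<in> compact_ideal"
proof -
  have "pM (0 * m - finite_rank [] m) \<le> e * pM m" if "e > 0" for e m
    using that by (simp add: finite_rank_def pM.zero pM.nonneg)
  moreover have "0 \<in> range_ideal \<alpha>"
    unfolding range_ideal_def by (rule closure_subset[THEN subsetD]) (rule span_zero)
  ultimately show ?thesis unfolding compact_ideal_def by blast
qed

lemma compact_ideal_closed: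
  assumes "\<And>e. e > 0 \<Longrightarrow> \<exists>b\<in>compact_ideal. norm (a - b) \<le> e"
  shows "a \<in> compact_ideal"
proof -
  have "\<exists>bs. \<forall>m. pM (a * m - finite_rank bs m) \<le> e * pM m" if e: "e > 0" for e
  proof -
    obtain b where b: "b \<in> compact_ideal" "norm (a - b) \<le> e / 2" using assms[of "e / 2"] e by auto
    obtain bs where bs: "\<And>m. pM (b * m - finite_rank bs m) \<le> e / 2 * pM m"
      using compact_idealD[OF b(1) half_gt_zero[OF e]] by blast
    have "pM (a * m - finite_rank bs m) \<le> e * pM m" for m
    proof -
      have eq: "a * m - finite_rank bs m = (a - b) * m + (b * m - finite_rank bs m)"
        by (simp add: left_diff_distrib)
      have "pM ((a - b) * m) \<le> e / 2 * pM m"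
        using pM_mult b(2) by (meson mult_right_mono order_trans pM.nonneg)
      then show ?thesis
        unfolding eq using pM.triangle[of "(a - b) * m" "b * m - finite_rank bs m"] bs[of m]
        by linarith
    qed
    then show ?thesis by blast
  qed
  moreover have "a \<in> range_ideal \<alpha>"
  proof -
    have "\<exists>b\<in>range_ideal \<alpha>. dist b a < e" if "e > 0" for e
      using assms[of "e / 2"] that unfolding compact_ideal_def
      by (force simp: dist_norm norm_minus_commute)
    then have "a \<in> closure (range_ideal \<alpha>)" by (simp add: closure_approachable)
    then show ?thesis by (simp add: range_ideal_def)
  qed
  ultimately show ?thesis by (simp add: compact_ideal_def)
qed

section \<open>The two cutoff families\<close>

text \<open>For a closed ideal with an approximate unit, the norm of x modulo the ideal is the
  infimum of the norms of x e over contractions e with 1 - e in the ideal. Here e acts on the Fock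
  module from the right.\<close>

definition unit_cutoffs :: "((nat \<Rightarrow>\<^sub>0 'a) \<Rightarrow> (nat \<Rightarrow>\<^sub>0 'a)) set" where
  "unit_cutoffs = {right_mult e |e. norm e \<le> 1 \<and> 1 - e \<in> compact_ideal}"

lemma cutoff_family_unit: "cutoff_family unit_cutoffs"
proof -
  have contr: "fnorm (right_mult e f) \<le> fnorm f" if "norm e \<le> 1" for e f
    using fnorm_right_mult[of e f] mult_right_mono[OF that fnorm_nonneg[of f]] by simp
  have comp: "right_mult (e * e') f = right_mult e (right_mult e' f)" for e e' f
    by (intro poly_mapping_eqI) (simp add: alpha_pow_mult ac_simps)
  have prod: "norm (e * e') \<le> 1 \<and> 1 - e * e' \<in> compact_ideal"
    if "norm e \<le> 1" "1 - e \<in> compact_ideal" "norm e' \<le> 1" "1 - e' \<in> compact_ideal" for e e'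
  proof
    show "norm (e * e') \<le> 1"
      using that norm_mult_ineq[of e e'] mult_le_one[of "norm e" "norm e'"] by simp
    have eq: "1 - e * e' = (1 - e) + e * (1 - e')" by (simp add: algebra_simps)
    show "1 - e * e' \<in> compact_ideal"
      unfolding eq using that by (simp add: compact_ideal_add compact_ideal_mult)
  qed
  show ?thesis
    unfolding cutoff_family_def
  proof (intro conjI ballI allI)
    have "1 - (1::'a) \<in> compact_ideal" by (simp add: zero_compact_ideal)
    then show "unit_cutoffs \<noteq> {}" using norm_one_le unfolding unit_cutoffs_def by blast
    show "fnorm (c f) \<le> fnorm f" if "c \<in> unit_cutoffs" for c f
      using that contr by (auto simp: unit_cutoffs_def)
    fix c d assume "c \<in> unit_cutoffs" "d \<in> unit_cutoffs"
    then obtain e e' where e: "c = right_mult e" "norm e \<le> 1" "1 - e \<in> compact_ideal"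
      and e': "d = right_mult e'" "norm e' \<le> 1" "1 - e' \<in> compact_ideal"
      unfolding unit_cutoffs_def by blast
    have mem: "right_mult (e * e') \<in> unit_cutoffs"
      using prod[OF e(2,3) e'(2,3)] unfolding unit_cutoffs_def by blast
    show "\<exists>k\<in>unit_cutoffs. \<forall>f. \<exists>g h. k f = c g \<and> k f = d h \<and> fnorm g \<le> fnorm f \<and> fnorm h \<le> fnorm f"
    proof (intro bexI[OF _ mem] allI exI conjI)
      fix f
      show "right_mult (e * e') f = c (right_mult e' f)" by (simp add: e comp)
      show "right_mult (e * e') f = d (right_mult e f)" by (simp add: e' flip: comp) (simp add: mult.commute)
    qed (use contr e e' in auto)
    fix y
    show "\<exists>k\<in>unit_cutoffs. \<forall>f. \<exists>g h. rep y (k f) = c g \<and> fnorm g \<le> fnorm (rep y (d h)) \<and> fnorm h \<le> fnorm f"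
    proof (intro bexI[OF _ mem] allI exI conjI)
      fix f
      \<comment> \<open>Right linearity of the representation lets the cutoff c pass in front of y
        unchanged.\<close>
      show "rep y (right_mult (e * e') f) = c (rep y (d f))" by (simp add: e e' comp rep_right_mult)
    qed auto
  qed
qed

lemma tail_tail: "tail M (tail N f) = tail (max M N) f"
  by (intro poly_mapping_eqI) simp

text \<open>Only S^* lowers the level, and by one at a time, so any bound on the lengths of the
  words in y serves as k.\<close>

lemma rep_tail: "\<exists>k. \<forall>n f. tail n (rep y (tail (n + k) f)) = rep y (tail (n + k) f)"
proof -
  define low where "low n f \<longleftrightarrow> (\<forall>i<n. entry f i = 0)" for n and f :: "nat \<Rightarrow>\<^sub>0 'a"
  have act: "low n (act l f)" if "low (Suc n) f" for n l f
    using that by (cases l) (auto simp: low_def split: nat.splits)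
  have word: "low n (act_word w f)" if "low (n + length w) f" for n w f
    using that by (induction w arbitrary: n) (auto simp: act)
  have mono: "low n f" if "low m f" "n \<le> m" for n m f using that by (auto simp: low_def)
  have "\<exists>k. \<forall>n f. low (n + k) f \<longrightarrow> low n (rep y f)"
  proof (induction y rule: poly_mapping_single_induct)
    case zero
    then show ?case by (simp add: low_def)
  next
    case (single_add w c y)
    then obtain k where k: "\<And>n f. low (n + k) f \<Longrightarrow> low n (rep y f)" by blast
    have "low n (rep (Poly_Mapping.single w c + y) f)" if f: "low (n + (k + length w)) f" for n f
    proof -
      have "low n (act_word w f)" "low n (rep y f)"
        using word[OF mono[OF f]] k[OF mono[OF f]] by simp_all
      then show ?thesis by (simp add: low_def rep_add lookup_add)
    qed
    then show ?case by blast
  qed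
  then obtain k where k: "\<And>n f. low (n + k) f \<Longrightarrow> low n (rep y f)" by blast
  have "tail n g = g" if "low n g" for n g
    by (intro poly_mapping_eqI) (use that in \<open>simp add: low_def\<close>)
  moreover have "low (n + k) (tail (n + k) f)" for n f by (simp add: low_def)
  ultimately show ?thesis using k by blast
qed

lemma cutoff_family_tail: "cutoff_family (range tail)"
  unfolding cutoff_family_def
proof (intro conjI ballI allI)
  show "fnorm (c f) \<le> fnorm f" if "c \<in> range tail" for c f using that fnorm_tail by auto
  fix c d assume "c \<in> range tail" "d \<in> range tail"
  then obtain N M where c: "c = tail N" "d = tail M" by blast
  show "\<exists>e\<in>range tail. \<forall>f. \<exists>g h. e f = c g \<and> e f = d h \<and> fnorm g \<le> fnorm f \<and> fnorm h \<le> fnorm f"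
  proof (intro bexI[of _ "tail (max N M)"] allI exI conjI)
    fix f
    show "tail (max N M) f = c (tail M f)" "tail (max N M) f = d (tail N f)"
      by (simp_all add: c tail_tail max.commute)
  qed (auto simp: fnorm_tail)
  fix y
  obtain k where k: "\<And>n f. tail n (rep y (tail (n + k) f)) = rep y (tail (n + k) f)"
    using rep_tail by blast
  show "\<exists>e\<in>range tail. \<forall>f. \<exists>g h. rep y (e f) = c g \<and> fnorm g \<le> fnorm (rep y (d h)) \<and> fnorm h \<le> fnorm f"
  \<comment> \<open>Starting at level N + k keeps the image under y at levels \<ge> N, where c acts
    trivially; starting at level M makes d act trivially on f.\<close>
  proof (intro bexI[of _ "tail (max (N + k) M)"] allI exI conjI)
    fix f
    let ?f = "tail (max (N + k) M) f"
    show "rep y ?f = c (rep y ?f)"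
      using k[of N ?f] by (simp add: c tail_tail)
    show "fnorm (rep y ?f) \<le> fnorm (rep y (d ?f))" by (simp add: c tail_tail max.left_commute)
    show "fnorm ?f \<le> fnorm f" by (rule fnorm_tail)
  qed auto
qed auto

lemma rep_zero_right [simp]: "rep x 0 = 0"
  using rep_add_right[of x 0 0] by simp

section \<open>Redundancies in the Fock representation\<close>

text \<open>As \<alpha> may fail to preserve 1, v S maps the unit on level j to v \<alpha>(1) and
  not to v. The discrepancy is a null vector, because a factor \<alpha>(1) under L comes out as a
  factor 1.\<close>

lemma fnorm_single_Suc_diff:
  "fnorm (Poly_Mapping.single (Suc j) v
    - rep (letter (Elem v) * letter Gen) (Poly_Mapping.single j 1)) = 0"
proof -
  define w where "w = v - v * \<alpha> 1"
  have "rep (letter (Elem v) * letter Gen) (Poly_Mapping.single j 1) = Poly_Mapping.single (Suc j) (v * \<alpha> 1)"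
    by (intro poly_mapping_eqI) (auto simp: rep_mult lookup_single when_def split: nat.splits)
  moreover have "fnorm (Poly_Mapping.single (Suc j) w) = 0"
  proof -
    have "star w * (v - v * \<alpha> 1) = star w * v - \<alpha> 1 * (star w * v)"
      by (simp add: right_diff_distrib ac_simps)
    then have "L (star w * w) = L (star w * v) - L (\<alpha> 1 * (star w * v))"
      by (simp add: L_diff flip: w_def)
    also have "\<dots> = 0" by (simp add: L_alpha)
    finally show ?thesis by (simp add: fnorm_def finner_single funpow_swap1)
  qed
  ultimately show ?thesis by (simp add: w_def single_diff)
qed

text \<open>b S S^* c kills the vacuum and acts on every higher level by the same formula, that of a
  rank one operator on M_L.\<close>

lemma entry_rank_sum: "entry (rep (rank_sum bs) f) n =
    (case n of 0 \<Rightarrow> 0 | Suc j \<Rightarrow> finite_rank bs (entry f (Suc j)))"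
proof (induction bs)
  case (Cons p bs)
  then show ?case
    by (cases p) (auto simp: rank_sum_def finite_rank_def rep_add rep_mult lookup_add split: nat.splits)
qed (simp add: rank_sum_def finite_rank_def split: nat.split)

context
  fixes a k X
  assumes X: "pcauchy (toeplitz_seminorm \<alpha> L) X" "k = pclass (toeplitz_seminorm \<alpha> L) X"
    and lim: "\<And>b. (\<lambda>n. toeplitz_seminorm \<alpha> L ((letter (Elem a) - X n) * letter (Elem b) * letter Gen)) \<longlonglongrightarrow> 0"
    and approx: "\<And>e. e > 0 \<Longrightarrow> \<exists>bs. \<forall>\<^sub>F n in sequentially. toeplitz_seminorm \<alpha> L (X n - rank_sum bs) < e"
begin

text \<open>Up to null vectors, a vector without vacuum component is a finite sum of vectors v S x,
  and on those the redundancy condition gives convergence. The limit is taken for each f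
  separately.\<close>

lemma redundancy_tendsto:
  assumes f: "entry f 0 = 0"
  shows "(\<lambda>n. fnorm (rep (letter (Elem a) - X n) f)) \<longlonglongrightarrow> 0"
proof -
  have single: "(\<lambda>n. fnorm (rep (letter (Elem a) - X n) (Poly_Mapping.single (Suc j) v))) \<longlonglongrightarrow> 0" for j v
  proof (rule tendsto_sandwich[OF _ _ tendsto_const])
    let ?s = "Poly_Mapping.single j (1::'a)" and ?y = "letter (Elem v) * letter Gen"
    let ?b = "\<lambda>n. toeplitz_seminorm \<alpha> L ((letter (Elem a) - X n) * letter (Elem v) * letter Gen) * fnorm ?s"
    show "?b \<longlonglongrightarrow> 0" using tendsto_mult_left_zero[OF lim[of v]] .
    show "\<forall>\<^sub>F n in sequentially.
        fnorm (rep (letter (Elem a) - X n) (Poly_Mapping.single (Suc j) v)) \<le> ?b n"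
    proof (intro always_eventually allI)
      fix n
      let ?x = "letter (Elem a) - X n" and ?t = "Poly_Mapping.single (Suc j) v"
      have "fnorm (rep ?x (?t - rep ?y ?s)) \<le> 0"
        using fnorm_rep_le[of ?x "?t - rep ?y ?s"] by (simp add: fnorm_single_Suc_diff)
      moreover have "fnorm (rep (?x * ?y) ?s) \<le> toeplitz_seminorm \<alpha> L (?x * ?y) * fnorm ?s"
        by (rule fnorm_rep_le)
      moreover have "rep ?x ?t = rep ?x (?t - rep ?y ?s) + rep (?x * ?y) ?s"
        by (simp add: rep_mult flip: rep_add_right)
      ultimately show "fnorm (rep ?x ?t) \<le> ?b n"
        using fnorm_triangle[of "rep ?x (?t - rep ?y ?s)" "rep (?x * ?y) ?s"] by (simp add: mult.assoc)
    qed
  qed simp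
  have "(\<lambda>n. fnorm (rep (letter (Elem a) - X n) (\<Sum>i\<in>I. Poly_Mapping.single i (entry f i)))) \<longlonglongrightarrow> 0"
    if "finite I" "0 \<notin> I" for I
    using that
  proof (induction I)
    case (insert i I)
    then obtain j where "i = Suc j" by (cases i) auto
    then have "(\<lambda>n. fnorm (rep (letter (Elem a) - X n) (Poly_Mapping.single i (entry f i)) +
        rep (letter (Elem a) - X n) (\<Sum>i\<in>I. Poly_Mapping.single i (entry f i)))) \<longlonglongrightarrow> 0"
      using insert single by (intro fnorm.tendsto_zero_add) auto
    then show ?case using insert by (simp add: rep_add_right)
  qed simp
  from this[of "Poly_Mapping.keys f"] show ?thesis
    using f poly_mapping_sum_single[of f] by (simp add: in_keys_iff)
qed

text \<open>Letting n tend to infinity for fixed f eliminates X: its distance to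
  \<open>rank_sum bs\<close> is eventually below e, its distance to a on f tends to zero. The
  resulting estimate is uniform in f.\<close>

lemma redundancy_rank_sum_le:
  assumes bs: "\<forall>\<^sub>F n in sequentially. toeplitz_seminorm \<alpha> L (X n - rank_sum bs) < e" and f: "entry f 0 = 0"
  shows "fnorm (rep (letter (Elem a) - rank_sum bs) f) \<le> e * fnorm f"
proof (rule tendsto_lowerbound)
  show "(\<lambda>n. fnorm (rep (letter (Elem a) - X n) f) + e * fnorm f) \<longlonglongrightarrow> e * fnorm f"
    using tendsto_add[OF redundancy_tendsto[OF f] tendsto_const] by simp
  show "\<forall>\<^sub>F n in sequentially. fnorm (rep (letter (Elem a) - rank_sum bs) f)
      \<le> fnorm (rep (letter (Elem a) - X n) f) + e * fnorm f"
    using bs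
  proof eventually_elim
    case (elim n)
    have "fnorm (rep (X n - rank_sum bs) f) \<le> e * fnorm f"
      using fnorm_rep_le[of "X n - rank_sum bs" f] mult_right_mono[OF less_imp_le[OF elim] fnorm_nonneg[of f]]
      by linarith
    then show ?case
      using fnorm_triangle[of "rep (letter (Elem a) - X n) f" "rep (X n - rank_sum bs) f"]
      by (simp flip: rep_add)
  qed
qed simp

text \<open>On level one the estimate for \<open>rank_sum\<close> says that left multiplication by a
  is a limit of finite rank maps.\<close>

lemma redundancy_compact_ideal:
  assumes "a \<in> range_ideal \<alpha>"
  shows "a \<in> compact_ideal"
proof -
  have "\<exists>bs. \<forall>m. pM (a * m - finite_rank bs m) \<le> e * pM m" if e: "e > 0" for e
  proof -
    obtain bs where bs: "\<forall>\<^sub>F n in sequentially. toeplitz_seminorm \<alpha> L (X n - rank_sum bs) < e"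
      using approx[OF e] by blast
    have "pM (a * m - finite_rank bs m) \<le> e * pM m" for m
    proof -
      have "finite_rank bs 0 = 0"
        using M_bounded_finite_rank[of bs] unfolding M_bounded_def by (metis diff_self)
      then have "rep (letter (Elem a) - rank_sum bs) (Poly_Mapping.single 1 m)
          = Poly_Mapping.single 1 (a * m - finite_rank bs m)"
        by (intro poly_mapping_eqI)
          (auto simp: rep_diff lookup_minus entry_rank_sum lookup_single when_def split: nat.splits)
      then show ?thesis
        using redundancy_rank_sum_le[OF bs, of "Poly_Mapping.single 1 m"]
        by (simp add: module_seminorm_eq lookup_single)
    qed
    then show ?thesis by blast
  qed
  then show ?thesis using assms by (simp add: compact_ideal_def)
qed

text \<open>An operator estimate, in contrast to the pointwise limit: comparison with
  \<open>rank_sum\<close>, which kills the vacuum, leaves a acting on the vacuum component and two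
  errors bounded uniformly in f.\<close>

lemma redundancy_eventually:
  assumes e: "e > 0"
  shows "\<forall>\<^sub>F n in sequentially. \<forall>f. fnorm (rep (letter (Elem a) - X n) f)
    \<le> fnorm (left_mult a (f - tail 1 f)) + e * fnorm f"
proof -
  define d where "d = e / 4"
  have d: "d > 0" using e by (simp add: d_def)
  obtain bs where bs: "\<forall>\<^sub>F n in sequentially. toeplitz_seminorm \<alpha> L (X n - rank_sum bs) < d"
    using approx[OF d] by blast
  then show ?thesis
  proof eventually_elim
    case (elim n)
    show ?case
    proof
      fix f
      let ?x = "letter (Elem a) - X n" and ?y = "letter (Elem a) - rank_sum bs" and ?g = "tail 1 f"
      have r: "fnorm (rep (rank_sum bs - X n) f) \<le> d * fnorm f"
        using fnorm_rep_le[of "rank_sum bs - X n" f] mult_right_mono[OF less_imp_le[OF elim] fnorm_nonneg[of f]]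
          fnorm.minus[of "rep (rank_sum bs - X n) f"] fnorm_rep_le[of "X n - rank_sum bs" f]
        by (simp flip: rep_minus)
      have "rep (rank_sum bs) (f - ?g) = 0"
      proof (intro poly_mapping_eqI)
        fix i
        have "finite_rank bs 0 = 0"
          using M_bounded_finite_rank[of bs] unfolding M_bounded_def by (metis diff_self)
        then show "entry (rep (rank_sum bs) (f - ?g)) i = entry 0 i"
          by (simp add: entry_rank_sum lookup_minus split: nat.split)
      qed
      then have y1: "rep ?y (f - ?g) = left_mult a (f - ?g)" by (simp add: rep_diff)
      have y2: "rep ?y f = rep ?y (f - ?g) + rep ?y ?g"
        using rep_add_right[of ?y "f - ?g" ?g] by simp
      have "rep ?x f = rep ?y f + rep (rank_sum bs - X n) f"
        using rep_add[of ?y "rank_sum bs - X n" f] by simp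
      then have "rep ?x f = left_mult a (f - ?g) + rep ?y ?g + rep (rank_sum bs - X n) f"
        unfolding y2 y1 .
      then have "fnorm (rep ?x f) \<le> fnorm (left_mult a (f - ?g)) + fnorm (rep ?y ?g)
          + fnorm (rep (rank_sum bs - X n) f)"
        using fnorm_triangle[of "left_mult a (f - ?g) + rep ?y ?g" "rep (rank_sum bs - X n) f"]
          fnorm_triangle[of "left_mult a (f - ?g)" "rep ?y ?g"] by simp
      moreover have "fnorm (rep ?y ?g) \<le> d * fnorm f"
        using redundancy_rank_sum_le[OF bs, of ?g] mult_left_mono[OF fnorm_tail[of 1 f] less_imp_le[OF d]]
        by simp
      moreover have "d * fnorm f + d * fnorm f \<le> e * fnorm f"
        using e by (simp add: d_def)
      ultimately show "fnorm (rep ?x f) \<le> fnorm (left_mult a (f - ?g)) + e * fnorm f"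
        using r by linarith
    qed
  qed
qed

text \<open>Only the vacuum component is left to control, so a cutoff family serves as soon as it
  makes a small there.\<close>

lemma redundancy_null_ideal_aux:
  assumes C: "cutoff_family C"
    and small: "\<And>e. e > 0 \<Longrightarrow> \<exists>c\<in>C. \<forall>f. fnorm (left_mult a (c f - tail 1 (c f))) \<le> e * fnorm f"
  shows "i_A \<alpha> L a \<ominus>\<^bsub>toeplitz \<alpha> L\<^esub> k \<in> null_ideal \<alpha> L (cut_seminorm C)"
proof -
  let ?pT = "toeplitz_seminorm \<alpha> L"
  interpret pT: ring_seminorm ?pT
    using toeplitz_cstar_seminorm_toeplitz_seminorm[of \<alpha> L]
    by (auto simp: toeplitz_cstar_seminorm_def intro: cstar_seminorm_ring_seminorm)
  have "(\<lambda>n. cut_seminorm C (letter (Elem a) - X n)) \<longlonglongrightarrow> 0"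
  proof (rule tendstoI)
    fix e :: real assume "e > 0"
    define d where "d = e / 4"
    have d: "d > 0" using \<open>e > 0\<close> by (simp add: d_def)
    obtain c where c: "c \<in> C" "\<And>f. fnorm (left_mult a (c f - tail 1 (c f))) \<le> d * fnorm f"
      using small[OF d] by blast
    have contr: "fnorm (c f) \<le> fnorm f" for f using C c(1) unfolding cutoff_family_def by blast
    show "\<forall>\<^sub>F n in sequentially. dist (cut_seminorm C (letter (Elem a) - X n)) 0 < e"
      using redundancy_eventually[OF d]
    proof eventually_elim
      case (elim n)
      have "cut_bound C (letter (Elem a) - X n) (2 * d)"
      proof (rule cut_boundI[OF _ c(1)])
        fix f
        have "fnorm (rep (letter (Elem a) - X n) (c f))
            \<le> fnorm (left_mult a (c f - tail 1 (c f))) + d * fnorm (c f)"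
          using elim by blast
        also have "\<dots> \<le> d * fnorm f + d * fnorm f"
          using c d contr by (intro add_mono mult_left_mono) auto
        finally show "fnorm (rep (letter (Elem a) - X n) (c f)) \<le> 2 * d * fnorm f" by simp
      qed (use d in simp)
      then have "cut_seminorm C (letter (Elem a) - X n) \<le> 2 * d" by (rule cut_seminorm_lower)
      moreover have "0 \<le> cut_seminorm C (letter (Elem a) - X n)"
        by (rule cut_seminorm_greatest[OF C]) (simp add: cut_bound_def)
      ultimately show ?case using \<open>e > 0\<close> by (simp add: d_def)
    qed
  qed
  moreover have "pcauchy ?pT (\<lambda>n. letter (Elem a) - X n)"
    using pT.pcauchy_add[OF pT.pcauchy_const pT.pcauchy_uminus[OF X(1)], of "letter (Elem a)"] by simp
  ultimately show ?thesis
    using X toeplitz_cstar_seminorm_cut_seminorm[OF C]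
    by (simp add: i_A_def cpl_embed_def toeplitz_minus_pclass pclass_null_ideal_iff)
qed

end

lemma redundancy_null_ideal:
  assumes a: "a \<in> range_ideal \<alpha>" and r: "redundancy \<alpha> L a k"
  shows "i_A \<alpha> L a \<ominus>\<^bsub>toeplitz \<alpha> L\<^esub> k \<in> null_ideal \<alpha> L (cut_seminorm unit_cutoffs)"
    and "i_A \<alpha> L a \<ominus>\<^bsub>toeplitz \<alpha> L\<^esub> k \<in> null_ideal \<alpha> L (cut_seminorm (range tail))"
proof -
  obtain X where X: "pcauchy (toeplitz_seminorm \<alpha> L) X" "k = pclass (toeplitz_seminorm \<alpha> L) X"
    "\<And>b. (\<lambda>n. toeplitz_seminorm \<alpha> L ((letter (Elem a) - X n) * letter (Elem b) * letter Gen)) \<longlonglongrightarrow> 0"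
    "\<And>e. e > 0 \<Longrightarrow> \<exists>bs. \<forall>\<^sub>F n in sequentially. toeplitz_seminorm \<alpha> L (X n - rank_sum bs) < e"
    using redundancyE[OF r] by metis
  have aK: "a \<in> compact_ideal" by (rule redundancy_compact_ideal[OF X a])
  show "i_A \<alpha> L a \<ominus>\<^bsub>toeplitz \<alpha> L\<^esub> k \<in> null_ideal \<alpha> L (cut_seminorm unit_cutoffs)"
  proof (rule redundancy_null_ideal_aux[OF X cutoff_family_unit])
    fix e :: real assume "e > 0"
    then have "e / 2 > 0" by simp
    \<comment> \<open>On the vacuum level the right action is plain multiplication, so cutoff and a
      meet there as the product a u. The vacuum component is bounded by twice the norm of f, hence e
      / 2.\<close>
    then obtain u where u: "norm u \<le> 1" "1 - u \<in> compact_ideal" "norm (a * u) \<le> e / 2"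
      using approximate_unit[of compact_ideal a] compact_ideal_mult compact_ideal_add aK by metis
    have "fnorm (left_mult a (right_mult u f - tail 1 (right_mult u f))) \<le> e * fnorm f" for f
    proof -
      have "left_mult a (right_mult u f - tail 1 (right_mult u f)) = left_mult (a * u) (f - tail 1 f)"
      proof (intro poly_mapping_eqI)
        fix i
        show "entry (left_mult a (right_mult u f - tail 1 (right_mult u f))) i
            = entry (left_mult (a * u) (f - tail 1 f)) i"
          by (cases i) (simp_all add: lookup_minus ac_simps)
      qed
      also have "fnorm \<dots> \<le> e / 2 * fnorm (f - tail 1 f)"
        using fnorm_left_mult u(3) by (meson fnorm_nonneg mult_right_mono order_trans)
      also have "\<dots> \<le> e / 2 * (2 * fnorm f)"
        using fnorm_triangle[of f "- tail 1 f"] fnorm_tail[of 1 f] \<open>e > 0\<close>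
        by (intro mult_left_mono) (auto simp: fnorm_minus)
      finally show ?thesis by simp
    qed
    then show "\<exists>c\<in>unit_cutoffs. \<forall>f. fnorm (left_mult a (c f - tail 1 (c f))) \<le> e * fnorm f"
      using u unfolding unit_cutoffs_def by blast
  qed
  show "i_A \<alpha> L a \<ominus>\<^bsub>toeplitz \<alpha> L\<^esub> k \<in> null_ideal \<alpha> L (cut_seminorm (range tail))"
  proof (rule redundancy_null_ideal_aux[OF X cutoff_family_tail])
    fix e :: real assume "e > 0"
    \<comment> \<open>\<open>tail 1\<close> removes the vacuum component altogether.\<close>
    then show "\<exists>c\<in>range tail. \<forall>f. fnorm (left_mult a (c f - tail 1 (c f))) \<le> e * fnorm f"
      by (intro bexI[of _ "tail 1"]) (auto simp: tail_tail)
  qed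
qed

text \<open>Both null ideals are closed and contain the generators, so they take part in the
  intersection that defines the redundancy ideal; a constant sequence is null only if its value has
  seminorm zero.\<close>

lemma redundancy_ideal_seminorm_zero:
  assumes "i_A \<alpha> L a \<in> redundancy_ideal \<alpha> L"
  shows "cut_seminorm unit_cutoffs (letter (Elem a)) = 0"
    and "cut_seminorm (range tail) (letter (Elem a)) = 0"
proof -
  let ?pT = "toeplitz_seminorm \<alpha> L"
  interpret pT: ring_seminorm ?pT
    using toeplitz_cstar_seminorm_toeplitz_seminorm[of \<alpha> L]
    by (auto simp: toeplitz_cstar_seminorm_def intro: cstar_seminorm_ring_seminorm)
  have "cut_seminorm C (letter (Elem a)) = 0"
    if C: "cutoff_family C" and red: "\<And>a k. a \<in> range_ideal \<alpha> \<Longrightarrow> redundancy \<alpha> L a k \<Longrightarrow>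
      i_A \<alpha> L a \<ominus>\<^bsub>toeplitz \<alpha> L\<^esub> k \<in> null_ideal \<alpha> L (cut_seminorm C)" for C
  proof -
    note p = toeplitz_cstar_seminorm_cut_seminorm[OF C]
    have "redundancy_ideal \<alpha> L \<subseteq> null_ideal \<alpha> L (cut_seminorm C)"
      unfolding redundancy_ideal_def closed_ideal_gen_def
      using null_ideal[OF p] null_ideal_closed[OF p] red by (intro Inter_lower) auto
    then have "pclass ?pT (\<lambda>n. letter (Elem a)) \<in> null_ideal \<alpha> L (cut_seminorm C)"
      using assms by (auto simp: i_A_def cpl_embed_def)
    then show ?thesis by (simp add: pclass_null_ideal_iff[OF p] LIMSEQ_const_iff)
  qed
  then show "cut_seminorm unit_cutoffs (letter (Elem a)) = 0"
    and "cut_seminorm (range tail) (letter (Elem a)) = 0"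
    using cutoff_family_unit cutoff_family_tail redundancy_null_ideal by blast+
qed

section \<open>Faithfulness and injectivity\<close>

text \<open>Call the element v. A small cutoff bound, tested on g at level n, makes u^* v u small,
  and with v = w^2 also w u and v u. So v is close to v (1 - u), which lies in the ideal.\<close>

lemma L_pow_in_compact_ideal:
  assumes "cut_seminorm unit_cutoffs (letter (Elem a)) = 0"
  shows "(L ^^ n) (star (a * g) * (a * g)) \<in> compact_ideal"
proof -
  define v where "v = (L ^^ n) (star (a * g) * (a * g))"
  have "cpositive v" unfolding v_def by (intro L_pow_cpositive) simp
  then obtain w where w: "cpositive w" "v = w * w" by (rule cpositive_sqrt)
  have "v \<in> compact_ideal"
  proof (rule compact_ideal_closed)
    fix e :: real assume "e > 0"
    let ?f = "Poly_Mapping.single n g"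
    define d where "d = e / (norm w * fnorm ?f + 1)"
    have d: "d > 0" "d * (norm w * fnorm ?f) \<le> e"
      using \<open>e > 0\<close> by (simp_all add: d_def add_nonneg_pos divide_le_eq mult_left_mono)
    obtain r where r: "r < d" "cut_bound unit_cutoffs (letter (Elem a)) r"
      using cut_seminorm_less[OF cutoff_family_unit, of "letter (Elem a)" d] assms d by auto
    then obtain u where u: "1 - u \<in> compact_ideal"
      "\<And>f. fnorm (left_mult a (right_mult u f)) \<le> r * fnorm f"
      unfolding cut_bound_def unit_cutoffs_def by auto
    have "left_mult a ?f = Poly_Mapping.single n (a * g)"
      by (intro poly_mapping_eqI) (simp add: lookup_single when_def)
    then have "(fnorm (left_mult a (right_mult u ?f)))\<^sup>2 = norm (star u * v * u)"
      by (simp add: left_right_mult fnorm_sq finner_right_mult finner_right_mult_left finner_single v_def)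
    also have "star u * v * u = star (w * u) * (w * u)"
      using w by (simp add: star_mult cpositive_selfadjoint ac_simps)
    finally have "norm (w * u) = fnorm (left_mult a (right_mult u ?f))"
      by (simp add: cstar_identity)
    then have "norm (w * u) \<le> d * fnorm ?f"
      using u(2)[of ?f] mult_right_mono[OF less_imp_le[OF r(1)] fnorm_nonneg[of ?f]] by simp
    then have "norm (v * u) \<le> norm w * (d * fnorm ?f)"
      unfolding w(2) mult.assoc by (meson mult_left_mono norm_ge_zero norm_mult_ineq order_trans)
    also have "\<dots> \<le> e" using d(2) by (simp add: ac_simps)
    finally have "norm (v - v * (1 - u)) \<le> e" by (simp add: right_diff_distrib)
    then show "\<exists>b\<in>compact_ideal. norm (v - b) \<le> e" using compact_ideal_mult[OF u(1)] by blast
  qed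
  then show ?thesis by (simp add: v_def)
qed

text \<open>Faithfulness speaks of L(w^* w) and not of L(w); for positive w the two are linked by 0
  \<le> w^2 \<le> norm(w) w.\<close>

lemma L_nonzero_of_faithful:
  assumes L: "faithful_on L (K_ideal \<alpha> L)" and w: "w \<in> compact_ideal" "cpositive w" "w \<noteq> 0"
  shows "L w \<noteq> 0"
proof
  assume "L w = 0"
  have "cpositive (norm w *\<^sub>R 1 - w)" using w by (simp add: cpositive_norm_minus cpositive_selfadjoint)
  then have "cpositive (L ((norm w *\<^sub>R 1 - w) * w))" using w by (intro L_cpositive cpositive_mult)
  moreover have "L (r *\<^sub>R w) = 0" for r
    using L_pow_scaleR[of 1 r w] \<open>L w = 0\<close> by simp
  ultimately have "cpositive (- L (w * w))" by (simp add: left_diff_distrib L_diff)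
  moreover have "cpositive (L (w * w))" using w by (intro L_cpositive cpositive_mult)
  ultimately have "L (star w * w) = 0" using w by (simp add: cpositive_antisym cpositive_selfadjoint)
  then show False using L w compact_ideal_subset by (auto simp: faithful_on_def)
qed

lemma eq_0_of_cut_seminorms:
  assumes L: "faithful_on L (K_ideal \<alpha> L)"
    and unit: "cut_seminorm unit_cutoffs (letter (Elem a)) = 0"
    and tails: "cut_seminorm (range tail) (letter (Elem a)) = 0"
  shows "a = 0"
proof (rule ccontr)
  assume "a \<noteq> 0"
  define h where "h = star a * a"
  \<comment> \<open>Any threshold strictly between 0 and the norm of h would do;
    \<open>sqrt r\<close> becomes the lower bound for a on the test vectors.\<close>
  define r where "r = norm h / 2"
  have nh: "norm h > 0" using \<open>a \<noteq> 0\<close> by (simp add: h_def cstar_identity)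
  then have r: "0 < r" "r < norm h" by (simp_all add: r_def)
  obtain g where g: "star g = g" "g * g \<noteq> 0" "cpositive (g * g * (h - r *\<^sub>R 1))"
    using spectral_cutoff[of h r] r by (auto simp: h_def)
  define m where "m = a * g"
  define w where "w n = (L ^^ n) (star m * m)" for n
  have mm: "star m * m = h * (g * g)" by (simp add: m_def h_def star_mult g ac_simps)
  have "star m * m \<noteq> 0"
  proof
    assume "star m * m = 0"
    \<comment> \<open>If h g^2 were 0, the cutoff inequality would make - r g^2 positive, against
      g^2 \<noteq> 0.\<close>
    then have "g * g * (h - r *\<^sub>R 1) = - (r *\<^sub>R (g * g))"
      unfolding mm by (simp add: right_diff_distrib mult.commute)
    then have "cpositive (- (r *\<^sub>R (g * g)))" using g(3) by simp
    moreover have "cpositive (r *\<^sub>R (g * g))"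
      using r g by (intro cpositive_scaleR cpositive_square) auto
    ultimately have "r *\<^sub>R (g * g) = 0" by (metis cpositive_antisym)
    then show False using r g by simp
  qed
  have wK: "w n \<in> compact_ideal" "cpositive (w n)" for n
    using L_pow_in_compact_ideal[OF unit, of n g] by (simp_all add: w_def m_def L_pow_cpositive)
  have w0: "w n \<noteq> 0" for n
  proof (induction n)
    case 0
    then show ?case using \<open>star m * m \<noteq> 0\<close> by (simp add: w_def)
  next
    case (Suc n)
    then show ?case using L_nonzero_of_faithful[OF L wK Suc] by (simp add: w_def)
  qed
  have "sqrt r \<le> cut_seminorm (range tail) (letter (Elem a))"
  proof (rule cut_seminorm_greatest[OF cutoff_family_tail])
    fix s assume "cut_bound (range tail) (letter (Elem a)) s"
    then obtain N where s: "0 \<le> s" "\<And>f. fnorm (left_mult a (tail N f)) \<le> s * fnorm f"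
      unfolding cut_bound_def by auto
    \<comment> \<open>The test vector sits on level N, so the cutoff fixes it, and its squared norm
      is the norm of w N, which is nonzero.\<close>
    let ?f = "Poly_Mapping.single N m"
    have f1: "tail N ?f = ?f" by (intro poly_mapping_eqI) (auto simp: lookup_single when_def)
    have f2: "left_mult a ?f = Poly_Mapping.single N (a * m)"
      by (intro poly_mapping_eqI) (simp add: lookup_single when_def)
    have nf: "(fnorm ?f)\<^sup>2 = norm (w N)" by (simp add: fnorm_sq finner_single w_def)
    \<comment> \<open>Multiplying the cutoff inequality by h gives (a m)^* (a m) \<ge> r m^* m,
      which \<open>L ^^ N\<close> preserves.\<close>
    have "cpositive (h * (g * g * (h - r *\<^sub>R 1)))"
      by (rule cpositive_mult[OF _ g(3)]) (simp add: h_def)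
    also have "h * (g * g * (h - r *\<^sub>R 1)) = star (a * m) * (a * m) - r *\<^sub>R (star m * m)"
    proof -
      have "star (a * m) * (a * m) = h * (star m * m)" by (simp add: h_def star_mult ac_simps)
      moreover have "h * (g * g * (h - r *\<^sub>R 1)) = h * (h * (g * g)) - r *\<^sub>R (h * (g * g))"
        by (simp add: right_diff_distrib mult.commute)
      ultimately show ?thesis by (simp only: mm)
    qed
    finally have "cpositive ((L ^^ N) (star (a * m) * (a * m)) - r *\<^sub>R w N)"
      unfolding w_def L_pow_scaleR[symmetric] L_pow_diff[symmetric] by (rule L_pow_cpositive)
    then have "norm (r *\<^sub>R w N) \<le> norm ((L ^^ N) (star (a * m) * (a * m)))"
      using r wK by (intro cpositive_norm_mono cpositive_scaleR) auto
    then have "r * (fnorm ?f)\<^sup>2 \<le> (fnorm (left_mult a ?f))\<^sup>2"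
      using r by (simp add: nf) (simp add: f2 fnorm_sq finner_single)
    also have "\<dots> \<le> (s * fnorm ?f)\<^sup>2" using s(2)[of ?f] f1 by (intro power_mono) auto
    finally have "r * (fnorm ?f)\<^sup>2 \<le> s\<^sup>2 * (fnorm ?f)\<^sup>2" by (simp add: power_mult_distrib)
    moreover have "(fnorm ?f)\<^sup>2 > 0" unfolding nf using w0 by simp
    ultimately have "r \<le> s\<^sup>2" by simp
    then show "sqrt r \<le> s" using s by (simp add: real_le_lsqrt)
  qed
  then show False using tails r by simp
qed

theorem inj_j_A_iff_faithful: "inj (j_A \<alpha> L) \<longleftrightarrow> faithful_on L (K_ideal \<alpha> L)"
proof
  assume inj: "inj (j_A \<alpha> L)"
  show "faithful_on L (K_ideal \<alpha> L)"
    unfolding faithful_on_def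
  proof (intro ballI impI)
    fix a assume a: "a \<in> K_ideal \<alpha> L" "L (star a * a) = 0"
    have "L (star (a * b) * (a * b)) = 0" for b
    proof -
      \<comment> \<open>By commutativity a b = b a, and left multiplication by b preserves null
        vectors of the form.\<close>
      have "pM (b * a) = 0"
        using pM_mult[of b a] pM.nonneg[of "b * a"] a(2) by (simp add: module_seminorm_def)
      then show ?thesis by (simp add: module_seminorm_def mult.commute)
    qed
    then have "i_A \<alpha> L a \<in> redundancy_ideal \<alpha> L"
      using a by (intro i_A_in_redundancy_ideal) (auto simp: K_ideal_def)
    then show "a = 0" using inj inj_j_A_iff by blast
  qed
next
  assume "faithful_on L (K_ideal \<alpha> L)"
  then show "inj (j_A \<alpha> L)"
    using redundancy_ideal_seminorm_zero eq_0_of_cut_seminorms unfolding inj_j_A_iff by blast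
qed

end

theorem corollary4p3:
  fixes \<alpha> L :: "'a::comm_unital_cstar_algebra \<Rightarrow> 'a"
  assumes "star_hom \<alpha>" and "transfer_operator \<alpha> L"
  shows "inj (j_A \<alpha> L) \<longleftrightarrow> faithful_on L (K_ideal \<alpha> L)"
proof -
  interpret exel_system \<alpha> L by standard fact+
  show ?thesis by (rule inj_j_A_iff_faithful)
qed

end
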